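(* Let $(A, \sim_A)$ and $(B, \sim_B)$ be finite simple graphs, and let $R = `(\sim_A)$ and $S = `(\sim_B)$. Let $H$ be a nonzero finite-dimensional Hilbert space, and let $\mathcal X$ be the quantum set defined by $\mathrm{At}(\mathcal X) = \{H\}$. Consider the one-to-one correspondence between families of projections $(p_{ab} \in L(H) \,|\, a \in A,\, b \in B)$ such that $\sum_{b \in B} p_{ab} = 1_H$ for all $a \in A$ and functions $F: \mathcal X \times `A \to `B$, given by $F(H \otimes \mathbb C_a, \mathbb C_b)= L(H \otimes \mathbb C_a, \mathbb C_b)\cdot (p_{ab} \otimes 1)$ for $a \in A$ and $b \in B$. This correspondence restricts to a one-to-one correspondence between families of projections $(p_{ab} \in L(H) \,|\, a \in A, \, b \in B)$ witnessing $A \xrightarrow{q} B$ and functions $F: \mathcal X \times `A \to `B$ satisfying $$[\![(\forall (x = x_* ) \in \mathcal X \times \mathcal X^* )\, (\forall (a_1 = a_{1*}) \in `A \times `A^* )\,(\forall (a_2 = a_{2*}) \in `A \times `A^* )\, (\widehat R (a_{1},a_{2*}) \to (\widehat S)_* (F_*(x_*,a_{1*}), F(x,a_{2})))]\!] = \top.$$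
   Context: Witnessing. A finite simple graph $(A,\sim_A)$ is a finite set with its adjacency relation. A family of projections $(p_{ab}\in L(H)\,|\,a\in A,b\in B)$ witnesses $A\xrightarrow{q}B$ if (i) $\sum_{b\in B}p_{ab}=1_H$ for all $a\in A$, and (ii) $p_{a_1b_1}\cdot p_{a_2b_2}=0$ for all $a_1,a_2\in A$ and $b_1,b_2\in B$ satisfying either ($a_1=a_2$ and $b_1\ne b_2$) or ($a_1\sim_A a_2$ and $b_1\not\sim_B b_2$). Operators. Hilbert spaces are complex. $L(H,K)$ is the space of bounded operators $H\to K$, $L(H)=L(H,H)$, $H^*=L(H,\mathbb C)$. For $a\in L(H,K)$: $a^\dagger\in L(K,H)$ is the Hermitian adjoint, $a^*\in L(K^*,H^* )$ the transpose, $a_*=(a^\dagger)^*\in L(H^*,K^* )$. Products of subspaces of operators denote linear spans of products. The identifications $X^{**}=X$, $(X\otimes Y)^*=X^*\otimes Y^*$, $\mathbb C^*=\mathbb C$, $X\otimes\mathbb C=X$ are used. Quantum sets. A quantum set $\mathcal X$ is an object uniquely determined by a set $\mathrm{At}(\mathcal X)$ of nonzero finite-dimensional Hilbert spaces, its atoms. $\mathcal X\times\mathcal Y$ has atoms $X\otimes Y$; $\mathcal X^*$ has atoms $X^*$; $\mathbf 1$ (the empty product) has the single atom $\mathbb C$. For an ordinary set $A$, $`A$ has exactly one one-dimensional atom $\mathbb C_a$ for each $a\in A$ (distinct for distinct $a$); $`A^*$ means $(`A)^*$. Binary relations. A binary relation $R$ from $\mathcal X$ to $\mathcal Y$ is a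 choice of subspaces $R(X,Y)\le L(X,Y)$ for all atoms $X,Y$. Order, joins, meets and complement $\neg$ are componentwise (inclusion, span, intersection, orthogonal complement for $\langle a|b\rangle=\mathrm{Tr}(a^\dagger b)$); $\top$ and $\bot$ (or $\top_{\mathcal X}$, $\bot_{\mathcal X}$ for $\mathcal Y=\mathbf 1$) are the largest and smallest. $(S\circ R)(X,Z)=\sum_Y S(Y,Z)\cdot R(X,Y)$; $(R\times S)(X\otimes X',Y\otimes Y')=R(X,Y)\otimes S(X',Y')$; $R^\dagger(Y,X)=\{r^\dagger: r\in R(X,Y)\}$; $R_*(X^*,Y^* )=\{r_*: r\in R(X,Y)\}$; $I_{\mathcal X}(X,X)=\mathbb C1_X$, with other components $0$. A function $F:\mathcal X\to\mathcal Y$ is a binary relation with $F^\dagger\circ F\ge I_{\mathcal X}$ and $F\circ F^\dagger\le I_{\mathcal Y}$. For an ordinary binary relation $r\subseteq A\times B$, $`r(\mathbb C_a,\mathbb C_b)=L(\mathbb C_a,\mathbb C_b)$ if $(a,b)\in r$ and $0$ otherwise. A relation of arity $(\mathcal X_1,\dots,\mathcal X_n)$ is a binary relation $R$ from $\mathcal X_1\times\cdots\times\mathcal X_n$ to $\mathbf 1$; write $R(X_1\otimes\cdots\otimes X_n)$ for $R(X_1\otimes\cdots\otimes X_n,\mathbb C)$; its conjugate $R_*$ has arity $(\mathcal X_1^*,\dots,\mathcal X_n^* )$. The equality relation $E_{\mathcal X}$ of arity $(\mathcal X,\mathcal X^* )$ has $E_{\mathcal X}(X\otimes X^* )=\mathbb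 C\epsilon_X$, with $\epsilon_X:X\otimes X^*\to\mathbb C$ evaluation, and $E_{\mathcal X}(X_1\otimes X_2^* )=0$ for $X_1\ne X_2$. For a binary relation $B$ from $\mathcal X$ to $\mathcal Y$, $\widehat B=E_{\mathcal Y}\circ(B\times I_{\mathcal Y^*})$, of arity $(\mathcal X,\mathcal Y^* )$; so $(\widehat B)_*$ has arity $(\mathcal X^*,\mathcal Y)$. Formulas. Each quantum set is a sort with infinitely many variables. Nonduplicating terms of sort $\mathcal Y$: variables of sort $\mathcal Y$, and $F(s_1,\dots,s_m)$ with $F:\mathcal X_1\times\cdots\times\mathcal X_m\to\mathcal Y$ a function and $s_i$ nonduplicating terms of sorts $\mathcal X_i$, no two sharing a variable. Nonduplicating atomic formulas: $R(t_1,\dots,t_n)$ with $R$ a relation of arity $(\mathcal Y_1,\dots,\mathcal Y_n)$ and $t_i$ nonduplicating terms of sorts $\mathcal Y_i$, no two sharing a variable. Formulas are built from these with connectives and quantifiers. Interpretation. For distinct variables $x_i$ of sorts $\mathcal X_i$ including the free variables of $\phi$, $[\![\phi]\!]=[\![(x_1,\dots,x_n)\in\mathcal X_1\times\cdots\times\mathcal X_n\,|\,\phi]\!]$ is a relation of arity $(\mathcal X_1,\dots,\mathcal X_n)$ (for a sentence, $\top$ or $\bot$), defined recursively. For a permutation $\pi$ of $\{1,\dots,n\}$, $m\le n$ and $R$ of arity $(\mathcal X_{\pi(1)},\dots,\mathcal X_{\pi(m)})$, $[\![R(x_{\pi(1)},\dots,x_{\pi(m)})]\!](X_1\otimes\cdots\otimes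 X_n)=(R\times\top_{\mathcal X_{\pi(m+1)}}\times\cdots\times\top_{\mathcal X_{\pi(n)}})(X_{\pi(1)}\otimes\cdots\otimes X_{\pi(n)})\cdot u_\pi$, where $u_\pi$ is the unitary permuting tensor factors. $[\![\neg\phi]\!]=\neg[\![\phi]\!]$; $[\![\phi\wedge\psi]\!]=[\![\phi]\!]\wedge[\![\psi]\!]$; $[\![(x_1,\dots,x_n)\,|\,(\forall x\in\mathcal X)\,\phi]\!]=\sup\{R \text{ of arity }(\mathcal X_1,\dots,\mathcal X_n): \top_{\mathcal X}\times R\le[\![(x,x_1,\dots,x_n)\,|\,\phi]\!]\}$. Abbreviations: $\phi\vee\psi$ is $\neg(\neg\phi\wedge\neg\psi)$; $\exists$ is $\neg\forall\neg$; $\phi\to\psi$ is $\neg\phi\vee(\phi\wedge\psi)$; $(\forall(x=x_* )\in\mathcal X\times\mathcal X^* )\,\phi$ is $(\forall x_*\in\mathcal X^* )(\forall x\in\mathcal X)(E_{\mathcal X}(x,x_* )\to\phi)$, with $x,x_*$ distinct variables; $(\exists(x=x_* )\in\mathcal X\times\mathcal X^* )\,\phi$ is $\neg(\forall(x=x_* )\in\mathcal X\times\mathcal X^* )\,\neg\phi$. If not all $t_i$ are variables, $R(t_1,\dots,t_n)$ abbreviates $(\exists(y_n=y_{n*})\in\mathcal Y_n\times\mathcal Y_n^* )\cdots(\exists(y_1=y_{1*})\in\mathcal Y_1\times\mathcal Y_1^* )(R(y_1,\dots,y_n)\wedge t_1\curvearrowright y_{1*}\wedge\cdots\wedge t_n\curvearrowright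 y_{n*})$ with all $y_i,y_{i*}$ new variables, where $t\curvearrowright y_*$ is $E_{\mathcal Y}(t,y_* )$ if $t$ is a variable and $\widehat F(s_1,\dots,s_m,y_* )$ if $t=F(s_1,\dots,s_m)$. *)

theory Defs
  imports Complex_Main "HOL-Library.FuncSet" "Jordan_Normal_Form.VS_Connect"
begin

section \<open>Finite-dimensional Hilbert spaces\<close>

text \<open>
  A Hilbert space is a module record over the field of complex numbers, extended by an inner
  product \<open>\<langle>x|y\<rangle>\<close> that is antilinear in \<open>x\<close> and linear in \<open>y\<close>. Completeness and boundedness
  of linear maps are automatic in finite dimension.
\<close>

record 'v hilb = "(complex, 'v) module" +
  ip :: "'v \<Rightarrow> 'v \<Rightarrow> complex"

definition fd_hilbert :: "'v hilb \<Rightarrow> bool" where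
  "fd_hilbert X \<longleftrightarrow>
     vectorspace class_ring X \<and> vectorspace.fin_dim class_ring X \<and>
     (\<forall>x\<in>carrier X. \<forall>y\<in>carrier X. ip X x y = cnj (ip X y x)) \<and>
     (\<forall>x\<in>carrier X. \<forall>y\<in>carrier X. \<forall>z\<in>carrier X. ip X x (y \<oplus>\<^bsub>X\<^esub> z) = ip X x y + ip X x z) \<and>
     (\<forall>x\<in>carrier X. \<forall>y\<in>carrier X. \<forall>c. ip X x (c \<odot>\<^bsub>X\<^esub> y) = c * ip X x y) \<and>
     (\<forall>x\<in>carrier X. x \<noteq> \<zero>\<^bsub>X\<^esub> \<longrightarrow> 0 < Re (ip X x x))"

definition is_onb :: "'v hilb \<Rightarrow> 'v set \<Rightarrow> bool" where
  "is_onb X E \<longleftrightarrow> E \<subseteq> carrier X \<and> finite E \<and>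
     (\<forall>e\<in>E. \<forall>f\<in>E. ip X e f = (if e = f then 1 else 0)) \<and>
     (\<forall>x\<in>carrier X. (\<forall>e\<in>E. ip X e x = 0) \<longrightarrow> x = \<zero>\<^bsub>X\<^esub>)"

definition onb :: "'v hilb \<Rightarrow> 'v set" where
  "onb X = (SOME E. is_onb X E)"

text \<open>
  The dual space \<open>X\<^sup>*\<close>, with the functional \<open>\<langle>x|\<close> represented by its Riesz vector \<open>x\<close>:
  then \<open>c \<langle>x| = \<langle>cnj c x|\<close> and the inner product of \<open>\<langle>x|\<close> and \<open>\<langle>y|\<close> is \<open>\<langle>y|x\<rangle>\<close>.
  With this representation \<open>X\<^sup>*\<^sup>* = X\<close> holds on the nose.
\<close>

definition dual :: "'v hilb \<Rightarrow> 'v hilb" where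
  "dual X = X\<lparr>smult := \<lambda>c x. cnj c \<odot>\<^bsub>X\<^esub> x, ip := \<lambda>x y. ip X y x\<rparr>"

lemma dual_dual: "dual (dual X) = X"
  by (simp add: dual_def)

definition projections :: "'v hilb \<Rightarrow> ('v \<Rightarrow> 'v) set" where
  "projections H = {p \<in> LinearCombinations.module_hom class_ring H H \<inter> extensional (carrier H).
     (\<forall>x\<in>carrier H. p (p x) = p x) \<and>
     (\<forall>x\<in>carrier H. \<forall>y\<in>carrier H. ip H x (p y) = ip H (p x) y)}"


section \<open>Operators between tensor products\<close>

text \<open>
  A list \<open>[X\<^sub>1, \<dots>, X\<^sub>n]\<close> stands for \<open>X\<^sub>1 \<otimes> \<dots> \<otimes> X\<^sub>n\<close>, the empty list for the scalars. By the
  universal property of the tensor product, an operator \<open>k\<close> from \<open>Xs\<close> to \<open>Ys\<close> is the same thing as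
  its matrix elements on product vectors,
    \<open>k ys xs = \<langle>y\<^sub>1 \<otimes> \<dots> \<otimes> y\<^sub>m | k (x\<^sub>1 \<otimes> \<dots> \<otimes> x\<^sub>n)\<rangle>\<close>,
  which may be any function that is linear in each \<open>x\<^sub>i\<close> and antilinear in each \<open>y\<^sub>j\<close>; it is
  extended by 0 to lists outside the spaces. Associativity and unit laws of the tensor product, and
  \<open>(X \<otimes> Y)\<^sup>* = X\<^sup>* \<otimes> Y\<^sup>*\<close>, are then identities.
\<close>

type_synonym 'v opr = "'v list \<Rightarrow> 'v list \<Rightarrow> complex"

abbreviation vecs :: "'v hilb list \<Rightarrow> 'v list set" where
  "vecs Xs \<equiv> listset (map carrier Xs)"

definition opers :: "'v hilb list \<Rightarrow> 'v hilb list \<Rightarrow> 'v opr set" where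
  "opers Xs Ys = {k.
     (\<forall>ys xs. \<not> (ys \<in> vecs Ys \<and> xs \<in> vecs Xs) \<longrightarrow> k ys xs = 0) \<and>
     (\<forall>ys\<in>vecs Ys. \<forall>xs\<in>vecs Xs.
        (\<forall>i<length Xs. \<forall>u\<in>carrier (Xs ! i). \<forall>v\<in>carrier (Xs ! i). \<forall>c.
           k ys (xs[i := u \<oplus>\<^bsub>Xs ! i\<^esub> v]) = k ys (xs[i := u]) + k ys (xs[i := v]) \<and>
           k ys (xs[i := c \<odot>\<^bsub>Xs ! i\<^esub> u]) = c * k ys (xs[i := u])) \<and>
        (\<forall>j<length Ys. \<forall>u\<in>carrier (Ys ! j). \<forall>v\<in>carrier (Ys ! j). \<forall>c.
           k (ys[j := u \<oplus>\<^bsub>Ys ! j\<^esub> v]) xs = k (ys[j := u]) xs + k (ys[j := v]) xs \<and>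
           k (ys[j := c \<odot>\<^bsub>Ys ! j\<^esub> u]) xs = cnj c * k (ys[j := u]) xs))}"

definition op_zero :: "'v opr" where
  "op_zero = (\<lambda>ys xs. 0)"

definition op_of :: "'v hilb \<Rightarrow> 'v hilb \<Rightarrow> ('v \<Rightarrow> 'v) \<Rightarrow> 'v opr" where
  "op_of X Y f = (\<lambda>ys xs. if ys \<in> vecs [Y] \<and> xs \<in> vecs [X] then ip Y (hd ys) (f (hd xs)) else 0)"

definition op_id :: "'v hilb list \<Rightarrow> 'v opr" where
  "op_id Xs = (\<lambda>ys xs. if ys \<in> vecs Xs \<and> xs \<in> vecs Xs
     then \<Prod>i<length Xs. ip (Xs ! i) (ys ! i) (xs ! i) else 0)"

text \<open>The product \<open>s \<cdot> r\<close> of \<open>r\<close>, with target \<open>Ys\<close>, and \<open>s\<close>, with source \<open>Ys\<close>. By Parseval's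
  identity it does not depend on the orthonormal bases chosen by \<^const>\<open>onb\<close>.\<close>

definition op_mult :: "'v hilb list \<Rightarrow> 'v opr \<Rightarrow> 'v opr \<Rightarrow> 'v opr" where
  "op_mult Ys s r = (\<lambda>zs xs. \<Sum>ys\<in>listset (map onb Ys). s zs ys * r ys xs)"

text \<open>The tensor product \<open>r \<otimes> s\<close>, where \<open>r\<close> is an operator from \<open>Xs\<close> to \<open>Ys\<close>.\<close>

definition op_tensor :: "'v hilb list \<Rightarrow> 'v hilb list \<Rightarrow> 'v opr \<Rightarrow> 'v opr \<Rightarrow> 'v opr" where
  "op_tensor Xs Ys r s = (\<lambda>ys xs.
     r (take (length Ys) ys) (take (length Xs) xs) * s (drop (length Ys) ys) (drop (length Xs) xs))"

definition op_adj :: "'v opr \<Rightarrow> 'v opr" where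
  "op_adj k = (\<lambda>xs ys. cnj (k ys xs))"

text \<open>
  \<open>k\<^sub>* = (k\<^sup>\<dagger>)\<^sup>*\<close> maps \<open>\<langle>x|\<close> to \<open>\<langle>k x|\<close>, and the inner product of \<open>\<langle>y|\<close> and \<open>\<langle>k x|\<close> is
  \<open>\<langle>k x|y\<rangle> = cnj \<langle>y|k x\<rangle>\<close>.
\<close>

definition op_conj :: "'v opr \<Rightarrow> 'v opr" where
  "op_conj k = (\<lambda>ys xs. cnj (k ys xs))"

definition op_trace :: "'v hilb list \<Rightarrow> 'v opr \<Rightarrow> complex" where
  "op_trace Xs k = (\<Sum>xs\<in>listset (map onb Xs). k xs xs)"

text \<open>The evaluation \<open>X \<otimes> X\<^sup>* \<rightarrow> \<complex>\<close>, \<open>x \<otimes> \<langle>y| \<mapsto> \<langle>y|x\<rangle>\<close>.\<close>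

definition op_eval :: "'v hilb \<Rightarrow> 'v opr" where
  "op_eval X = (\<lambda>ys xs. if ys \<in> vecs [] \<and> xs \<in> vecs [X, dual X] then ip X (xs ! 1) (xs ! 0) else 0)"

definition op_subspace :: "'v opr set \<Rightarrow> bool" where
  "op_subspace V \<longleftrightarrow> op_zero \<in> V \<and>
     (\<forall>k\<in>V. \<forall>l\<in>V. (\<lambda>ys xs. k ys xs + l ys xs) \<in> V) \<and>
     (\<forall>k\<in>V. \<forall>c. (\<lambda>ys xs. c * k ys xs) \<in> V)"

definition op_span :: "'v opr set \<Rightarrow> 'v opr set" where
  "op_span S = op_subspace hull S"


section \<open>Quantum sets and their binary relations\<close>

text \<open>
  A quantum set is given by its set of atoms; that these are nonzero and satisfy
  \<^const>\<open>fd_hilbert\<close> is not part of the type and has to be assumed. A list of quantum sets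
  stands for their product, whose atoms are the lists of atoms taken from the factors.
\<close>

type_synonym 'v qset = "'v hilb set"

definition qdual :: "'v qset \<Rightarrow> 'v qset" where
  "qdual Q = dual ` Q"

record 'v brel =
  src :: "'v qset list"
  tgt :: "'v qset list"
  cmp :: "'v hilb list \<Rightarrow> 'v hilb list \<Rightarrow> 'v opr set"

text \<open>Off the atoms of source and target, components are 0, so that equality of relations is equality
  of their components on atoms.\<close>

definition is_brel :: "'v brel \<Rightarrow> bool" where
  "is_brel R \<longleftrightarrow> (\<forall>Xs Ys.
     if Xs \<in> listset (src R) \<and> Ys \<in> listset (tgt R)
     then op_subspace (cmp R Xs Ys) \<and> cmp R Xs Ys \<subseteq> opers Xs Ys
     else cmp R Xs Ys = {op_zero})"

definition mk_rel ::
  "'v qset list \<Rightarrow> 'v qset list \<Rightarrow> ('v hilb list \<Rightarrow> 'v hilb list \<Rightarrow> 'v opr set) \<Rightarrow> 'v brel" where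
  "mk_rel Qs Ps f = \<lparr>src = Qs, tgt = Ps,
     cmp = (\<lambda>Xs Ys. if Xs \<in> listset Qs \<and> Ys \<in> listset Ps then f Xs Ys else {op_zero})\<rparr>"

definition rel_le :: "'v brel \<Rightarrow> 'v brel \<Rightarrow> bool" where
  "rel_le R S \<longleftrightarrow> src R = src S \<and> tgt R = tgt S \<and> (\<forall>Xs Ys. cmp R Xs Ys \<subseteq> cmp S Xs Ys)"

definition rel_top :: "'v qset list \<Rightarrow> 'v qset list \<Rightarrow> 'v brel" where
  "rel_top Qs Ps = mk_rel Qs Ps opers"

definition rel_inf :: "'v brel \<Rightarrow> 'v brel \<Rightarrow> 'v brel" where
  "rel_inf R S = mk_rel (src R) (tgt R) (\<lambda>Xs Ys. cmp R Xs Ys \<inter> cmp S Xs Ys)"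

definition rel_Sup :: "'v qset list \<Rightarrow> 'v qset list \<Rightarrow> 'v brel set \<Rightarrow> 'v brel" where
  "rel_Sup Qs Ps \<R> = mk_rel Qs Ps (\<lambda>Xs Ys. op_span (\<Union>R\<in>\<R>. cmp R Xs Ys))"

definition rel_neg :: "'v brel \<Rightarrow> 'v brel" where
  "rel_neg R = mk_rel (src R) (tgt R) (\<lambda>Xs Ys.
     {k \<in> opers Xs Ys. \<forall>l\<in>cmp R Xs Ys. op_trace Xs (op_mult Ys (op_adj l) k) = 0})"

definition rel_comp :: "'v brel \<Rightarrow> 'v brel \<Rightarrow> 'v brel" where
  "rel_comp S R = mk_rel (src R) (tgt S) (\<lambda>Xs Zs.
     op_span {op_mult Ys s r | Ys s r. Ys \<in> listset (tgt R) \<and> s \<in> cmp S Ys Zs \<and> r \<in> cmp R Xs Ys})"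

definition rel_times :: "'v brel \<Rightarrow> 'v brel \<Rightarrow> 'v brel" where
  "rel_times R S = mk_rel (src R @ src S) (tgt R @ tgt S) (\<lambda>Xs Ys.
     let n = length (src R); m = length (tgt R)
     in op_span {op_tensor (take n Xs) (take m Ys) r s | r s.
          r \<in> cmp R (take n Xs) (take m Ys) \<and> s \<in> cmp S (drop n Xs) (drop m Ys)})"

definition rel_adj :: "'v brel \<Rightarrow> 'v brel" where
  "rel_adj R = mk_rel (tgt R) (src R) (\<lambda>Ys Xs. op_adj ` cmp R Xs Ys)"

definition conj_rel :: "'v brel \<Rightarrow> 'v brel" where
  "conj_rel R = mk_rel (map qdual (src R)) (map qdual (tgt R))
     (\<lambda>Xs Ys. op_conj ` cmp R (map dual Xs) (map dual Ys))"

definition rel_id :: "'v qset list \<Rightarrow> 'v brel" where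
  "rel_id Qs = mk_rel Qs Qs (\<lambda>Xs Ys. if Xs = Ys then op_span {op_id Xs} else {op_zero})"

definition is_function :: "'v brel \<Rightarrow> bool" where
  "is_function F \<longleftrightarrow> is_brel F \<and>
     rel_le (rel_id (src F)) (rel_comp (rel_adj F) F) \<and>
     rel_le (rel_comp F (rel_adj F)) (rel_id (tgt F))"

definition qfunctions :: "'v qset list \<Rightarrow> 'v qset list \<Rightarrow> 'v brel set" where
  "qfunctions Qs Ps = {F. is_function F \<and> src F = Qs \<and> tgt F = Ps}"

text \<open>A relation of arity \<open>Qs\<close> is a binary relation from \<open>Qs\<close> to the empty product.\<close>

definition rels :: "'v qset list \<Rightarrow> 'v brel set" where
  "rels Qs = {R. is_brel R \<and> src R = Qs \<and> tgt R = []}"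

definition rel_eq :: "'v qset \<Rightarrow> 'v brel" where
  "rel_eq Q = mk_rel [Q, qdual Q] []
     (\<lambda>Xs Ys. if Xs ! 1 = dual (Xs ! 0) then op_span {op_eval (Xs ! 0)} else {op_zero})"

text \<open>\<open>hat B\<close>, for \<open>B\<close> with a single target factor.\<close>

definition hat :: "'v brel \<Rightarrow> 'v brel" where
  "hat B = (let Q = hd (tgt B) in rel_comp (rel_eq Q) (rel_times B (rel_id [qdual Q])))"

text \<open>
  For an ordinary set \<open>A\<close>, a choice \<open>C\<close> of pairwise distinct one-dimensional atoms \<open>C a\<close>
  makes \<open>C ` A\<close> the associated quantum set.
\<close>

definition line_atoms :: "('a \<Rightarrow> 'v hilb) \<Rightarrow> 'a set \<Rightarrow> bool" where
  "line_atoms C A \<longleftrightarrow> inj_on C A \<and>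
     (\<forall>a\<in>A. fd_hilbert (C a) \<and> vectorspace.dim class_ring (C a) = 1)"

definition ord_rel ::
  "('a \<Rightarrow> 'v hilb) \<Rightarrow> 'a set \<Rightarrow> ('b \<Rightarrow> 'v hilb) \<Rightarrow> 'b set \<Rightarrow> ('a \<times> 'b) set \<Rightarrow> 'v brel" where
  "ord_rel C A D B r = mk_rel [C ` A] [D ` B] (\<lambda>Xs Ys.
     if \<exists>a\<in>A. \<exists>b\<in>B. (a, b) \<in> r \<and> Xs = [C a] \<and> Ys = [D b] then opers Xs Ys else {op_zero})"


section \<open>Formulas and their interpretation\<close>

text \<open>A variable is a sort together with an index.\<close>

type_synonym 'v var = "'v qset \<times> nat"

abbreviation sort_of :: "'v var \<Rightarrow> 'v qset" where
  "sort_of \<equiv> fst"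

datatype (dead 'v) trm =
    is_Var: Var (var_of: "'v var")
  | App "'v brel" "'v trm list"

datatype (dead 'v) fm =
    Atm "'v brel" "'v trm list"
  | Neg "'v fm"
  | Conj "'v fm" "'v fm"
  | All "'v var" "'v fm"

definition Disj :: "'v fm \<Rightarrow> 'v fm \<Rightarrow> 'v fm" where
  "Disj \<phi> \<psi> = Neg (Conj (Neg \<phi>) (Neg \<psi>))"

definition Impl :: "'v fm \<Rightarrow> 'v fm \<Rightarrow> 'v fm" where
  "Impl \<phi> \<psi> = Disj (Neg \<phi>) (Conj \<phi> \<psi>)"

text \<open>\<open>AllEq x x' \<phi>\<close> and \<open>ExEq x x' \<phi>\<close> are the quantifiers \<open>\<forall>(x = x')\<close> and \<open>\<exists>(x = x')\<close>, where the sort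
  of \<open>x'\<close> is the dual of the sort of \<open>x\<close>.\<close>

definition AllEq :: "'v var \<Rightarrow> 'v var \<Rightarrow> 'v fm \<Rightarrow> 'v fm" where
  "AllEq x x' \<phi> = All x' (All x (Impl (Atm (rel_eq (sort_of x)) [Var x, Var x']) \<phi>))"

definition ExEq :: "'v var \<Rightarrow> 'v var \<Rightarrow> 'v fm \<Rightarrow> 'v fm" where
  "ExEq x x' \<phi> = Neg (AllEq x x' (Neg \<phi>))"

fun graph_fm :: "'v trm \<Rightarrow> 'v var \<Rightarrow> 'v fm" where
  "graph_fm (Var v) y' = Atm (rel_eq (sort_of v)) [Var v, Var y']"
| "graph_fm (App F ss) y' = Atm (hat F) (ss @ [Var y'])"

text \<open>
  The formula abbreviated by \<open>R(t\<^sub>1, \<dots>, t\<^sub>n)\<close> when some \<open>t\<^sub>i\<close> is not a variable; the bound variables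
  introduced have indices from \<open>N\<close> on. The quantifier over the last pair is the outermost one.
\<close>

definition unfold_atm :: "nat \<Rightarrow> 'v brel \<Rightarrow> 'v trm list \<Rightarrow> 'v fm" where
  "unfold_atm N R ts =
     (let n = length ts;
          y = (\<lambda>i. (src R ! i, N + i));
          y' = (\<lambda>i. (qdual (src R ! i), N + n + i))
      in fold (\<lambda>i. ExEq (y i) (y' i)) [0..<n]
           (foldl Conj (Atm R (map (\<lambda>i. Var (y i)) [0..<n]))
                       (map (\<lambda>i. graph_fm (ts ! i) (y' i)) [0..<n])))"

text \<open>
  \<open>reorder ctx vs xs\<close> lists the entries of \<open>xs\<close>, which are indexed by the variables \<open>ctx\<close>, in
  the order \<open>vs\<close>; \<open>op_perm ctx vs Xs\<close> is the corresponding unitary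
  \<open>x\<^sub>1 \<otimes> \<dots> \<otimes> x\<^sub>n \<mapsto> x\<^bsub>\<pi>(1)\<^esub> \<otimes> \<dots> \<otimes> x\<^bsub>\<pi>(n)\<^esub>\<close>.
\<close>

definition reorder :: "'i list \<Rightarrow> 'i list \<Rightarrow> 'x list \<Rightarrow> 'x list" where
  "reorder ctx vs xs = map (\<lambda>v. the (map_of (zip ctx xs) v)) vs"

definition op_perm :: "'i list \<Rightarrow> 'i list \<Rightarrow> 'v hilb list \<Rightarrow> 'v opr" where
  "op_perm ctx vs Xs = (\<lambda>ys xs. if xs \<in> vecs Xs
     then op_id (reorder ctx vs Xs) ys (reorder ctx vs xs) else 0)"

text \<open>The interpretation of \<open>R(v\<^sub>1, \<dots>, v\<^sub>m)\<close> in the context \<open>ctx\<close>: the permutation lists the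
  variables \<open>v\<^sub>1, \<dots>, v\<^sub>m\<close> first and then the remaining ones.\<close>

definition interp_atm :: "'v var list \<Rightarrow> 'v brel \<Rightarrow> 'v var list \<Rightarrow> 'v brel" where
  "interp_atm ctx R vs =
     (let rest = filter (\<lambda>v. v \<notin> set vs) ctx;
          ws = vs @ rest;
          T = rel_times R (rel_top (map sort_of rest) [])
      in mk_rel (map sort_of ctx) [] (\<lambda>Xs Ys.
           (\<lambda>k. op_mult (reorder ctx ws Xs) k (op_perm ctx ws Xs)) ` cmp T (reorder ctx ws Xs) Ys))"

definition fresh :: "'v var list \<Rightarrow> nat" where
  "fresh ctx = Suc (Max (insert 0 (snd ` set ctx)))"

(* Termination measure for the interpretation. *)

fun trm_weight :: "'v trm \<Rightarrow> nat" where
  "trm_weight (Var v) = 0"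
| "trm_weight (App F ss) = Suc (sum_list (map trm_weight ss))"

fun fm_weight :: "'v fm \<Rightarrow> nat" where
  "fm_weight (Atm R ts) = sum_list (map trm_weight ts)"
| "fm_weight (Neg \<phi>) = fm_weight \<phi>"
| "fm_weight (Conj \<phi> \<psi>) = max (fm_weight \<phi>) (fm_weight \<psi>)"
| "fm_weight (All v \<phi>) = fm_weight \<phi>"

lemma fm_weight_ExEq: "fm_weight (ExEq x x' \<phi>) = fm_weight \<phi>"
  by (simp add: ExEq_def AllEq_def Impl_def Disj_def)

lemma fm_weight_fold_ExEq: "fm_weight (fold (\<lambda>i. ExEq (y i) (y' i)) is \<phi>) = fm_weight \<phi>"
  by (induction "is" arbitrary: \<phi>) (simp_all add: fm_weight_ExEq)

lemma fm_weight_foldl_Conj: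
  assumes "fm_weight \<phi> < n" "\<And>\<psi>. \<psi> \<in> set \<psi>s \<Longrightarrow> fm_weight \<psi> < n"
  shows "fm_weight (foldl Conj \<phi> \<psi>s) < n"
  using assms by (induction \<psi>s arbitrary: \<phi>) simp_all

lemma fm_weight_graph_fm:
  assumes "t \<in> set ts" "\<exists>t\<in>set ts. \<not> is_Var t"
  shows "fm_weight (graph_fm t y') < sum_list (map trm_weight ts)"
proof -
  have le: "trm_weight s \<le> sum_list (map trm_weight ts)" if "s \<in> set ts" for s
    using that by (simp add: member_le_sum_list)
  obtain s where "s \<in> set ts" "\<not> is_Var s" using assms(2) by blast
  have "0 < trm_weight s" using \<open>\<not> is_Var s\<close> by (cases s) simp_all
  with le[OF \<open>s \<in> set ts\<close>] have "0 < sum_list (map trm_weight ts)" by linarith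
  with le[OF assms(1)] show ?thesis by (cases t) auto
qed

lemma fm_weight_unfold_atm:
  assumes "\<not> (\<forall>t\<in>set ts. is_Var t)"
  shows "fm_weight (unfold_atm N R ts) < fm_weight (Atm R ts)"
proof -
  obtain t where t: "t \<in> set ts" "\<not> is_Var t" using assms by blast
  have pos: "0 < sum_list (map trm_weight ts)"
    using fm_weight_graph_fm[OF t(1), of undefined] t by fastforce
  have zero: "sum_list (map (trm_weight \<circ> (\<lambda>i. Var (f i))) is) = 0"
    for f :: "nat \<Rightarrow> 'a var" and "is"
    by (simp add: comp_def)
  show ?thesis
    unfolding unfold_atm_def Let_def fm_weight_fold_ExEq
    by (rule fm_weight_foldl_Conj)
       (use pos assms in \<open>auto simp: comp_def intro!: fm_weight_graph_fm\<close>)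
qed

text \<open>
  \<open>interp ctx \<phi>\<close> is \<open>\<lbrakk>(x\<^sub>1, \<dots>, x\<^sub>n) | \<phi>\<rbrakk>\<close> for a list \<open>ctx\<close> of distinct variables that
  includes the free variables of the nonduplicating formula \<open>\<phi>\<close>.
\<close>

function interp :: "'v var list \<Rightarrow> 'v fm \<Rightarrow> 'v brel" where
  "interp ctx (Atm R ts) =
     (if \<forall>t\<in>set ts. is_Var t then interp_atm ctx R (map var_of ts)
      else interp ctx (unfold_atm (fresh ctx) R ts))"
| "interp ctx (Neg \<phi>) = rel_neg (interp ctx \<phi>)"
| "interp ctx (Conj \<phi> \<psi>) = rel_inf (interp ctx \<phi>) (interp ctx \<psi>)"
| "interp ctx (All v \<phi>) = rel_Sup (map sort_of ctx) []
     {R \<in> rels (map sort_of ctx).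
        rel_le (rel_times (rel_top [sort_of v] []) R) (interp (v # ctx) \<phi>)}"
  by pat_completeness auto

termination
  by (relation "inv_image (less_than <*lex*> less_than) (\<lambda>(ctx, \<phi>). (fm_weight \<phi>, size \<phi>))")
     (use fm_weight_unfold_atm in \<open>auto simp: max_def\<close>)


section \<open>Graphs and witnessing families\<close>

definition simple_graph :: "'a set \<Rightarrow> 'a rel \<Rightarrow> bool" where
  "simple_graph A r \<longleftrightarrow> finite A \<and> r \<subseteq> A \<times> A \<and> sym r \<and> irrefl r"

definition proj_families :: "'v hilb \<Rightarrow> 'a set \<Rightarrow> 'b set \<Rightarrow> ('a \<Rightarrow> 'b \<Rightarrow> 'v \<Rightarrow> 'v) set" where
  "proj_families H A B = A \<rightarrow>\<^sub>E B \<rightarrow>\<^sub>E projections H"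

definition sums_to_one :: "'v hilb \<Rightarrow> 'a set \<Rightarrow> 'b set \<Rightarrow> ('a \<Rightarrow> 'b \<Rightarrow> 'v \<Rightarrow> 'v) \<Rightarrow> bool" where
  "sums_to_one H A B p \<longleftrightarrow>
     (\<forall>a\<in>A. \<forall>x\<in>carrier H. finsum H (\<lambda>b. p a b x) B = x)"

definition witnesses ::
  "'v hilb \<Rightarrow> 'a set \<Rightarrow> 'a rel \<Rightarrow> 'b set \<Rightarrow> 'b rel \<Rightarrow> ('a \<Rightarrow> 'b \<Rightarrow> 'v \<Rightarrow> 'v) \<Rightarrow> bool" where
  "witnesses H A r B s p \<longleftrightarrow> sums_to_one H A B p \<and>
     (\<forall>a1\<in>A. \<forall>a2\<in>A. \<forall>b1\<in>B. \<forall>b2\<in>B.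
        a1 = a2 \<and> b1 \<noteq> b2 \<or> (a1, a2) \<in> r \<and> (b1, b2) \<notin> s \<longrightarrow>
        (\<forall>x\<in>carrier H. p a1 b1 (p a2 b2 x) = \<zero>\<^bsub>H\<^esub>))"

text \<open>The relation \<open>F\<close> with \<open>F(H \<otimes> C a, D b) = L(H \<otimes> C a, D b) \<cdot> (p a b \<otimes> 1)\<close>.\<close>

definition fun_of_family ::
  "'v hilb \<Rightarrow> ('a \<Rightarrow> 'v hilb) \<Rightarrow> 'a set \<Rightarrow> ('b \<Rightarrow> 'v hilb) \<Rightarrow> 'b set \<Rightarrow>
   ('a \<Rightarrow> 'b \<Rightarrow> 'v \<Rightarrow> 'v) \<Rightarrow> 'v brel" where
  "fun_of_family H C A D B p = mk_rel [{H}, C ` A] [D ` B] (\<lambda>Xs Ys.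
     {op_mult [H, C a] l (op_tensor [H] [H] (op_of H H (p a b)) (op_id [C a])) | a b l.
        a \<in> A \<and> b \<in> B \<and> Xs = [H, C a] \<and> Ys = [D b] \<and> l \<in> opers [H, C a] [D b]})"

end

theory Submission
  imports Defs
begin

text \<open>
  The components of a relation of arity \<open>(X\<^sub>1, \<dots>, X\<^sub>n)\<close> are subspaces of the
  finite-dimensional Hilbert space of multilinear forms on the atoms, and the connectives act on
  them by intersection and orthogonal complement.

  For the first correspondence, the atoms of \<open>`A\<close> and \<open>`B\<close> are lines, so a
  relation \<open>F\<close> from \<open>X \<times> `A\<close> to \<open>`B\<close> is given by subspaces
  \<open>W a b\<close> of \<open>H\<close>: its component at \<open>a, b\<close> consists of the operators with first factor
  \<open>\<langle>v|\<close> for \<open>v \<in> W a b\<close>. The condition \<open>F F\<^sup>\<dagger> \<le> I\<close> says that the subspaces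
  \<open>W a b\<close> with \<open>b \<in> B\<close> are pairwise orthogonal, and then \<open>F\<^sup>\<dagger> F \<ge> I\<close> says that they span
  \<open>H\<close> (\<open>is_function_iff\<close>). So a function is an orthogonal decomposition of \<open>H\<close> for each \<open>a\<close>,
  which is the same as a family of projections that sum to \<open>1\<close> (\<open>fun_of_family_bij\<close>).

  For the second correspondence, a form \<open>k\<close> satisfies \<open>\<forall>(x = x\<^sub>*). \<phi>\<close> if and only if
  \<open>\<epsilon> \<otimes> k\<close> satisfies \<open>\<phi>\<close> (\<open>sem_AllEq\<close>); implication is the Sasaki arrow, and this
  is where the orthomodular law enters. Hence the sentence is true if and only if for each edge
  \<open>(i, j)\<close> of \<open>A\<close> the form \<open>\<epsilon> \<otimes> \<epsilon> \<otimes> \<epsilon>\<close>, which stands for \<open>1\<^sub>H\<close>, satisfies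
  the conclusion at the atoms \<open>C i, C j\<close>. The conclusion abbreviates an existential formula. At
  \<open>b0, b1\<close> its matrix is zero if \<open>b0, b1\<close> are not adjacent, and otherwise it contains exactly the
  forms invariant under \<open>p i b0\<close> in \<open>x\<^sub>*\<close> and under \<open>p j b1\<close> in \<open>x\<close>. So, in terms of
  operators, the sentence says that \<open>1\<^sub>H\<close> belongs to the sum of the spaces
  \<open>p i b0 \<cdot> L(H) \<cdot> p j b1\<close> over adjacent \<open>b0, b1\<close>. As \<open>1\<^sub>H\<close> is the sum of all products
  \<open>p i b0 \<cdot> p j b1\<close>, this holds if the products at nonadjacent \<open>b0, b1\<close> vanish
  (\<open>orthogonality_imp_sem\<close>). Conversely, operators of the form \<open>p i b |u\<rangle>\<langle>v| p j b'\<close> with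
  \<open>b, b'\<close> not adjacent are orthogonal to that sum, and if all of them are orthogonal to \<open>1\<^sub>H\<close>
  then \<open>p i b \<cdot> p j b' = 0\<close> (\<open>sem_imp_orthogonality\<close>). The other half of the
  witnessing condition, \<open>p a b \<cdot> p a b' = 0\<close> for \<open>b \<noteq> b'\<close>, holds for every family of projections
  with sum \<open>1\<close> (\<open>projections_sum_one_orthogonal\<close>).
\<close>

section \<open>Hermitian spaces\<close>

text \<open>
  Gram-Schmidt orthogonalisation relies on finite dimension through a bound on the size of
  orthonormal sets. It is used for Hilbert spaces, where the dimension is such a bound, and for
  spaces of multilinear forms, where the size of an explicit orthonormal basis is one
  (\<open>card_orthonormal_le_onb\<close>).
\<close>

locale hermitian = Module.module "class_ring :: complex ring" X for X :: "'v hilb" +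
  assumes ip_sym: "x \<in> carrier X \<Longrightarrow> y \<in> carrier X \<Longrightarrow> ip X x y = cnj (ip X y x)"
    and ip_add_right: "x \<in> carrier X \<Longrightarrow> y \<in> carrier X \<Longrightarrow> z \<in> carrier X \<Longrightarrow>
          ip X x (y \<oplus>\<^bsub>X\<^esub> z) = ip X x y + ip X x z"
    and ip_smult_right: "x \<in> carrier X \<Longrightarrow> y \<in> carrier X \<Longrightarrow> ip X x (c \<odot>\<^bsub>X\<^esub> y) = c * ip X x y"
    and ip_pos: "x \<in> carrier X \<Longrightarrow> x \<noteq> \<zero>\<^bsub>X\<^esub> \<Longrightarrow> 0 < Re (ip X x x)"
begin

lemma smult_carrier [simp]: "x \<in> carrier X \<Longrightarrow> c \<odot>\<^bsub>X\<^esub> x \<in> carrier X"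
  by (rule smult_closed) simp

lemma ip_add_left: "x \<in> carrier X \<Longrightarrow> y \<in> carrier X \<Longrightarrow> z \<in> carrier X \<Longrightarrow>
    ip X (x \<oplus>\<^bsub>X\<^esub> y) z = ip X x z + ip X y z"
  using ip_sym[of "x \<oplus>\<^bsub>X\<^esub> y" z] ip_sym[of x z] ip_sym[of y z] ip_add_right[of z x y] by simp

lemma ip_smult_left: "x \<in> carrier X \<Longrightarrow> y \<in> carrier X \<Longrightarrow>
    ip X (c \<odot>\<^bsub>X\<^esub> x) y = cnj c * ip X x y"
  using ip_sym[of "c \<odot>\<^bsub>X\<^esub> x" y] ip_sym[of x y] ip_smult_right[of y x c] by simp

lemma ip_zero_right [simp]: "x \<in> carrier X \<Longrightarrow> ip X x \<zero>\<^bsub>X\<^esub> = 0"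
  using ip_add_right[of x "\<zero>\<^bsub>X\<^esub>" "\<zero>\<^bsub>X\<^esub>"] by simp

lemma ip_zero_left [simp]: "x \<in> carrier X \<Longrightarrow> ip X \<zero>\<^bsub>X\<^esub> x = 0"
  using ip_sym[of "\<zero>\<^bsub>X\<^esub>" x] by simp

lemma ip_self_0: "x \<in> carrier X \<Longrightarrow> ip X x x = 0 \<Longrightarrow> x = \<zero>\<^bsub>X\<^esub>"
  using ip_pos[of x] by auto

lemma ip_self_real: "x \<in> carrier X \<Longrightarrow> ip X x x = complex_of_real (Re (ip X x x))"
  using ip_sym[of x x] by (metis Reals_cnj_iff of_real_Re)

lemma ip_finsum_right:
  assumes "finite E" "f \<in> E \<rightarrow> carrier X" "x \<in> carrier X"
  shows "ip X x (finsum X f E) = (\<Sum>e\<in>E. ip X x (f e))"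
  using assms
proof (induction E)
  case (insert e E)
  then have "f \<in> E \<rightarrow> carrier X" "f e \<in> carrier X" by auto
  with insert show ?case by (simp add: finsum_insert ip_add_right finsum_closed)
qed simp

definition subsp :: "'v set \<Rightarrow> bool" where
  "subsp W \<longleftrightarrow> W \<subseteq> carrier X \<and> \<zero>\<^bsub>X\<^esub> \<in> W \<and> (\<forall>x\<in>W. \<forall>y\<in>W. x \<oplus>\<^bsub>X\<^esub> y \<in> W) \<and> (\<forall>x\<in>W. \<forall>c. c \<odot>\<^bsub>X\<^esub> x \<in> W)"

lemma subsp_eqI:
  assumes W: "subsp W" and x: "x \<in> W" and y: "y \<in> W"
    and eq: "\<And>v. v \<in> W \<Longrightarrow> ip X v x = ip X v y"
  shows "x = y"
proof -
  let ?z = "x \<oplus>\<^bsub>X\<^esub> (- 1) \<odot>\<^bsub>X\<^esub> y"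
  have zW: "?z \<in> W" and C: "x \<in> carrier X" "y \<in> carrier X" using W x y by (auto simp: subsp_def)
  then have z: "?z \<in> carrier X" by simp
  have "ip X ?z ?z = ip X ?z x + (-1) * ip X ?z y"
    using ip_add_right[OF z, of x] ip_smult_right[OF z, of y] C by simp
  also have "\<dots> = 0" using eq[OF zW] by simp
  finally have "?z = \<zero>\<^bsub>X\<^esub>" by (rule ip_self_0[OF z])
  moreover have "(- 1) \<odot>\<^bsub>X\<^esub> y = \<ominus>\<^bsub>X\<^esub> y"
    using smult_l_minus[of 1 y] smult_one[of y] C by (simp add: class_ring_simps)
  ultimately show ?thesis
    using C by (metis add.inv_closed add.inv_equality minus_minus)
qed

lemma ip_ext:
  assumes "x \<in> carrier X" "y \<in> carrier X" "\<And>v. v \<in> carrier X \<Longrightarrow> ip X v x = ip X v y"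
  shows "x = y"
  by (rule subsp_eqI[of "carrier X"]) (use assms in \<open>auto simp: subsp_def\<close>)

definition orthonormal :: "'v set \<Rightarrow> bool" where
  "orthonormal E \<longleftrightarrow> E \<subseteq> carrier X \<and> finite E \<and> (\<forall>e\<in>E. \<forall>f\<in>E. ip X e f = (if e = f then 1 else 0))"

definition fourier :: "'v set \<Rightarrow> 'v \<Rightarrow> 'v" where
  "fourier E x = finsum X (\<lambda>e. ip X e x \<odot>\<^bsub>X\<^esub> e) E"

lemma fourier_closed: "orthonormal E \<Longrightarrow> x \<in> carrier X \<Longrightarrow> fourier E x \<in> carrier X"
  unfolding fourier_def by (rule finsum_closed) (auto simp: orthonormal_def)

lemma ip_fourier:
  assumes "orthonormal E" "x \<in> carrier X" "y \<in> carrier X"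
  shows "ip X y (fourier E x) = (\<Sum>e\<in>E. ip X e x * ip X y e)"
proof -
  have E: "finite E" "E \<subseteq> carrier X" using assms(1) by (auto simp: orthonormal_def)
  have "ip X y (fourier E x) = (\<Sum>e\<in>E. ip X y (ip X e x \<odot>\<^bsub>X\<^esub> e))"
    unfolding fourier_def using E assms by (subst ip_finsum_right) auto
  also have "\<dots> = (\<Sum>e\<in>E. ip X e x * ip X y e)"
    using E assms by (intro sum.cong refl ip_smult_right) auto
  finally show ?thesis .
qed

lemma ip_fourier_mem:
  assumes "orthonormal E" "x \<in> carrier X" "e \<in> E"
  shows "ip X e (fourier E x) = ip X e x"
proof -
  have E: "finite E" "e \<in> carrier X" "\<And>f. f \<in> E \<Longrightarrow> ip X e f = (if e = f then 1 else 0)"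
    using assms by (auto simp: orthonormal_def)
  have "ip X e (fourier E x) = (\<Sum>f\<in>E. ip X f x * ip X e f)"
    by (rule ip_fourier) (use assms E in auto)
  also have "\<dots> = (\<Sum>f\<in>E. if f = e then ip X f x else 0)"
    by (rule sum.cong) (auto simp: E(3))
  also have "\<dots> = ip X e x" using E(1) assms(3) by simp
  finally show ?thesis .
qed

lemma subsp_finsum:
  assumes "subsp W" "finite E" "f \<in> E \<rightarrow> W"
  shows "finsum X f E \<in> W"
  using assms(2,3)
proof (induction E)
  case (insert e E)
  then have "f \<in> E \<rightarrow> carrier X" "f e \<in> carrier X" "f e \<in> W" "finsum X f E \<in> W"
    using assms(1) by (auto simp: subsp_def)
  with insert assms(1) show ?case by (simp add: finsum_insert subsp_def)
qed (use assms(1) in \<open>simp add: subsp_def\<close>)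

text \<open>
  An orthonormal subset of \<open>W\<close> of largest size is a basis of \<open>W\<close>, because what the Fourier
  expansion of a vector misses could be normalised and added to the set.
\<close>

lemma gram_schmidt:
  assumes W: "subsp W"
    and bound: "\<And>E. orthonormal E \<Longrightarrow> card E \<le> N"
  obtains E where "orthonormal E" "E \<subseteq> W" "\<And>v. v \<in> W \<Longrightarrow> fourier E v = v"
proof -
  have "\<exists>E. (orthonormal E \<and> E \<subseteq> W) \<and> (\<forall>E'. orthonormal E' \<and> E' \<subseteq> W \<longrightarrow> card E' \<le> card E)"
    by (rule ex_has_greatest_nat[of _ "{}" _ "Suc N"]) (use bound in \<open>auto simp: orthonormal_def less_Suc_eq_le\<close>)
  then obtain E where E: "orthonormal E" "E \<subseteq> W"
    and max: "\<And>E'. orthonormal E' \<Longrightarrow> E' \<subseteq> W \<Longrightarrow> card E' \<le> card E" by blast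
  have fin: "finite E" and EC: "E \<subseteq> carrier X" using E by (auto simp: orthonormal_def)
  have "fourier E v = v" if v: "v \<in> W" for v
  proof (rule ccontr)
    assume ne: "fourier E v \<noteq> v"
    have vC: "v \<in> carrier X" using v W by (auto simp: subsp_def)
    have fW: "fourier E v \<in> W" unfolding fourier_def
      by (rule subsp_finsum[OF W fin]) (use E W in \<open>auto simp: subsp_def\<close>)
    have fC: "fourier E v \<in> carrier X" using fW W by (auto simp: subsp_def)
    define z where "z = v \<oplus>\<^bsub>X\<^esub> (- 1) \<odot>\<^bsub>X\<^esub> fourier E v"
    have zW: "z \<in> W" unfolding z_def using v fW W by (auto simp: subsp_def)
    then have zC: "z \<in> carrier X" using W by (auto simp: subsp_def)
    have ipz: "ip X y z = ip X y v - ip X y (fourier E v)" if "y \<in> carrier X" for y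
      unfolding z_def using that vC fC by (simp add: ip_add_right ip_smult_right)
    have z0: "z \<noteq> \<zero>\<^bsub>X\<^esub>"
    proof
      assume "z = \<zero>\<^bsub>X\<^esub>"
      then have "ip X y v = ip X y (fourier E v)" if "y \<in> carrier X" for y
        using ipz[OF that] that by simp
      then have "v = fourier E v" by (intro ip_ext vC fC)
      with ne show False by simp
    qed
    have ez: "ip X e z = 0" if "e \<in> E" for e
      using ipz[of e] ip_fourier_mem[OF E(1) vC that] that EC by auto
    define r where "r = Re (ip X z z)"
    have r: "r > 0" "ip X z z = complex_of_real r"
      using ip_pos[OF zC z0] ip_self_real[OF zC] by (auto simp: r_def)
    define c where "c = complex_of_real (1 / sqrt r)"
    have c: "cnj c * (c * ip X z z) = 1"
    proof -
      have "1 / sqrt r * (1 / sqrt r * r) = 1" using r(1)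
        by (simp add: field_simps)
      then have "complex_of_real (1 / sqrt r * (1 / sqrt r * r)) = 1" by simp
      then show ?thesis unfolding r(2) c_def by (simp only: of_real_mult complex_cnj_complex_of_real)
    qed
    define f where "f = c \<odot>\<^bsub>X\<^esub> z"
    have fWW: "f \<in> W" and fCC: "f \<in> carrier X" unfolding f_def using zW zC W by (auto simp: subsp_def)
    have ff: "ip X f f = 1" unfolding f_def using c zC by (simp add: ip_smult_left ip_smult_right mult.left_commute)
    have ef: "ip X e f = 0" "ip X f e = 0" if "e \<in> E" for e
    proof -
      have eC: "e \<in> carrier X" using that EC by auto
      show "ip X e f = 0" unfolding f_def using ip_smult_right[OF eC zC] ez[OF that] by simp
      then show "ip X f e = 0" using ip_sym[OF fCC eC] by simp
    qed
    have "f \<notin> E" using ef ff by force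
    have "orthonormal (insert f E)"
      using E(1) ef ff fCC \<open>f \<notin> E\<close> unfolding orthonormal_def by auto
    then have "card (insert f E) \<le> card E" using max fWW E by simp
    with \<open>f \<notin> E\<close> fin show False by simp
  qed
  with E that show thesis by blast
qed

text \<open>
  The projection of \<open>x\<close> is its Fourier expansion in an orthonormal basis of \<open>W\<close>.
\<close>

lemma orthogonal_projection_exists:
  assumes W: "subsp W"
    and bound: "\<And>E. orthonormal E \<Longrightarrow> card E \<le> N"
    and x: "x \<in> carrier X"
  shows "\<exists>w\<in>W. \<forall>v\<in>W. ip X v x = ip X v w"
proof -
  obtain E where E: "orthonormal E" "E \<subseteq> W" "\<And>v. v \<in> W \<Longrightarrow> fourier E v = v"
    using gram_schmidt[OF W bound] by blast
  have fin: "finite E" and EC: "E \<subseteq> carrier X" using E by (auto simp: orthonormal_def)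
  have "fourier E x \<in> W" unfolding fourier_def
    by (rule subsp_finsum[OF W fin]) (use E W in \<open>auto simp: subsp_def\<close>)
  moreover have "ip X v x = ip X v (fourier E x)" if v: "v \<in> W" for v
  proof -
    have vC: "v \<in> carrier X" using v W by (auto simp: subsp_def)
    have "ip X v x = cnj (ip X x (fourier E v))" using E(3)[OF v] ip_sym[OF vC x] by simp
    also have "\<dots> = cnj (\<Sum>e\<in>E. ip X e v * ip X x e)" using ip_fourier[OF E(1) vC x] by simp
    also have "\<dots> = (\<Sum>e\<in>E. ip X v e * ip X e x)"
      unfolding cnj_sum
    proof (rule sum.cong[OF refl])
      fix e assume "e \<in> E"
      then have "e \<in> carrier X" using EC by auto
      then show "cnj (ip X e v * ip X x e) = ip X v e * ip X e x"
        using ip_sym[of v e] ip_sym[of e x] vC x by simp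
    qed
    also have "\<dots> = ip X v (fourier E x)" using ip_fourier[OF E(1) x vC] by (simp add: mult.commute)
    finally show ?thesis .
  qed
  ultimately show ?thesis by blast
qed

lemma is_onb_orthonormal: "is_onb X E \<Longrightarrow> orthonormal E"
  by (simp add: is_onb_def orthonormal_def)

lemma fourier_onb:
  assumes "is_onb X E" "x \<in> carrier X"
  shows "fourier E x = x"
proof -
  have E: "orthonormal E" by (rule is_onb_orthonormal[OF assms(1)])
  have fC: "fourier E x \<in> carrier X" by (rule fourier_closed[OF E assms(2)])
  let ?z = "x \<oplus>\<^bsub>X\<^esub> (- 1) \<odot>\<^bsub>X\<^esub> fourier E x"
  have z: "?z \<in> carrier X" using assms fC by simp
  have ipz: "ip X y ?z = ip X y x - ip X y (fourier E x)" if "y \<in> carrier X" for y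
    using that assms(2) fC by (simp add: ip_add_right ip_smult_right)
  have "ip X e ?z = 0" if "e \<in> E" for e
    using ipz[of e] ip_fourier_mem[OF E assms(2) that] that E by (auto simp: orthonormal_def)
  then have z0: "?z = \<zero>\<^bsub>X\<^esub>" using assms(1) z by (auto simp: is_onb_def)
  show ?thesis
    by (rule ip_ext[OF fC assms(2)]) (use ipz z0 in auto)
qed

lemma parseval:
  assumes "is_onb X E" "x \<in> carrier X" "y \<in> carrier X"
  shows "(\<Sum>e\<in>E. ip X x e * ip X e y) = ip X x y"
  using ip_fourier[OF is_onb_orthonormal[OF assms(1)] assms(3,2)] fourier_onb[OF assms(1,3)]
  by (simp add: mult.commute)

text \<open>Double counting of the squared entries between an orthonormal set and a basis.\<close>

lemma card_orthonormal_le_onb: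
  assumes J: "is_onb X J" and E: "orthonormal E"
  shows "card E \<le> card J"
proof -
  have JC: "J \<subseteq> carrier X" "finite J" and EC: "E \<subseteq> carrier X" "finite E"
    using assms by (auto simp: is_onb_def orthonormal_def)
  have sq: "ip X x y * ip X y x = complex_of_real ((cmod (ip X x y))\<^sup>2)"
    if "x \<in> carrier X" "y \<in> carrier X" for x y
    unfolding complex_norm_square ip_sym[OF that(2,1)] ..
  have a: "(\<Sum>j\<in>J. (cmod (ip X e j))\<^sup>2) = 1" if "e \<in> E" for e
  proof -
    have "complex_of_real (\<Sum>j\<in>J. (cmod (ip X e j))\<^sup>2) = (\<Sum>j\<in>J. ip X e j * ip X j e)"
      unfolding of_real_sum by (rule sum.cong) (use that EC JC in \<open>auto intro!: sq sq[symmetric] simp del: of_real_power\<close>)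
    also have "\<dots> = ip X e e" by (rule parseval[OF J]) (use that EC in auto)
    also have "\<dots> = 1" using that E by (auto simp: orthonormal_def)
    finally show ?thesis using of_real_eq_1_iff by blast
  qed
  have b: "(\<Sum>e\<in>E. (cmod (ip X e j))\<^sup>2) \<le> 1" if j: "j \<in> J" for j
  proof -
    have jC: "j \<in> carrier X" using j JC by auto
    let ?f = "fourier E j"
    have fC: "?f \<in> carrier X" by (rule fourier_closed[OF E jC])
    let ?z = "j \<oplus>\<^bsub>X\<^esub> (- 1) \<odot>\<^bsub>X\<^esub> ?f"
    have z: "?z \<in> carrier X" using jC fC by simp
    let ?s = "\<Sum>e\<in>E. (cmod (ip X e j))\<^sup>2"
    have jf: "ip X j ?f = complex_of_real ?s"
      unfolding ip_fourier[OF E jC jC] of_real_sum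
      by (rule sum.cong) (use jC EC in \<open>auto intro!: sq sq[symmetric] simp del: of_real_power\<close>)
    have ff: "ip X ?f ?f = complex_of_real ?s"
    proof -
      have "ip X ?f ?f = (\<Sum>e\<in>E. ip X e j * ip X ?f e)" by (rule ip_fourier[OF E jC fC])
      also have "\<dots> = (\<Sum>e\<in>E. ip X e j * ip X j e)"
      proof (rule sum.cong[OF refl])
        fix e assume e: "e \<in> E"
        then have eC: "e \<in> carrier X" using EC by auto
        show "ip X e j * ip X ?f e = ip X e j * ip X j e"
          using ip_fourier_mem[OF E jC e] ip_sym[OF fC eC] ip_sym[OF jC eC] by simp
      qed
      also have "\<dots> = complex_of_real ?s"
        unfolding of_real_sum by (rule sum.cong) (use jC EC in \<open>auto intro!: sq sq[symmetric] simp del: of_real_power\<close>)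
      finally show ?thesis .
    qed
    have jj: "ip X j j = 1" using j J by (auto simp: is_onb_def)
    have fj: "ip X ?f j = complex_of_real ?s" using ip_sym[OF fC jC] jf by simp
    have "ip X ?z ?z = complex_of_real (1 - ?s)"
      using jC fC jj fj jf ff
      by (simp add: ip_add_right ip_add_left ip_smult_right ip_smult_left)
    moreover have "0 \<le> Re (ip X ?z ?z)"
      using ip_pos[OF z] ip_zero_right by (cases "?z = \<zero>\<^bsub>X\<^esub>") auto
    ultimately show ?thesis by simp
  qed
  have "real (card E) = (\<Sum>e\<in>E. \<Sum>j\<in>J. (cmod (ip X e j))\<^sup>2)" using a by simp
  also have "\<dots> = (\<Sum>j\<in>J. \<Sum>e\<in>E. (cmod (ip X e j))\<^sup>2)" by (rule sum.swap)
  also have "\<dots> \<le> (\<Sum>j\<in>J. 1)" by (rule sum_mono) (rule b)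
  finally show ?thesis by simp
qed

end


section \<open>Finite-dimensional Hilbert spaces and their duals\<close>

lemma fd_hilbert_hermitian:
  assumes "fd_hilbert X"
  shows "hermitian X"
proof -
  have "vectorspace class_ring X" using assms by (simp add: fd_hilbert_def)
  then interpret vectorspace class_ring X .
  show ?thesis
    by unfold_locales (use assms in \<open>unfold fd_hilbert_def, blast+\<close>)
qed

text \<open>
  Orthonormal sets are linearly independent: taking the inner product of a linear combination with
  one of the vectors extracts its coefficient.
\<close>

lemma fd_hilbert_orthonormal_card:
  assumes "fd_hilbert X" "hermitian.orthonormal X E"
  shows "card E \<le> vectorspace.dim class_ring X"
proof -
  interpret V: vectorspace class_ring X using assms(1) by (simp add: fd_hilbert_def)
  interpret hermitian X by (rule fd_hilbert_hermitian[OF assms(1)])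
  have E: "E \<subseteq> carrier X" "finite E" "\<And>e f. e \<in> E \<Longrightarrow> f \<in> E \<Longrightarrow> ip X e f = (if e = f then 1 else 0)"
    using assms(2) by (auto simp: orthonormal_def)
  have "\<not> V.lin_dep E"
  proof (rule V.finite_lin_indpt2[OF E(2,1)])
    fix a assume a: "a \<in> E \<rightarrow> carrier (class_ring :: complex ring)" "V.lincomb a E = \<zero>\<^bsub>X\<^esub>"
    show "\<forall>v\<in>E. a v = \<zero>\<^bsub>class_ring\<^esub>"
    proof
      fix v assume v: "v \<in> E"
      then have vC: "v \<in> carrier X" using E by auto
      have "0 = ip X v (V.lincomb a E)" using a(2) vC by simp
      also have "\<dots> = (\<Sum>e\<in>E. ip X v (a e \<odot>\<^bsub>X\<^esub> e))"
        unfolding V.lincomb_def by (rule ip_finsum_right) (use E vC in auto)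
      also have "\<dots> = (\<Sum>e\<in>E. if e = v then a e else 0)"
        by (rule sum.cong) (use E vC v in \<open>auto simp: ip_smult_right\<close>)
      also have "\<dots> = a v" using E v by simp
      finally show "a v = \<zero>\<^bsub>class_ring\<^esub>" by simp
    qed
  qed
  moreover have "V.fin_dim" using assms(1) by (simp add: fd_hilbert_def)
  ultimately show ?thesis by (intro V.li_le_dim(2) E(1))
qed

lemma is_onb_onb:
  assumes "fd_hilbert X"
  shows "is_onb X (onb X)"
proof -
  interpret hermitian X by (rule fd_hilbert_hermitian[OF assms])
  have "subsp (carrier X)" by (auto simp: subsp_def)
  then obtain E where E: "orthonormal E" "\<And>v. v \<in> carrier X \<Longrightarrow> fourier E v = v"
    by (rule gram_schmidt) (use fd_hilbert_orthonormal_card[OF assms] in auto)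
  have "x = \<zero>\<^bsub>X\<^esub>" if "x \<in> carrier X" "\<forall>e\<in>E. ip X e x = 0" for x
  proof -
    have "ip X x x = (\<Sum>e\<in>E. ip X e x * ip X x e)"
      using ip_fourier[OF E(1) that(1) that(1)] E(2)[OF that(1)] by simp
    also have "\<dots> = 0" using that(2) by simp
    finally show ?thesis by (rule ip_self_0[OF that(1)])
  qed
  then have "is_onb X E" using E(1) by (auto simp: is_onb_def orthonormal_def)
  then show ?thesis unfolding onb_def by (rule someI)
qed

lemma carrier_dual [simp]: "carrier (dual X) = carrier X"
  and add_dual [simp]: "add (dual X) = add X"
  and zero_dual [simp]: "zero (dual X) = zero X"
  and smult_dual [simp]: "smult (dual X) c x = cnj c \<odot>\<^bsub>X\<^esub> x"
  and ip_dual [simp]: "ip (dual X) x y = ip X y x"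
  by (simp_all add: dual_def)

lemma dual_inj [simp]: "dual X = dual Y \<longleftrightarrow> X = Y"
  by (metis dual_dual)

lemma dual_dual' [simp]: "dual (dual X) = X"
  by (rule dual_dual)

lemma hermitian_dual:
  assumes "hermitian X"
  shows "hermitian (dual X)"
proof -
  interpret hermitian X by fact
  interpret D: abelian_group "dual X"
    by (rule abelian_groupI) (auto simp: a_ac intro: add.inv_closed l_neg)
  show ?thesis
  proof (unfold_locales, goal_cases)
    case (2 a b x)
    then show ?case using smult_l_distr[of "cnj a" "cnj b" x] by simp
  next
    case (3 a x y)
    then show ?case using smult_r_distr[of "cnj a" x y] by simp
  next
    case (4 a b x)
    then show ?case using smult_assoc1[of "cnj a" "cnj b" x] by simp
  next
    case (5 x)
    then show ?case using smult_one[of x] by simp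
  qed (simp_all add: ip_add_left ip_smult_left ip_pos del: complex_cnj_cancel_iff, (rule ip_sym; assumption)?)
qed

lemma is_onb_dual:
  assumes "hermitian X"
  shows "is_onb (dual X) E \<longleftrightarrow> is_onb X E"
proof -
  interpret hermitian X by fact
  have sym0: "ip X x e = 0 \<longleftrightarrow> ip X e x = 0" if "e \<in> carrier X" "x \<in> carrier X" for e x
    using ip_sym[OF that] by simp
  have on: "(\<forall>e\<in>E. \<forall>f\<in>E. ip X f e = (if e = f then 1 else 0)) \<longleftrightarrow>
      (\<forall>e\<in>E. \<forall>f\<in>E. ip X e f = (if e = f then 1 else 0))"
    by (intro iffI ballI) auto
  have total: "(\<forall>x\<in>carrier X. (\<forall>e\<in>E. ip X x e = 0) \<longrightarrow> x = \<zero>\<^bsub>X\<^esub>) \<longleftrightarrow>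
      (\<forall>x\<in>carrier X. (\<forall>e\<in>E. ip X e x = 0) \<longrightarrow> x = \<zero>\<^bsub>X\<^esub>)" if "E \<subseteq> carrier X"
  proof (rule ball_cong[OF refl])
    fix x assume "x \<in> carrier X"
    then have "(\<forall>e\<in>E. ip X x e = 0) \<longleftrightarrow> (\<forall>e\<in>E. ip X e x = 0)"
      using sym0 that by (intro ball_cong refl) blast
    then show "((\<forall>e\<in>E. ip X x e = 0) \<longrightarrow> x = \<zero>\<^bsub>X\<^esub>) \<longleftrightarrow> ((\<forall>e\<in>E. ip X e x = 0) \<longrightarrow> x = \<zero>\<^bsub>X\<^esub>)"
      by (rule imp_cong) (rule refl)
  qed
  show ?thesis
    unfolding is_onb_def carrier_dual ip_dual zero_dual on by (intro conj_cong refl total)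
qed

lemma onb_dual: "hermitian X \<Longrightarrow> onb (dual X) = onb X"
proof -
  assume "hermitian X"
  then have "is_onb (dual X) = is_onb X" by (intro ext is_onb_dual)
  then show ?thesis by (simp only: onb_def)
qed

text \<open>
  What the calculus of operators needs of a space is only that \<^const>\<open>onb\<close> selects an
  orthonormal basis of it, and this passes to duals without a discussion of dimensions.
\<close>

definition tame :: "'v hilb \<Rightarrow> bool" where
  "tame X \<longleftrightarrow> hermitian X \<and> is_onb X (onb X)"

lemma fd_hilbert_tame: "fd_hilbert X \<Longrightarrow> tame X"
  by (simp add: tame_def fd_hilbert_hermitian is_onb_onb)

lemma tame_dual [simp]: "tame (dual X) \<longleftrightarrow> tame X"
proof -
  have *: "tame (dual Y)" if "tame Y" for Y :: "'v hilb"
    using that unfolding tame_def by (metis hermitian_dual is_onb_dual onb_dual)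
  show ?thesis using *[of X] *[of "dual X"] by auto
qed

lemma tame_onb_dual [simp]: "tame X \<Longrightarrow> onb (dual X) = onb X"
  by (simp add: tame_def onb_dual)

lemma onb_finite [simp]: "tame X \<Longrightarrow> finite (onb X)"
  unfolding tame_def is_onb_def by blast

lemma onb_carrier: "tame X \<Longrightarrow> e \<in> onb X \<Longrightarrow> e \<in> carrier X"
  unfolding tame_def is_onb_def by blast

lemma onb_ip: "tame X \<Longrightarrow> e \<in> onb X \<Longrightarrow> f \<in> onb X \<Longrightarrow> ip X e f = (if e = f then 1 else 0)"
  unfolding tame_def is_onb_def by blast

lemma onb_parseval:
  assumes "tame X" "x \<in> carrier X" "y \<in> carrier X"
  shows "(\<Sum>e\<in>onb X. ip X x e * ip X e y) = ip X x y"
  by (rule hermitian.parseval) (use assms in \<open>unfold tame_def, blast+\<close>)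

section \<open>Multilinear forms\<close>

lemma Cons_in_listset [simp]: "x # xs \<in> listset (A # As) \<longleftrightarrow> x \<in> A \<and> xs \<in> listset As"
  by (simp add: set_Cons_def)

lemma Nil_notin_listset [simp]: "[] \<notin> listset (A # As)"
  by (simp add: set_Cons_def)

lemma listset_ConsE:
  assumes "zs \<in> listset (A # As)"
  obtains x xs where "zs = x # xs" "x \<in> A" "xs \<in> listset As"
  using assms by (auto simp: set_Cons_def)

lemma ball_listset_Cons: "(\<forall>zs\<in>listset (A # As). P zs) \<longleftrightarrow> (\<forall>x\<in>A. \<forall>xs\<in>listset As. P (x # xs))"
  by (auto simp: set_Cons_def)

lemma listset_iff: "xs \<in> listset As \<longleftrightarrow> list_all2 (\<in>) xs As"
  by (induction As arbitrary: xs) (auto simp: set_Cons_def list_all2_Cons2)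

lemma length_listset: "xs \<in> listset As \<Longrightarrow> length xs = length As"
  by (simp add: listset_iff list_all2_lengthD)

lemma vecs_dual [simp]: "listset (map (carrier \<circ> dual) Xs) = vecs Xs"
  by (simp add: comp_def)

lemma sum_listset_Cons:
  "(\<Sum>zs\<in>listset (A # As). f zs) = (\<Sum>x\<in>A. \<Sum>xs\<in>listset As. f (x # xs))"
proof -
  have "listset (A # As) = (\<lambda>(x, xs). x # xs) ` (A \<times> listset As)"
    by (auto simp: set_Cons_def)
  moreover have "inj_on (\<lambda>(x, xs). x # xs) (A \<times> listset As)" by (auto simp: inj_on_def)
  ultimately show ?thesis
    by (simp add: sum.reindex sum.cartesian_product case_prod_unfold del: listset.simps)
qed

declare listset.simps(2) [simp del]

definition linear_form :: "'v hilb \<Rightarrow> ('v \<Rightarrow> complex) \<Rightarrow> bool" where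
  "linear_form X f \<longleftrightarrow> (\<forall>u\<in>carrier X. \<forall>v\<in>carrier X. f (u \<oplus>\<^bsub>X\<^esub> v) = f u + f v) \<and>
     (\<forall>c. \<forall>u\<in>carrier X. f (c \<odot>\<^bsub>X\<^esub> u) = c * f u)"

lemma linear_form_expand:
  assumes X: "tame X" and f: "linear_form X f" and x: "x \<in> carrier X"
  shows "f x = (\<Sum>e\<in>onb X. ip X e x * f e)"
proof -
  interpret hermitian X using X by (simp add: tame_def)
  have f0: "f \<zero>\<^bsub>X\<^esub> = 0" 
    using f[unfolded linear_form_def] zero_closed by (metis add_cancel_left_left l_zero)
  have "f (finsum X g E) = (\<Sum>e\<in>E. f (g e))" if "finite E" "g \<in> E \<rightarrow> carrier X" for g and E :: "'a set"
    using that
  proof (induction E)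
    case (insert e E)
    then have g: "g \<in> E \<rightarrow> carrier X" "g e \<in> carrier X" by auto
    with insert f show ?case by (simp add: finsum_insert finsum_closed linear_form_def)
  qed (simp add: f0)
  note this[of "onb X" "\<lambda>e. ip X e x \<odot>\<^bsub>X\<^esub> e"]
  moreover have "x = finsum X (\<lambda>e. ip X e x \<odot>\<^bsub>X\<^esub> e) (onb X)"
    using fourier_onb[of "onb X" x] X x by (simp add: fourier_def tame_def)
  moreover have "f (c \<odot>\<^bsub>X\<^esub> e) = c * f e" if "e \<in> onb X" for c e
    using f onb_carrier[OF X that] by (simp add: linear_form_def)
  ultimately show ?thesis using onb_carrier[OF X] X by (simp cong: sum.cong)
qed

text \<open>
  Multilinearity by recursion on the spaces, because quantifiers add a variable in front of a
  context and induction then removes the first argument of a form.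
\<close>

fun mlin :: "'v hilb list \<Rightarrow> ('v list \<Rightarrow> complex) \<Rightarrow> bool" where
  "mlin [] f \<longleftrightarrow> True"
| "mlin (X # Xs) f \<longleftrightarrow> (\<forall>x\<in>carrier X. mlin Xs (\<lambda>xs. f (x # xs))) \<and>
     (\<forall>xs\<in>vecs Xs. linear_form X (\<lambda>x. f (x # xs)))"

lemma mlin_iff_slots:
  "mlin Xs f \<longleftrightarrow> (\<forall>xs\<in>vecs Xs. \<forall>i<length Xs.
     \<forall>u\<in>carrier (Xs ! i). \<forall>v\<in>carrier (Xs ! i). \<forall>c.
       f (xs[i := u \<oplus>\<^bsub>Xs ! i\<^esub> v]) = f (xs[i := u]) + f (xs[i := v]) \<and>
       f (xs[i := c \<odot>\<^bsub>Xs ! i\<^esub> u]) = c * f (xs[i := u]))"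
proof (induction Xs arbitrary: f)
  case (Cons X Xs)
  have "(\<forall>xs\<in>vecs (X # Xs). \<forall>i<length (X # Xs). Q xs i) \<longleftrightarrow>
      (\<forall>x\<in>carrier X. \<forall>xs\<in>vecs Xs. \<forall>i<length Xs. Q (x # xs) (Suc i)) \<and>
      (\<forall>xs\<in>vecs Xs. \<forall>x\<in>carrier X. Q (x # xs) 0)" for Q
    by (simp add: ball_listset_Cons All_less_Suc2) blast
  note this[of "\<lambda>xs i. \<forall>u\<in>carrier ((X # Xs) ! i). \<forall>v\<in>carrier ((X # Xs) ! i). \<forall>c.
       f (xs[i := u \<oplus>\<^bsub>(X # Xs) ! i\<^esub> v]) = f (xs[i := u]) + f (xs[i := v]) \<and>
       f (xs[i := c \<odot>\<^bsub>(X # Xs) ! i\<^esub> u]) = c * f (xs[i := u])"]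
  then show ?case unfolding mlin.simps Cons.IH
    by (simp only:, simp add: linear_form_def) blast
qed simp

text \<open>
  Antilinearity in the vectors of \<open>Ys\<close> is linearity over the dual spaces.
\<close>

lemma mlin_dual_iff_slots:
  "mlin (map dual Ys) f \<longleftrightarrow> (\<forall>ys\<in>vecs Ys. \<forall>j<length Ys.
     \<forall>u\<in>carrier (Ys ! j). \<forall>v\<in>carrier (Ys ! j). \<forall>c.
       f (ys[j := u \<oplus>\<^bsub>Ys ! j\<^esub> v]) = f (ys[j := u]) + f (ys[j := v]) \<and>
       f (ys[j := c \<odot>\<^bsub>Ys ! j\<^esub> u]) = cnj c * f (ys[j := u]))"
proof -
  have *: "(\<forall>c. P \<and> f (ys[j := cnj c \<odot>\<^bsub>Y\<^esub> u]) = c * z) \<longleftrightarrow>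
      (\<forall>c. P \<and> f (ys[j := c \<odot>\<^bsub>Y\<^esub> u]) = cnj c * z)" for P ys j Y u z
    by (metis complex_cnj_cnj)
  have "mlin (map dual Ys) f \<longleftrightarrow> (\<forall>ys\<in>vecs Ys. \<forall>j<length Ys.
     \<forall>u\<in>carrier (Ys ! j). \<forall>v\<in>carrier (Ys ! j). \<forall>c.
       f (ys[j := u \<oplus>\<^bsub>Ys ! j\<^esub> v]) = f (ys[j := u]) + f (ys[j := v]) \<and>
       f (ys[j := cnj c \<odot>\<^bsub>Ys ! j\<^esub> u]) = c * f (ys[j := u]))"
    unfolding mlin_iff_slots map_map vecs_dual length_map by (simp cong: conj_cong)
  then show ?thesis by (simp only: *)
qed

lemma opers_iff:
  "k \<in> opers Xs Ys \<longleftrightarrow> (\<forall>ys xs. \<not> (ys \<in> vecs Ys \<and> xs \<in> vecs Xs) \<longrightarrow> k ys xs = 0) \<and>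
     (\<forall>ys\<in>vecs Ys. mlin Xs (k ys)) \<and> (\<forall>xs\<in>vecs Xs. mlin (map dual Ys) (\<lambda>ys. k ys xs))"
  unfolding opers_def mlin_iff_slots[of Xs] mlin_dual_iff_slots by blast

lemma op_subspace_opers [simp]: "op_subspace (opers Xs Ys)"
  unfolding op_subspace_def opers_def op_zero_def by (simp add: algebra_simps)

lemma op_subspace_zero: "op_subspace V \<Longrightarrow> op_zero \<in> V"
  by (simp add: op_subspace_def)

lemma op_subspace_add: "op_subspace V \<Longrightarrow> k \<in> V \<Longrightarrow> l \<in> V \<Longrightarrow> (\<lambda>ys xs. k ys xs + l ys xs) \<in> V"
  by (simp add: op_subspace_def)

lemma op_subspace_smult: "op_subspace V \<Longrightarrow> k \<in> V \<Longrightarrow> (\<lambda>ys xs. c * k ys xs) \<in> V"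
  by (simp add: op_subspace_def)

lemma op_subspace_sum:
  assumes "op_subspace V" "\<And>i. i \<in> I \<Longrightarrow> k i \<in> V"
  shows "(\<lambda>ys xs. \<Sum>i\<in>I. k i ys xs) \<in> V"
  using assms(2)
proof (induction I rule: infinite_finite_induct)
  case (insert i I)
  then have "k i \<in> V" "(\<lambda>ys xs. \<Sum>i\<in>I. k i ys xs) \<in> V" by auto
  from op_subspace_add[OF assms(1) this] show ?case using insert by simp
qed (use op_subspace_zero[OF assms(1)] in \<open>simp_all add: op_zero_def\<close>)

text \<open>
  A form is determined by its values on basis vectors; \<^const>\<open>op_id\<close> supplies the coordinates.
\<close>

lemma mlin_expand:
  assumes "\<forall>X\<in>set Xs. tame X" "mlin Xs f" "xs \<in> vecs Xs"
  shows "f xs = (\<Sum>es\<in>listset (map onb Xs). op_id Xs es xs * f es)"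
  using assms
proof (induction Xs arbitrary: f xs)
  case Nil
  then show ?case by (simp add: op_id_def)
next
  case (Cons X Xs)
  from Cons.prems(3) obtain x us where xs: "xs = x # us" "x \<in> carrier X" "us \<in> vecs Xs"
    by (auto elim: listset_ConsE)
  have X: "tame X" using Cons.prems by simp
  have id: "op_id (X # Xs) (e # es) xs = ip X e x * op_id Xs es us"
    if "e \<in> carrier X" for e es
    using that xs by (simp add: op_id_def prod.lessThan_Suc_shift del: prod.lessThan_Suc)
  have "f xs = (\<Sum>e\<in>onb X. ip X e x * f (e # us))"
    using linear_form_expand[OF X _ xs(2), of "\<lambda>x. f (x # us)"] Cons.prems(2) xs by simp
  also have "\<dots> = (\<Sum>e\<in>onb X. ip X e x * (\<Sum>es\<in>listset (map onb Xs). op_id Xs es us * f (e # es)))"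
    using Cons.IH[of "\<lambda>us. f (_ # us)" us] Cons.prems xs onb_carrier[OF X]
    by (intro sum.cong refl) simp
  also have "\<dots> = (\<Sum>es\<in>listset (map onb (X # Xs)). op_id (X # Xs) es xs * f es)"
    unfolding list.map sum_listset_Cons
    by (intro sum.cong refl) (simp add: sum_distrib_left id onb_carrier[OF X] mult.assoc)
  finally show ?case .
qed

lemma listset_onb_vecs: "\<forall>X\<in>set Xs. tame X \<Longrightarrow> es \<in> listset (map onb Xs) \<Longrightarrow> es \<in> vecs Xs"
  by (induction Xs arbitrary: es) (auto elim!: listset_ConsE simp: onb_carrier)

lemma finite_listset_onb: "\<forall>X\<in>set Xs. tame X \<Longrightarrow> finite (listset (map onb Xs))"
proof (induction Xs)
  case (Cons X Xs)
  then show ?case by (simp add: listset.simps(2) set_Cons_def image_def[symmetric] flip: )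
     (rule finite_subset[of _ "(\<lambda>(x, xs). x # xs) ` (onb X \<times> listset (map onb Xs))"], auto)
qed simp

lemma op_id_basis:
  assumes "\<forall>X\<in>set Xs. tame X" "es \<in> listset (map onb Xs)" "fs \<in> listset (map onb Xs)"
  shows "op_id Xs es fs = (if es = fs then 1 else 0)"
  using assms
proof (induction Xs arbitrary: es fs)
  case Nil
  then show ?case by (simp add: op_id_def)
next
  case (Cons X Xs)
  from Cons.prems obtain e es' f fs' where *: "es = e # es'" "fs = f # fs'"
    "e \<in> onb X" "f \<in> onb X" "es' \<in> listset (map onb Xs)" "fs' \<in> listset (map onb Xs)"
    by (auto elim!: listset_ConsE)
  have X: "tame X" using Cons.prems by simp
  have "op_id (X # Xs) (e # es') (f # fs') = ip X e f * op_id Xs es' fs'"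
    using onb_carrier[OF X] * by (simp add: op_id_def prod.lessThan_Suc_shift del: prod.lessThan_Suc)
  then show ?case using Cons.IH[of es' fs'] Cons.prems(1) * onb_ip[OF X] by simp
qed

lemma mlin_mult_const: "mlin Xs f \<Longrightarrow> mlin Xs (\<lambda>xs. c * f xs)"
  by (induction Xs arbitrary: f) (auto simp: linear_form_def algebra_simps)

lemma mlin_cong:
  assumes "\<forall>X\<in>set Xs. tame X" "\<And>xs. xs \<in> vecs Xs \<Longrightarrow> f xs = g xs"
  shows "mlin Xs f \<longleftrightarrow> mlin Xs g"
  using assms
proof (induction Xs arbitrary: f g)
  case (Cons X Xs)
  interpret hermitian X using Cons.prems(1) by (simp add: tame_def)
  have "mlin Xs (\<lambda>xs. f (x # xs)) \<longleftrightarrow> mlin Xs (\<lambda>xs. g (x # xs))" if "x \<in> carrier X" for x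
    by (rule Cons.IH) (use Cons.prems that in auto)
  moreover have "linear_form X (\<lambda>x. f (x # xs)) \<longleftrightarrow> linear_form X (\<lambda>x. g (x # xs))" if "xs \<in> vecs Xs" for xs
    using Cons.prems(2) that by (simp add: linear_form_def)
  ultimately show ?case by simp
qed simp

text \<open>The value 0 outside the spaces makes a form equal to any other that agrees with it on product vectors.\<close>

definition form :: "'v hilb list \<Rightarrow> ('v list \<Rightarrow> complex) \<Rightarrow> 'v opr" where
  "form Xs f = (\<lambda>ys xs. if ys = [] \<and> xs \<in> vecs Xs then f xs else 0)"

lemma form_apply [simp]: "xs \<in> vecs Xs \<Longrightarrow> form Xs f [] xs = f xs"
  by (simp add: form_def)

lemma forms_iff: "k \<in> opers Xs [] \<longleftrightarrow> (\<forall>ys xs. \<not> (ys = [] \<and> xs \<in> vecs Xs) \<longrightarrow> k ys xs = 0) \<and> mlin Xs (k [])"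
  by (auto simp: opers_iff)

lemma form_in_opers:
  assumes "\<forall>X\<in>set Xs. tame X" "mlin Xs f"
  shows "form Xs f \<in> opers Xs []"
proof -
  have "mlin Xs (form Xs f []) \<longleftrightarrow> mlin Xs f" by (rule mlin_cong[OF assms(1)]) simp
  then show ?thesis using assms(2) by (auto simp: forms_iff) (auto simp: form_def)
qed

lemma forms_eqI:
  assumes "k \<in> opers Xs []" "l \<in> opers Xs []" "\<And>xs. xs \<in> vecs Xs \<Longrightarrow> k [] xs = l [] xs"
  shows "k = l"
proof (intro ext)
  show "k ys xs = l ys xs" for ys xs
    using assms by (cases "ys = [] \<and> xs \<in> vecs Xs") (auto simp: forms_iff)
qed

lemma form_cong: "(\<And>xs. xs \<in> vecs Xs \<Longrightarrow> f xs = g xs) \<Longrightarrow> form Xs f = form Xs g"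
  by (auto simp: form_def fun_eq_iff)

lemma mlin_op_id:
  assumes "\<forall>X\<in>set Xs. tame X" "es \<in> vecs Xs"
  shows "mlin Xs (op_id Xs es)"
  using assms
proof (induction Xs arbitrary: es)
  case (Cons X Xs)
  from Cons.prems(2) obtain e fs where es: "es = e # fs" "e \<in> carrier X" "fs \<in> vecs Xs"
    by (auto elim: listset_ConsE)
  interpret hermitian X using Cons.prems(1) by (simp add: tame_def)
  have id: "op_id (X # Xs) es (x # xs) = (if x \<in> carrier X then ip X e x * op_id Xs fs xs else 0)" for x xs
    using es by (simp add: op_id_def prod.lessThan_Suc_shift del: prod.lessThan_Suc)
  show ?case using Cons.IH[OF _ es(3)] Cons.prems(1) es(2)
    unfolding mlin.simps id by (simp add: mlin_mult_const linear_form_def ip_add_right ip_smult_right algebra_simps)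
qed simp

text \<open>For operators to the scalars, \<open>Tr(l\<^sup>\<dagger> k)\<close> is the following sum over basis vectors (\<open>cmp_rel_neg\<close>).\<close>

definition form_ip :: "'v hilb list \<Rightarrow> 'v opr \<Rightarrow> 'v opr \<Rightarrow> complex" where
  "form_ip Xs l k = (\<Sum>es\<in>listset (map onb Xs). cnj (l [] es) * k [] es)"

definition form_space :: "'v hilb list \<Rightarrow> 'v opr hilb" where
  "form_space Xs = \<lparr>carrier = opers Xs [], mult = undefined, one = undefined, zero = op_zero,
     add = (\<lambda>k l ys xs. k ys xs + l ys xs), smult = (\<lambda>c k ys xs. c * k ys xs), ip = form_ip Xs\<rparr>"

lemma form_eq_0I:
  assumes "\<forall>X\<in>set Xs. tame X" "k \<in> opers Xs []" "\<And>es. es \<in> listset (map onb Xs) \<Longrightarrow> k [] es = 0"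
  shows "k = op_zero"
proof (rule forms_eqI[OF assms(2)])
  show "op_zero \<in> opers Xs []" using op_subspace_opers[of Xs "[]"] by (simp add: op_subspace_def)
  show "k [] xs = op_zero [] xs" if "xs \<in> vecs Xs" for xs
    using mlin_expand[OF assms(1) _ that, of "k []"] assms(2,3) by (simp add: forms_iff op_zero_def)
qed

lemma hermitian_form_space:
  assumes "\<forall>X\<in>set Xs. tame X"
  shows "hermitian (form_space Xs)"
proof -
  have sub: "op_subspace (opers Xs [])" by simp
  note sub = sub[unfolded op_subspace_def]
  interpret abelian_group "form_space Xs"
  proof (rule abelian_groupI; simp add: form_space_def sub)
    fix x assume x: "x \<in> opers Xs []"
    show "\<exists>y\<in>opers Xs []. (\<lambda>ys xs. y ys xs + x ys xs) = op_zero"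
    proof (rule bexI)
      show "(\<lambda>ys xs. (- 1) * x ys xs) \<in> opers Xs []" using sub x by blast
    qed (simp add: op_zero_def)
  qed (simp_all add: op_zero_def fun_eq_iff)
  show ?thesis
  proof (unfold_locales, goal_cases)
    case (9 x)
    then have x: "x \<in> opers Xs []" "x \<noteq> op_zero" by (simp_all add: form_space_def)
    then obtain es where es: "es \<in> listset (map onb Xs)" "x [] es \<noteq> 0"
      using form_eq_0I[OF assms x(1)] by blast
    have "Re (form_ip Xs x x) = (\<Sum>es\<in>listset (map onb Xs). (cmod (x [] es))\<^sup>2)"
      unfolding form_ip_def Re_sum
      by (rule sum.cong) (simp_all add: cmod_def power2_eq_square)
    also have "\<dots> > 0"
      using finite_listset_onb[OF assms] es by (intro sum_pos2[of _ es]) auto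
    finally show ?case by (simp add: form_space_def)
  qed (simp_all add: form_space_def sub form_ip_def sum_distrib_left sum.distrib algebra_simps)
qed

definition perp :: "'v hilb list \<Rightarrow> 'v opr set \<Rightarrow> 'v opr set" where
  "perp Xs V = {k \<in> opers Xs []. \<forall>l\<in>V. form_ip Xs l k = 0}"

lemma op_subspace_perp: "op_subspace (perp Xs V)"
  using op_subspace_opers[of Xs "[]"] unfolding op_subspace_def
  by (auto simp: perp_def form_ip_def op_zero_def algebra_simps sum.distrib simp flip: sum_distrib_left)

text \<open>
  The orthomodular law. If \<open>k\<close> belongs to the left-hand side, then its component orthogonal to
  \<open>V\<close> lies in \<open>W\<close>, so it is orthogonal to \<open>k\<close> and thereby to itself.
\<close>

lemma orthomodular:
  assumes tame: "\<forall>X\<in>set Xs. tame X" and V: "op_subspace V" "V \<subseteq> opers Xs []"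
    and W: "op_subspace W" "W \<subseteq> opers Xs []" "V \<subseteq> W"
  shows "W \<inter> perp Xs (W \<inter> perp Xs V) = V"
proof
  interpret hermitian "form_space Xs" by (rule hermitian_form_space[OF tame])
  have FS: "carrier (form_space Xs) = opers Xs []" "ip (form_space Xs) = form_ip Xs"
    "\<zero>\<^bsub>form_space Xs\<^esub> = op_zero"
    "k \<oplus>\<^bsub>form_space Xs\<^esub> l = (\<lambda>ys xs. k ys xs + l ys xs)"
    "c \<odot>\<^bsub>form_space Xs\<^esub> k = (\<lambda>ys xs. c * k ys xs)" for k l c
    by (simp_all add: form_space_def)
  show "V \<subseteq> W \<inter> perp Xs (W \<inter> perp Xs V)"
  proof
    fix v assume v: "v \<in> V"
    have "form_ip Xs l v = 0" if "l \<in> perp Xs V" for l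
      using ip_sym[of l v] v V that by (auto simp: FS perp_def)
    then show "v \<in> W \<inter> perp Xs (W \<inter> perp Xs V)" using v V W by (auto simp: perp_def)
  qed
  show "W \<inter> perp Xs (W \<inter> perp Xs V) \<subseteq> V"
  proof
    fix k assume k: "k \<in> W \<inter> perp Xs (W \<inter> perp Xs V)"
    then have kC: "k \<in> opers Xs []" by (simp add: perp_def)
    \<comment> \<open>the coordinate forms are an orthonormal basis, which bounds the size of orthonormal sets\<close>
    let ?\<delta> = "\<lambda>es. form Xs (op_id Xs es)"
    let ?J = "?\<delta> ` listset (map onb Xs)"
    have \<delta>C: "?\<delta> es \<in> opers Xs []" if "es \<in> listset (map onb Xs)" for es
      using that listset_onb_vecs[OF tame] mlin_op_id[OF tame] by (intro form_in_opers[OF tame]) blast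
    have \<delta>: "?\<delta> es [] fs = (if es = fs then 1 else 0)"
      if "es \<in> listset (map onb Xs)" "fs \<in> listset (map onb Xs)" for es fs
      using op_id_basis[OF tame that] listset_onb_vecs[OF tame that(2)] by simp
    have ip\<delta>: "form_ip Xs (?\<delta> es) l = l [] es" if "es \<in> listset (map onb Xs)" for es l
    proof -
      have "form_ip Xs (?\<delta> es) l = (\<Sum>fs\<in>listset (map onb Xs). if fs = es then l [] fs else 0)"
        unfolding form_ip_def using \<delta>[OF that] by (intro sum.cong) auto
      also have "\<dots> = l [] es" using that finite_listset_onb[OF tame] by simp
      finally show ?thesis .
    qed
    have "is_onb (form_space Xs) ?J"
      unfolding is_onb_def FS
    proof (intro conjI ballI impI)
      show "?J \<subseteq> opers Xs []" using \<delta>C by auto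
      show "finite ?J" using finite_listset_onb[OF tame] by simp
      show "form_ip Xs e f = (if e = f then 1 else 0)" if "e \<in> ?J" "f \<in> ?J" for e f
        using that ip\<delta> \<delta> by (auto split: if_splits)
      show "x = op_zero" if "x \<in> opers Xs []" "\<forall>e\<in>?J. form_ip Xs e x = 0" for x
        using form_eq_0I[OF tame that(1)] that(2) ip\<delta> by auto
    qed
    then have bound: "orthonormal E \<Longrightarrow> card E \<le> card ?J" for E
      by (rule card_orthonormal_le_onb)
    have "subsp V" using V by (auto simp: subsp_def FS op_subspace_def)
    from orthogonal_projection_exists[OF this bound, of k] kC
    obtain w where w: "w \<in> V" "\<And>v. v \<in> V \<Longrightarrow> form_ip Xs v k = form_ip Xs v w"
      by (auto simp: FS)
    have wC: "w \<in> opers Xs []" using w V by auto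
    define z where "z = k \<oplus>\<^bsub>form_space Xs\<^esub> (- 1) \<odot>\<^bsub>form_space Xs\<^esub> w"
    have zC: "z \<in> carrier (form_space Xs)" unfolding z_def
      by (intro a_closed smult_carrier) (simp_all add: FS(1) kC wC)
    have ipz: "form_ip Xs v z = form_ip Xs v k - form_ip Xs v w" for v
      unfolding z_def FS(4,5) form_ip_def by (simp add: right_diff_distrib sum_subtractf)
    have kW: "k \<in> W" and wW: "w \<in> W" using k w(1) W(3) by auto
    have "z \<in> W" unfolding z_def FS(4,5)
      by (intro op_subspace_add op_subspace_smult W(1) kW wW)
    moreover have "z \<in> perp Xs V" using ipz w zC V by (auto simp: perp_def FS(1))
    ultimately have "form_ip Xs z k = 0" "form_ip Xs z w = 0"
      using k w(1) ip_sym[of z w] zC wC by (auto simp: perp_def FS(1,2))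
    then have "z = op_zero"
      using ip_self_0[OF zC] ipz[of z] zC by (simp add: FS(1,2,3))
    then have "k = w" by (auto simp: z_def FS fun_eq_iff op_zero_def)
    then show "k \<in> V" using w by simp
  qed
qed

lemma perp_perp:
  assumes "\<forall>X\<in>set Xs. tame X" "op_subspace V" "V \<subseteq> opers Xs []"
  shows "perp Xs (perp Xs V) = V"
proof -
  have "opers Xs [] \<inter> perp Xs V' = perp Xs V'" for V' by (auto simp: perp_def)
  with orthomodular[OF assms op_subspace_opers _ assms(3)] show ?thesis by simp
qed

lemma perp_zero [simp]: "perp Xs {op_zero} = opers Xs []"
  by (simp add: perp_def form_ip_def op_zero_def)

section \<open>Relations and the connectives\<close>

lemma op_span_subspace [simp]: "op_subspace (op_span S)"
  unfolding op_span_def by (rule hull_in) (auto simp: op_subspace_def)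

lemma op_span_superset: "S \<subseteq> op_span S"
  unfolding op_span_def by (rule hull_subset)

lemma op_span_least: "S \<subseteq> V \<Longrightarrow> op_subspace V \<Longrightarrow> op_span S \<subseteq> V"
  unfolding op_span_def by (rule hull_minimal)

lemma op_zero_subspace [simp]: "op_subspace {op_zero}"
  by (simp add: op_subspace_def op_zero_def)

lemma op_zero_in_opers [simp]: "op_zero \<in> opers Xs Ys"
  by (rule op_subspace_zero) simp

lemma src_mk_rel [simp]: "src (mk_rel Qs Ps f) = Qs"
  and tgt_mk_rel [simp]: "tgt (mk_rel Qs Ps f) = Ps"
  and cmp_mk_rel: "cmp (mk_rel Qs Ps f) Xs Ys =
        (if Xs \<in> listset Qs \<and> Ys \<in> listset Ps then f Xs Ys else {op_zero})"
  by (simp_all add: mk_rel_def)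

lemma is_brel_mk_rel:
  assumes "\<And>Xs Ys. Xs \<in> listset Qs \<Longrightarrow> Ys \<in> listset Ps \<Longrightarrow> op_subspace (f Xs Ys) \<and> f Xs Ys \<subseteq> opers Xs Ys"
  shows "is_brel (mk_rel Qs Ps f)"
  using assms by (auto simp: is_brel_def cmp_mk_rel)

lemma is_brelD:
  assumes "is_brel R"
  shows "op_subspace (cmp R Xs Ys)" "Xs \<in> listset (src R) \<Longrightarrow> Ys \<in> listset (tgt R) \<Longrightarrow> cmp R Xs Ys \<subseteq> opers Xs Ys"
    "\<not> (Xs \<in> listset (src R) \<and> Ys \<in> listset (tgt R)) \<Longrightarrow> cmp R Xs Ys = {op_zero}"
  using assms unfolding is_brel_def by (metis op_zero_subspace)+

lemma is_brel_eqI: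
  assumes "is_brel R" "is_brel S" "src R = src S" "tgt R = tgt S"
    and "\<And>Xs Ys. Xs \<in> listset (src R) \<Longrightarrow> Ys \<in> listset (tgt R) \<Longrightarrow> cmp R Xs Ys = cmp S Xs Ys"
  shows "R = (S :: 'v brel)"
proof -
  have "cmp R Xs Ys = cmp S Xs Ys" for Xs Ys
    using assms is_brelD(3)[OF assms(1), of Xs Ys] is_brelD(3)[OF assms(2), of Xs Ys] by metis
  then have "cmp R = cmp S" by (intro ext)
  then show ?thesis using assms(3,4) by (cases R, cases S) simp
qed

lemma rels_mk_rel:
  assumes "\<And>Xs. Xs \<in> listset Qs \<Longrightarrow> op_subspace (f Xs []) \<and> f Xs [] \<subseteq> opers Xs []"
  shows "mk_rel Qs [] f \<in> rels Qs"
proof -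
  have "is_brel (mk_rel Qs [] f)" by (rule is_brel_mk_rel) (use assms in simp)
  then show ?thesis by (simp add: rels_def)
qed

lemma relsD:
  assumes "R \<in> rels Qs"
  shows "src R = Qs" "tgt R = []" "op_subspace (cmp R Xs Ys)" "Xs \<in> listset Qs \<Longrightarrow> cmp R Xs [] \<subseteq> opers Xs []"
    "\<not> (Xs \<in> listset Qs \<and> Ys = []) \<Longrightarrow> cmp R Xs Ys = {op_zero}"
  using assms is_brelD[of R] by (auto simp: rels_def)

lemma perp_subset: "perp Xs V \<subseteq> opers Xs []"
  by (auto simp: perp_def)

lemma op_subspace_Int: "op_subspace V \<Longrightarrow> op_subspace W \<Longrightarrow> op_subspace (V \<inter> W)"
  by (simp add: op_subspace_def)

lemma rel_neg_rels: "R \<in> rels Qs \<Longrightarrow> rel_neg R \<in> rels Qs"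
  and cmp_rel_neg: "R \<in> rels Qs \<Longrightarrow> Xs \<in> listset Qs \<Longrightarrow> cmp (rel_neg R) Xs [] = perp Xs (cmp R Xs [])"
proof -
  assume R: "R \<in> rels Qs"
  have eq: "{k \<in> opers Xs []. \<forall>l\<in>cmp R Xs []. op_trace Xs (op_mult [] (op_adj l) k) = 0} = perp Xs (cmp R Xs [])" for Xs
    by (simp add: perp_def op_trace_def op_mult_def op_adj_def form_ip_def)
  show "rel_neg R \<in> rels Qs"
    unfolding rel_neg_def relsD(1,2)[OF R]
    by (rule rels_mk_rel) (simp add: eq op_subspace_perp perp_subset)
  show "cmp (rel_neg R) Xs [] = perp Xs (cmp R Xs [])" if "Xs \<in> listset Qs"
    using that by (simp add: rel_neg_def relsD(1,2)[OF R] cmp_mk_rel eq)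
qed

lemma rel_inf_rels: "R \<in> rels Qs \<Longrightarrow> S \<in> rels Qs \<Longrightarrow> rel_inf R S \<in> rels Qs"
  unfolding rel_inf_def
  by (simp only: relsD(1,2), rule rels_mk_rel) (intro conjI op_subspace_Int relsD(3) le_infI1 relsD(4))

lemma cmp_rel_inf: "R \<in> rels Qs \<Longrightarrow> Xs \<in> listset Qs \<Longrightarrow> cmp (rel_inf R S) Xs [] = cmp R Xs [] \<inter> cmp S Xs []"
  by (simp add: rel_inf_def relsD(1,2) cmp_mk_rel)

lemma rel_Sup_rels:
  assumes "\<And>R. R \<in> \<R> \<Longrightarrow> R \<in> rels Qs"
  shows "rel_Sup Qs [] \<R> \<in> rels Qs"
  unfolding rel_Sup_def
proof (rule rels_mk_rel)
  fix Xs assume "Xs \<in> listset Qs"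
  then have "(\<Union>R\<in>\<R>. cmp R Xs []) \<subseteq> opers Xs []" using assms relsD(4) by blast
  then show "op_subspace (op_span (\<Union>R\<in>\<R>. cmp R Xs [])) \<and> op_span (\<Union>R\<in>\<R>. cmp R Xs []) \<subseteq> opers Xs []"
    by (simp add: op_span_least)
qed

text \<open>
  The function \<^const>\<open>interp\<close> is total. Where a formula applies relations to terms of the wrong
  sorts, its value need not have the arity of the context, on which all the rules below rely.
\<close>

abbreviation sem :: "'v var list \<Rightarrow> 'v fm \<Rightarrow> 'v hilb list \<Rightarrow> 'v opr set" where
  "sem ctx \<phi> Xs \<equiv> cmp (interp ctx \<phi>) Xs []"

definition wf_fm :: "'v var list \<Rightarrow> 'v fm \<Rightarrow> bool" where
  "wf_fm ctx \<phi> \<longleftrightarrow> interp ctx \<phi> \<in> rels (map sort_of ctx)"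

abbreviation atoms_of :: "'v var list \<Rightarrow> 'v hilb list set" where
  "atoms_of ctx \<equiv> listset (map sort_of ctx)"

definition tame_ctx :: "'v var list \<Rightarrow> bool" where
  "tame_ctx ctx \<longleftrightarrow> (\<forall>v\<in>set ctx. \<forall>X\<in>sort_of v. tame X)"

lemma tame_ctx_simps [simp]: "tame_ctx []"
  "tame_ctx (v # ctx) \<longleftrightarrow> (\<forall>X\<in>sort_of v. tame X) \<and> tame_ctx ctx"
  by (auto simp: tame_ctx_def)

lemma tame_atoms: "tame_ctx ctx \<Longrightarrow> Xs \<in> atoms_of ctx \<Longrightarrow> \<forall>X\<in>set Xs. tame X"
  by (induction ctx arbitrary: Xs) (auto elim!: listset_ConsE)

lemma sem_subspace: "wf_fm ctx \<phi> \<Longrightarrow> op_subspace (sem ctx \<phi> Xs)"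
  by (auto simp: wf_fm_def intro: relsD)

lemma sem_opers: "wf_fm ctx \<phi> \<Longrightarrow> Xs \<in> atoms_of ctx \<Longrightarrow> sem ctx \<phi> Xs \<subseteq> opers Xs []"
  unfolding wf_fm_def by (rule relsD)

lemma wf_Neg [simp]: "wf_fm ctx \<phi> \<Longrightarrow> wf_fm ctx (Neg \<phi>)"
  by (simp add: wf_fm_def rel_neg_rels)

lemma wf_Conj [simp]: "wf_fm ctx \<phi> \<Longrightarrow> wf_fm ctx \<psi> \<Longrightarrow> wf_fm ctx (Conj \<phi> \<psi>)"
  by (simp add: wf_fm_def rel_inf_rels)

lemma wf_All [simp]: "wf_fm ctx (All v \<phi>)"
  unfolding wf_fm_def interp.simps by (rule rel_Sup_rels) blast

lemma wf_Impl [simp]: "wf_fm ctx \<phi> \<Longrightarrow> wf_fm ctx \<psi> \<Longrightarrow> wf_fm ctx (Impl \<phi> \<psi>)"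
  by (simp add: Impl_def Disj_def)

lemma wf_AllEq [simp]: "wf_fm ctx (AllEq x x' \<phi>)"
  by (simp add: AllEq_def)

lemma wf_ExEq [simp]: "wf_fm ctx (ExEq x x' \<phi>)"
  by (simp add: ExEq_def)

lemma sem_Neg: "wf_fm ctx \<phi> \<Longrightarrow> Xs \<in> atoms_of ctx \<Longrightarrow> sem ctx (Neg \<phi>) Xs = perp Xs (sem ctx \<phi> Xs)"
  unfolding wf_fm_def interp.simps by (rule cmp_rel_neg)

lemma sem_Conj: "wf_fm ctx \<phi> \<Longrightarrow> Xs \<in> atoms_of ctx \<Longrightarrow>
    sem ctx (Conj \<phi> \<psi>) Xs = sem ctx \<phi> Xs \<inter> sem ctx \<psi> Xs"
  unfolding wf_fm_def interp.simps by (rule cmp_rel_inf)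

text \<open>
  The definition of the arrow contains a double negation, which cancels because subspaces of a
  finite-dimensional space are closed.
\<close>

lemma sem_Impl:
  assumes "tame_ctx ctx" "wf_fm ctx \<phi>" "wf_fm ctx \<psi>" "Xs \<in> atoms_of ctx"
  shows "sem ctx (Impl \<phi> \<psi>) Xs =
    perp Xs (sem ctx \<phi> Xs \<inter> perp Xs (sem ctx \<phi> Xs \<inter> sem ctx \<psi> Xs))"
  using assms perp_perp[OF tame_atoms[OF assms(1,4)] sem_subspace[OF assms(2)] sem_opers[OF assms(2,4)]]
  by (simp add: Impl_def Disj_def sem_Neg sem_Conj del: interp.simps)

lemma sem_Impl_top:
  assumes "tame_ctx ctx" "wf_fm ctx \<phi>" "wf_fm ctx \<psi>" "Xs \<in> atoms_of ctx" "sem ctx \<phi> Xs = opers Xs []"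
  shows "sem ctx (Impl \<phi> \<psi>) Xs = sem ctx \<psi> Xs"
proof -
  have "opers Xs [] \<inter> sem ctx \<psi> Xs = sem ctx \<psi> Xs" "opers Xs [] \<inter> perp Xs V = perp Xs V" for V
    using sem_opers[OF assms(3,4)] by (auto simp: perp_def)
  then show ?thesis
    using perp_perp[OF tame_atoms[OF assms(1,4)] sem_subspace[OF assms(3)] sem_opers[OF assms(3,4)]]
    by (simp add: sem_Impl[OF assms(1-4)] assms(5))
qed

lemma sem_Impl_bot:
  assumes "tame_ctx ctx" "wf_fm ctx \<phi>" "wf_fm ctx \<psi>" "Xs \<in> atoms_of ctx" "sem ctx \<phi> Xs = {op_zero}"
  shows "sem ctx (Impl \<phi> \<psi>) Xs = opers Xs []"
proof -
  have "{op_zero} \<inter> perp Xs V = {op_zero}" for V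
    using op_subspace_zero[OF op_subspace_perp] by blast
  then show ?thesis by (simp add: sem_Impl[OF assms(1-4)] assms(5))
qed

section \<open>Quantifiers\<close>

abbreviation tensor1 :: "'v hilb \<Rightarrow> 'v opr \<Rightarrow> 'v opr \<Rightarrow> 'v opr" where
  "tensor1 X l k \<equiv> op_tensor [X] [] l k"

lemma tensor1_apply [simp]: "tensor1 X l k [] (x # xs) = l [] [x] * k [] xs"
  by (simp add: op_tensor_def)

lemma mlin_append:
  assumes "\<forall>X\<in>set Us. tame X" "mlin Us f" "mlin Rs g"
  shows "mlin (Us @ Rs) (\<lambda>xs. f (take (length Us) xs) * g (drop (length Us) xs))"
  using assms
proof (induction Us arbitrary: f)
  case (Cons U Us)
  have lin: "linear_form U (\<lambda>x. f (x # take (length Us) xs))" if "xs \<in> vecs (Us @ Rs)" for xs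
  proof -
    have "take (length Us) xs \<in> vecs Us"
      using that by (simp add: listset_iff list_all2_append2) force
    then show ?thesis using Cons.prems by simp
  qed
  show ?case
    unfolding append_Cons mlin.simps
  proof (intro conjI ballI)
    fix x assume "x \<in> carrier U"
    then show "mlin (Us @ Rs) (\<lambda>xs. f (take (length (U # Us)) (x # xs)) * g (drop (length (U # Us)) (x # xs)))"
      using Cons.IH[of "\<lambda>xs. f (x # xs)"] Cons.prems by simp
  next
    fix xs assume "xs \<in> vecs (Us @ Rs)"
    from lin[OF this] show "linear_form U (\<lambda>x. f (take (length (U # Us)) (x # xs)) * g (drop (length (U # Us)) (x # xs)))"
      by (simp add: linear_form_def algebra_simps)
  qed
qed (simp add: mlin_mult_const)

lemma op_tensor_opers:
  fixes Us Rs :: "'v hilb list"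
  assumes tame: "\<forall>X\<in>set Us. tame X" and r: "r \<in> opers Us []" and s: "s \<in> opers Rs []"
  shows "op_tensor Us [] r s \<in> opers (Us @ Rs) []"
  unfolding forms_iff
proof (intro conjI allI impI)
  show "mlin (Us @ Rs) (op_tensor Us [] r s [])"
    unfolding op_tensor_def using mlin_append[OF tame, of "r []" Rs "s []"] r s
    by (simp add: forms_iff)
  fix ys xs :: "'v list" assume n: "\<not> (ys = [] \<and> xs \<in> vecs (Us @ Rs))"
  have "xs \<in> vecs (Us @ Rs)" if "take (length Us) xs \<in> vecs Us" "drop (length Us) xs \<in> vecs Rs"
    using list_all2_appendI[of "(\<in>)" "take (length Us) xs" "map carrier Us" "drop (length Us) xs" "map carrier Rs"] that
    by (simp add: listset_iff)
  with n r s show "op_tensor Us [] r s ys xs = 0"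
    by (auto simp: op_tensor_def forms_iff)
qed

lemma tensor1_opers: "tame X \<Longrightarrow> l \<in> opers [X] [] \<Longrightarrow> k \<in> opers Xs [] \<Longrightarrow> tensor1 X l k \<in> opers (X # Xs) []"
  using op_tensor_opers[of "[X]" l k Xs] by simp

lemma cmp_top_times:
  assumes "R \<in> rels Qs" "X \<in> Q" "Xs \<in> listset Qs"
  shows "cmp (rel_times (rel_top [Q] []) R) (X # Xs) [] =
    op_span {tensor1 X l k | l k. l \<in> opers [X] [] \<and> k \<in> cmp R Xs []}"
  using assms by (simp add: rel_times_def rel_top_def cmp_mk_rel relsD(1,2)[OF assms(1)])

text \<open>
  The condition on the right-hand side cuts out a subspace, so it is not lost when the supremum takes
  spans. Conversely, a single form \<open>k\<close> with this property spans a relation in the family.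
\<close>

lemma sem_All:
  assumes tame: "tame_ctx (v # ctx)" and wf: "wf_fm (v # ctx) \<phi>" and Xs: "Xs \<in> atoms_of ctx"
  shows "sem ctx (All v \<phi>) Xs = {k \<in> opers Xs []. \<forall>X\<in>sort_of v. \<forall>l\<in>opers [X] [].
    tensor1 X l k \<in> sem (v # ctx) \<phi> (X # Xs)}" (is "_ = ?V")
proof -
  let ?Qs = "map sort_of ctx"
  let ?\<R> = "{R \<in> rels ?Qs. rel_le (rel_times (rel_top [sort_of v] []) R) (interp (v # ctx) \<phi>)}"
  have i: "interp (v # ctx) \<phi> \<in> rels (sort_of v # ?Qs)" using wf by (simp add: wf_fm_def)
  have sem_eq: "sem ctx (All v \<phi>) Xs = op_span (\<Union>R\<in>?\<R>. cmp R Xs [])"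
    using Xs by (simp add: rel_Sup_def cmp_mk_rel)
  have V: "op_subspace ?V"
  proof -
    have t: "tensor1 X l op_zero = op_zero"
      "tensor1 X l (\<lambda>ys xs. k ys xs + k' ys xs) = (\<lambda>ys xs. tensor1 X l k ys xs + tensor1 X l k' ys xs)"
      "tensor1 X l (\<lambda>ys xs. c * k ys xs) = (\<lambda>ys xs. c * tensor1 X l k ys xs)" for X l k k' c
      by (auto simp: op_tensor_def op_zero_def algebra_simps fun_eq_iff)
    show ?thesis
      unfolding op_subspace_def
      by (auto simp: t intro!: op_subspace_zero op_subspace_add op_subspace_smult sem_subspace[OF wf]
          op_subspace_opers simp del: interp.simps)
  qed
  have "(\<Union>R\<in>?\<R>. cmp R Xs []) \<subseteq> ?V"
  proof
    fix k assume "k \<in> (\<Union>R\<in>?\<R>. cmp R Xs [])"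
    then obtain R where R: "R \<in> rels ?Qs"
      "rel_le (rel_times (rel_top [sort_of v] []) R) (interp (v # ctx) \<phi>)" "k \<in> cmp R Xs []" by blast
    have "tensor1 X l k \<in> sem (v # ctx) \<phi> (X # Xs)" if "X \<in> sort_of v" "l \<in> opers [X] []" for X l
    proof -
      have "tensor1 X l k \<in> cmp (rel_times (rel_top [sort_of v] []) R) (X # Xs) []"
        unfolding cmp_top_times[OF R(1) that(1) Xs] using that R(3)
        by (intro subsetD[OF op_span_superset]) blast
      then show ?thesis using R(2) unfolding rel_le_def by blast
    qed
    then show "k \<in> ?V" using relsD(4)[OF R(1) Xs] R(3) by blast
  qed
  then have "sem ctx (All v \<phi>) Xs \<subseteq> ?V" unfolding sem_eq using V by (rule op_span_least)
  moreover have "?V \<subseteq> sem ctx (All v \<phi>) Xs"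
  proof
    fix k assume k: "k \<in> ?V"
    \<comment> \<open>the relation spanned by \<open>k\<close> at \<open>Xs\<close> and zero elsewhere belongs to the family\<close>
    define R where "R = mk_rel ?Qs [] (\<lambda>Zs Ys. if Zs = Xs then op_span {k} else {op_zero})"
    have kO: "op_span {k} \<subseteq> opers Xs []" using k by (intro op_span_least) auto
    have R: "R \<in> rels ?Qs" unfolding R_def using kO by (intro rels_mk_rel) auto
    have "cmp (rel_times (rel_top [sort_of v] []) R) Zs Ys \<subseteq> cmp (interp (v # ctx) \<phi>) Zs Ys" for Zs Ys
    proof (cases "Zs \<in> listset (sort_of v # ?Qs) \<and> Ys = []")
      case False
      then have "cmp (rel_times (rel_top [sort_of v] []) R) Zs Ys = {op_zero}"
        by (auto simp: rel_times_def cmp_mk_rel relsD(1,2)[OF R] rel_top_def)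
      then show ?thesis using op_subspace_zero[OF relsD(3)[OF i]] by simp
    next
      case True
      then obtain X Xs' where Z: "Zs = X # Xs'" "X \<in> sort_of v" "Xs' \<in> listset ?Qs" "Ys = []"
        by (auto elim: listset_ConsE)
      have "tensor1 X l r \<in> sem (v # ctx) \<phi> (X # Xs')"
        if l: "l \<in> opers [X] []" and r: "r \<in> cmp R Xs' []" for l r
      proof (cases "Xs' = Xs")
        case True
        have "op_span {k} \<subseteq> ?V" using k V by (intro op_span_least) auto
        moreover have "r \<in> op_span {k}" using r Xs True by (simp add: R_def cmp_mk_rel)
        ultimately show ?thesis using l Z True by blast
      next
        case False
        then have "r = op_zero" using r by (auto simp: R_def cmp_mk_rel split: if_splits)
        then have "tensor1 X l r = op_zero" by (auto simp: op_tensor_def op_zero_def fun_eq_iff)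
        then show ?thesis using op_subspace_zero[OF sem_subspace[OF wf]] by simp
      qed
      then show ?thesis unfolding Z(1,4) cmp_top_times[OF R Z(2,3)]
        by (intro op_span_least sem_subspace[OF wf]) blast
    qed
    moreover have "src (rel_times (rel_top [sort_of v] []) R) = sort_of v # ?Qs"
      "tgt (rel_times (rel_top [sort_of v] []) R) = []"
      by (simp_all add: rel_times_def rel_top_def relsD(1,2)[OF R])
    ultimately have "R \<in> ?\<R>" using R relsD(1,2)[OF i] by (simp add: rel_le_def)
    moreover have "k \<in> cmp R Xs []"
      using Xs op_span_superset[of "{k}"] by (simp add: R_def cmp_mk_rel)
    ultimately show "k \<in> sem ctx (All v \<phi>) Xs"
      unfolding sem_eq by (intro subsetD[OF op_span_superset]) blast
  qed
  ultimately show ?thesis by (rule subset_antisym)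
qed

section \<open>Atomic formulas\<close>

lemma length_reorder [simp]: "length (reorder ctx vs xs) = length vs"
  by (simp add: reorder_def)

lemma reorder_append: "reorder ctx (vs @ ws) xs = reorder ctx vs xs @ reorder ctx ws xs"
  by (simp add: reorder_def)

lemma reorder_nth:
  assumes "distinct ctx" "length xs = length ctx" "i < length ctx" "j < length vs" "vs ! j = ctx ! i"
  shows "reorder ctx vs xs ! j = xs ! i"
  using assms by (simp add: reorder_def map_of_zip_nth)

lemma set_nthE:
  assumes "set vs \<subseteq> set ctx" "j < length vs"
  obtains i where "i < length ctx" "vs ! j = ctx ! i"
proof -
  have "vs ! j \<in> set ctx" using assms nth_mem by blast
  then show thesis using that unfolding in_set_conv_nth by force
qed

lemma reorder_vecs:
  assumes "distinct ctx" "set vs \<subseteq> set ctx" "length Xs = length ctx" "xs \<in> listset (map g Xs)"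
  shows "reorder ctx vs xs \<in> listset (map g (reorder ctx vs Xs))"
proof -
  have len: "length xs = length ctx" using length_listset[OF assms(4)] assms(3) by simp
  have "reorder ctx vs xs ! j \<in> g (reorder ctx vs Xs ! j)" if j: "j < length vs" for j
  proof -
    obtain i where i: "i < length ctx" "vs ! j = ctx ! i" using set_nthE[OF assms(2) j] .
    have "\<forall>i<length xs. xs ! i \<in> map g Xs ! i"
      using assms(4) unfolding listset_iff list_all2_conv_all_nth by blast
    from this[rule_format, of i] have "xs ! i \<in> g (Xs ! i)" using assms(3) len i by simp
    then show ?thesis
      using reorder_nth[OF assms(1) len i(1) j i(2)] reorder_nth[OF assms(1,3) i(1) j i(2)] by simp
  qed
  then show ?thesis by (simp add: listset_iff list_all2_conv_all_nth)
qed

lemma reorder_inverse: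
  assumes "distinct ctx" "distinct ws" "set ws = set ctx" "length xs = length ctx"
  shows "reorder ws ctx (reorder ctx ws xs) = xs"
proof (rule nth_equalityI)
  fix i assume "i < length (reorder ws ctx (reorder ctx ws xs))"
  then have i: "i < length ctx" by simp
  obtain j where j: "j < length ws" "ctx ! i = ws ! j" using set_nthE[of ctx ws i] i assms(3) by auto
  have "reorder ws ctx (reorder ctx ws xs) ! i = reorder ctx ws xs ! j"
    by (rule reorder_nth) (use assms i j in auto)
  also have "\<dots> = xs ! i" by (rule reorder_nth) (use assms i j in auto)
  finally show "reorder ws ctx (reorder ctx ws xs) ! i = xs ! i" .
qed (simp add: assms(4))

lemma reorder_update:
  assumes "distinct ctx" "distinct ws" "set ws \<subseteq> set ctx" "length xs = length ctx"
    and "i < length ctx" "j < length ws" "ws ! j = ctx ! i"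
  shows "reorder ctx ws (xs[i := u]) = (reorder ctx ws xs)[j := u]"
proof (rule nth_equalityI)
  fix j' assume "j' < length (reorder ctx ws (xs[i := u]))"
  then have j': "j' < length ws" by simp
  obtain i' where i': "i' < length ctx" "ws ! j' = ctx ! i'" using set_nthE[OF assms(3) j'] .
  have "reorder ctx ws (xs[i := u]) ! j' = xs[i := u] ! i'"
    by (rule reorder_nth) (use assms i' j' in auto)
  moreover have "reorder ctx ws xs ! j' = xs ! i'"
    by (rule reorder_nth) (use assms i' j' in auto)
  moreover have "j = j' \<longleftrightarrow> i = i'"
    using nth_eq_iff_index_eq[OF assms(1) assms(5) i'(1)] nth_eq_iff_index_eq[OF assms(2) assms(6) j']
      assms(7) i'(2) by auto
  ultimately show "reorder ctx ws (xs[i := u]) ! j' = (reorder ctx ws xs)[j := u] ! j'"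
    using assms i' j' by (auto simp: nth_list_update)
qed simp

lemma mlin_reorder:
  assumes "distinct ctx" "distinct ws" "set ws = set ctx" "length Xs = length ctx"
    and t: "mlin (reorder ctx ws Xs) t"
  shows "mlin Xs (\<lambda>xs. t (reorder ctx ws xs))"
  unfolding mlin_iff_slots
proof (intro ballI allI impI)
  fix xs i u v c
  assume xs: "xs \<in> vecs Xs" and i: "i < length Xs" and u: "u \<in> carrier (Xs ! i)" and v: "v \<in> carrier (Xs ! i)"
  have len: "length xs = length ctx" using length_listset[OF xs] assms(4) by simp
  obtain j where j: "j < length ws" "ctx ! i = ws ! j" using set_nthE[of ctx ws i] i assms(3,4) by auto
  have Xj: "reorder ctx ws Xs ! j = Xs ! i"
    by (rule reorder_nth) (use assms i j in auto)
  have up: "reorder ctx ws (xs[i := w]) = (reorder ctx ws xs)[j := w]" for w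
    by (rule reorder_update) (use assms i j len in auto)
  have "reorder ctx ws xs \<in> vecs (reorder ctx ws Xs)"
    by (rule reorder_vecs) (use assms xs in auto)
  with t u v j Xj show "t (reorder ctx ws (xs[i := u \<oplus>\<^bsub>Xs ! i\<^esub> v])) =
      t (reorder ctx ws (xs[i := u])) + t (reorder ctx ws (xs[i := v])) \<and>
      t (reorder ctx ws (xs[i := c \<odot>\<^bsub>Xs ! i\<^esub> u])) = c * t (reorder ctx ws (xs[i := u]))"
    unfolding up mlin_iff_slots by (metis length_reorder)
qed

lemma mlin_append_left: "mlin (Us @ Rs) f \<Longrightarrow> rs \<in> vecs Rs \<Longrightarrow> mlin Us (\<lambda>us. f (us @ rs))"
proof (induction Us arbitrary: f)
  case (Cons U Us)
  have "us @ rs \<in> vecs (Us @ Rs)" if "us \<in> vecs Us" for us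
    using that Cons.prems(2) by (simp add: listset_iff list_all2_appendI)
  then show ?case using Cons by auto
qed simp

lemma mlin_append_right: "mlin (Us @ Rs) f \<Longrightarrow> us \<in> vecs Us \<Longrightarrow> mlin Rs (\<lambda>rs. f (us @ rs))"
proof (induction Us arbitrary: f us)
  case (Cons U Us)
  then obtain x xs where "us = x # xs" "x \<in> carrier U" "xs \<in> vecs Us" by (auto elim: listset_ConsE)
  then show ?case using Cons.IH[of "\<lambda>zs. f (x # zs)" xs] Cons.prems(1) by simp
qed simp

lemma append_in_vecs: "us \<in> vecs Us \<Longrightarrow> rs \<in> vecs Rs \<Longrightarrow> us @ rs \<in> vecs (Us @ Rs)"
  by (simp add: listset_iff list_all2_appendI)

lemma in_vecs_appendE:
  assumes "zs \<in> vecs (Us @ Rs)"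
  obtains us rs where "zs = us @ rs" "us \<in> vecs Us" "rs \<in> vecs Rs"
  using assms by (auto simp: listset_iff list_all2_append2)

text \<open>
  A form belongs to \<open>V \<otimes> \<top>\<close> as soon as all its slices belong to \<open>V\<close>, because it is the sum of
  its slices at basis vectors, each tensored with the matching coordinate form.
\<close>

lemma span_tensor_top_iff_slices:
  fixes Us Rs :: "'v hilb list"
  assumes tU: "\<forall>X\<in>set Us. tame X" and tR: "\<forall>X\<in>set Rs. tame X"
    and V: "op_subspace V" "V \<subseteq> opers Us []"
  shows "op_span {op_tensor Us [] r s | r s. r \<in> V \<and> s \<in> opers Rs []} =
    {t \<in> opers (Us @ Rs) []. \<forall>rs\<in>vecs Rs. form Us (\<lambda>us. t [] (us @ rs)) \<in> V}"
    (is "op_span ?G = ?S")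
proof
  have form_lin: "form Us (\<lambda>us. op_zero [] (h us)) = op_zero"
    "form Us (\<lambda>us. f us + g us) = (\<lambda>ys xs. form Us f ys xs + form Us g ys xs)"
    "form Us (\<lambda>us. c * f us) = (\<lambda>ys xs. c * form Us f ys xs)" for f g c h
    by (auto simp: form_def op_zero_def fun_eq_iff)
  have S: "op_subspace ?S"
    unfolding op_subspace_def
    by (auto simp: form_lin
        intro!: op_subspace_zero op_subspace_add op_subspace_smult V(1) op_subspace_opers)
  have "?G \<subseteq> ?S"
  proof
    fix t assume "t \<in> ?G"
    then obtain r s where t: "t = op_tensor Us [] r s" "r \<in> V" "s \<in> opers Rs []" by blast
    have r: "r \<in> opers Us []" using t V by blast
    have "form Us (\<lambda>us. t [] (us @ rs)) \<in> V" if "rs \<in> vecs Rs" for rs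
    proof -
      have "form Us (\<lambda>us. t [] (us @ rs)) = (\<lambda>ys xs. s [] rs * r ys xs)"
        using r by (auto simp: form_def t op_tensor_def fun_eq_iff forms_iff dest!: length_listset)
      then show ?thesis using op_subspace_smult[OF V(1) t(2)] by simp
    qed
    then show "t \<in> ?S" using op_tensor_opers[OF tU r t(3)] t(1) by simp
  qed
  then show "op_span ?G \<subseteq> ?S" using S by (rule op_span_least)
  show "?S \<subseteq> op_span ?G"
  proof
    fix t assume t: "t \<in> ?S"
    let ?B = "listset (map onb Rs)"
    define g where "g es = op_tensor Us [] (form Us (\<lambda>us. t [] (us @ es))) (form Rs (op_id Rs es))" for es
    have g: "g es \<in> ?G" if "es \<in> ?B" for es
      using t listset_onb_vecs[OF tR that] form_in_opers[OF tR mlin_op_id[OF tR]] unfolding g_def by blast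
    have sum: "(\<lambda>ys xs. \<Sum>es\<in>?B. g es ys xs) \<in> op_span ?G"
      by (rule op_subspace_sum) (use g in \<open>auto intro: subsetD[OF op_span_superset]\<close>)
    have "op_span ?G \<subseteq> opers (Us @ Rs) []"
      by (rule op_span_least) (use V op_tensor_opers[OF tU] in auto)
    then have gC: "(\<lambda>ys xs. \<Sum>es\<in>?B. g es ys xs) \<in> opers (Us @ Rs) []" using sum by blast
    have tC: "t \<in> opers (Us @ Rs) []" using t by blast
    have "t = (\<lambda>ys xs. \<Sum>es\<in>?B. g es ys xs)"
    proof (rule forms_eqI[OF tC gC])
      fix zs assume "zs \<in> vecs (Us @ Rs)"
      then obtain us rs where z: "zs = us @ rs" "us \<in> vecs Us" "rs \<in> vecs Rs"
        by (rule in_vecs_appendE)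
      have "mlin Rs (\<lambda>rs. t [] (us @ rs))"
        using tC z(2) by (intro mlin_append_right) (simp_all add: forms_iff)
      from mlin_expand[OF tR this z(3)]
      show "t [] zs = (\<Sum>es\<in>?B. g es [] zs)"
        using z length_listset[OF z(2)] by (simp add: g_def op_tensor_def mult.commute)
    qed
    then show "t \<in> op_span ?G" using sum by simp
  qed
qed

text \<open>The update, at the variables \<open>vs\<close>, of the assignment \<open>xs\<close> to the variables \<open>ctx\<close>.\<close>

definition replace :: "'i list \<Rightarrow> 'i list \<Rightarrow> 'x list \<Rightarrow> 'x list \<Rightarrow> 'x list" where
  "replace ctx vs us xs = map (\<lambda>v. the ((map_of (zip ctx xs) ++ map_of (zip vs us)) v)) ctx"

lemma replace_eq_reorder:
  assumes "distinct ctx" "set vs \<subseteq> set ctx" "length xs = length ctx" "length us = length vs"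
    and rest: "rest = filter (\<lambda>v. v \<notin> set vs) ctx"
  shows "reorder (vs @ rest) ctx (us @ reorder ctx rest xs) = replace ctx vs us xs"
  unfolding replace_def reorder_def[of "vs @ rest"]
proof (rule map_cong[OF refl])
  fix v assume v: "v \<in> set ctx"
  have *: "map_of (zip (vs @ rest) (us @ reorder ctx rest xs)) =
      map_of (zip rest (reorder ctx rest xs)) ++ map_of (zip vs us)"
    using assms(4) by (simp add: map_of_append)
  show "the (map_of (zip (vs @ rest) (us @ reorder ctx rest xs)) v) =
      the ((map_of (zip ctx xs) ++ map_of (zip vs us)) v)"
  proof (cases "v \<in> set vs")
    case True
    then have "map_of (zip vs us) v \<noteq> None" using assms(4) by (simp add: map_of_zip_is_None)
    then show ?thesis unfolding * by (auto simp: map_add_def)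
  next
    case False
    then have "map_of (zip vs us) v = None" "v \<in> set rest"
      using assms(4) v by (simp_all add: map_of_zip_is_None rest)
    then show ?thesis unfolding * by (simp add: map_add_def reorder_def map_of_zip_map)
  qed
qed

text \<open>
  An atomic formula is a condition on the slices of a form in the variables \<open>vs\<close>, the others being
  held fixed. In terms of assignments the permutation of tensor factors disappears: the forms \<open>k\<close> and \<open>t\<close>
  below differ only by the order in which they read their arguments.
\<close>

lemma cmp_interp_atm:
  fixes ctx :: "'v var list"
  assumes R: "R \<in> rels (map sort_of vs)" and ctx: "distinct ctx" "distinct vs" "set vs \<subseteq> set ctx"
    and tame: "tame_ctx ctx" and Xs: "Xs \<in> atoms_of ctx"
  shows "cmp (interp_atm ctx R vs) Xs [] = {k \<in> opers Xs []. \<forall>xs\<in>vecs Xs.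
    form (reorder ctx vs Xs) (\<lambda>us. k [] (replace ctx vs us xs)) \<in> cmp R (reorder ctx vs Xs) []}"
    (is "_ = ?S")
proof -
  define rest where "rest = filter (\<lambda>v. v \<notin> set vs) ctx"
  define ws where "ws = vs @ rest"
  define Us Rs Zs where "Us = reorder ctx vs Xs" and "Rs = reorder ctx rest Xs" and "Zs = reorder ctx ws Xs"
  have Zs: "Zs = Us @ Rs" by (simp add: Zs_def ws_def Us_def Rs_def reorder_append)
  have ws: "distinct ws" "set ws = set ctx" using ctx by (auto simp: ws_def rest_def)
  have len: "length Xs = length ctx" using length_listset[OF Xs] by simp
  have tX: "\<forall>X\<in>set Xs. tame X" by (rule tame_atoms[OF tame Xs])
  have re: "reorder ctx vs' Xs \<in> atoms_of vs'" if "set vs' \<subseteq> set ctx" for vs'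
  proof -
    have "reorder ctx vs' Xs \<in> listset (map sort_of (reorder ctx vs' ctx))"
      by (rule reorder_vecs) (use ctx that Xs in auto)
    moreover have "reorder ctx vs' ctx = vs'"
      unfolding reorder_def
    proof (rule map_idI)
      fix v assume "v \<in> set vs'"
      then show "the (map_of (zip ctx ctx) v) = v" using that map_of_zip_map[of ctx "\<lambda>x. x"] by auto
    qed
    ultimately show ?thesis by simp
  qed
  have Us: "Us \<in> atoms_of vs" and Rs: "Rs \<in> atoms_of rest"
    unfolding Us_def Rs_def by (rule re; use ctx in \<open>auto simp: rest_def\<close>)+
  have tame': "tame_ctx vs" "tame_ctx rest" using tame ctx by (auto simp: tame_ctx_def rest_def)
  note tU = tame_atoms[OF tame'(1) Us] and tR = tame_atoms[OF tame'(2) Rs]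
  have tZ: "\<forall>X\<in>set Zs. tame X" using tU tR Zs by auto
  let ?T = "rel_times R (rel_top (map sort_of rest) [])"
  have Us_len: "length Us = length vs" by (simp add: Us_def)
  have Zs_in: "Us @ Rs \<in> listset (map sort_of vs @ map sort_of rest)"
    using Us Rs by (simp add: listset_iff list_all2_appendI)
  have T: "cmp ?T Zs [] = {t \<in> opers (Us @ Rs) []. \<forall>rs\<in>vecs Rs. form Us (\<lambda>us. t [] (us @ rs)) \<in> cmp R Us []}"
    using span_tensor_top_iff_slices[OF tU tR relsD(3)[OF R] relsD(4)[OF R Us]] Zs_in Us_len Rs
    by (simp add: rel_times_def cmp_mk_rel relsD(1,2)[OF R] rel_top_def Zs)
  have bk: "reorder ws ctx Zs = Xs" unfolding Zs_def by (rule reorder_inverse) (use ctx ws len in auto)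
  have perm: "op_mult Zs t (op_perm ctx ws Xs) = form Xs (\<lambda>xs. t [] (reorder ctx ws xs))"
    if t: "t \<in> opers Zs []" for t
  proof (intro ext)
    fix zs xs
    show "op_mult Zs t (op_perm ctx ws Xs) zs xs = form Xs (\<lambda>xs. t [] (reorder ctx ws xs)) zs xs"
    proof (cases "zs = [] \<and> xs \<in> vecs Xs")
      case True
      have "reorder ctx ws xs \<in> vecs Zs" unfolding Zs_def
        by (rule reorder_vecs) (use ctx ws len True in auto)
      from mlin_expand[OF tZ _ this, of "t []"] t True show ?thesis
        by (simp add: op_mult_def op_perm_def Zs_def forms_iff mult.commute)
    next
      case False
      then show ?thesis using t by (auto simp: op_mult_def op_perm_def form_def forms_iff)
    qed
  qed
  have slice: "replace ctx vs us xs = reorder ws ctx (us @ reorder ctx rest xs)"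
    if "us \<in> vecs Us" "xs \<in> vecs Xs" for us xs
    unfolding ws_def
    by (rule replace_eq_reorder[symmetric])
      (use ctx length_listset[OF that(1)] length_listset[OF that(2)] len Us_len in \<open>auto simp: rest_def\<close>)
  have rest_in: "reorder ctx rest xs \<in> vecs Rs" if "xs \<in> vecs Xs" for xs
    unfolding Rs_def by (rule reorder_vecs) (use ctx len that in \<open>auto simp: rest_def\<close>)
  have back_in: "reorder ws ctx zs \<in> vecs Xs" if "zs \<in> vecs Zs" for zs
    using reorder_vecs[where ctx = ws and vs = ctx and Xs = Zs and xs = zs and g = carrier] ws that len unfolding bk by (simp add: Zs_def)
  have inv: "reorder ctx ws (reorder ws ctx zs) = zs" if "zs \<in> vecs Zs" for zs
    by (rule reorder_inverse) (use ws ctx length_listset[OF that] in \<open>auto simp: Zs_def\<close>)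
  have inv': "reorder ws ctx (reorder ctx ws xs) = xs" if "xs \<in> vecs Xs" for xs
    by (rule reorder_inverse) (use ws ctx len length_listset[OF that] in auto)
  have interp: "cmp (interp_atm ctx R vs) Xs [] = (\<lambda>k. op_mult Zs k (op_perm ctx ws Xs)) ` cmp ?T Zs []"
    using Xs by (simp add: interp_atm_def Let_def cmp_mk_rel flip: rest_def ws_def Zs_def)
  show ?thesis unfolding interp
  proof (intro subset_antisym subsetI)
    fix k assume "k \<in> (\<lambda>k. op_mult Zs k (op_perm ctx ws Xs)) ` cmp ?T Zs []"
    then obtain t where t: "t \<in> cmp ?T Zs []" "k = op_mult Zs t (op_perm ctx ws Xs)" by blast
    have tZs: "t \<in> opers Zs []" using t(1) unfolding T by (simp add: Zs)
    have k: "k = form Xs (\<lambda>xs. t [] (reorder ctx ws xs))" using t(2) perm[OF tZs] by simp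
    have kC: "k \<in> opers Xs []" unfolding k
      by (intro form_in_opers[OF tX] mlin_reorder)
        (use ctx ws len tZs in \<open>auto simp: forms_iff Zs_def\<close>)
    have "form Us (\<lambda>us. k [] (replace ctx vs us xs)) \<in> cmp R Us []" if xs: "xs \<in> vecs Xs" for xs
    proof -
      let ?rs = "reorder ctx rest xs"
      have "k [] (replace ctx vs us xs) = t [] (us @ ?rs)" if us: "us \<in> vecs Us" for us
      proof -
        have z: "us @ ?rs \<in> vecs Zs" using append_in_vecs[OF us rest_in[OF xs]] by (simp add: Zs)
        show ?thesis unfolding slice[OF us xs] k using back_in[OF z] inv[OF z] by simp
      qed
      then have "form Us (\<lambda>us. k [] (replace ctx vs us xs)) = form Us (\<lambda>us. t [] (us @ ?rs))"
        by (rule form_cong)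
      then show ?thesis using t(1) rest_in[OF xs] unfolding T by simp
    qed
    then show "k \<in> ?S" using kC by (simp add: Us_def)
  next
    fix k assume k: "k \<in> ?S"
    define t where "t = form Zs (\<lambda>zs. k [] (reorder ws ctx zs))"
    have tC: "t \<in> opers Zs []" unfolding t_def
      by (intro form_in_opers[OF tZ] mlin_reorder)
        (use ctx ws len k in \<open>auto simp: forms_iff Zs_def bk[unfolded Zs_def]\<close>)
    have "form Us (\<lambda>us. t [] (us @ rs)) \<in> cmp R Us []" if rs: "rs \<in> vecs Rs" for rs
    proof (cases "vecs Us = {}")
      case True
      then have "form Us (\<lambda>us. t [] (us @ rs)) = op_zero" by (simp add: form_def op_zero_def)
      then show ?thesis using op_subspace_zero[OF relsD(3)[OF R]] by simp
    next
      case False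
      then obtain us0 where us0: "us0 \<in> vecs Us" by blast
      define xs where "xs = reorder ws ctx (us0 @ rs)"
      have z0: "us0 @ rs \<in> vecs Zs" using append_in_vecs[OF us0 rs] by (simp add: Zs)
      have xs: "xs \<in> vecs Xs" unfolding xs_def by (rule back_in[OF z0])
      have "us0 @ rs = reorder ctx vs xs @ reorder ctx rest xs"
        using inv[OF z0] by (simp add: xs_def flip: reorder_append ws_def)
      then have rs_eq: "rs = reorder ctx rest xs" using length_listset[OF us0] Us_len by simp
      have "t [] (us @ rs) = k [] (replace ctx vs us xs)" if us: "us \<in> vecs Us" for us
        unfolding slice[OF us xs] t_def using append_in_vecs[OF us rs] by (simp add: Zs rs_eq)
      then have "form Us (\<lambda>us. t [] (us @ rs)) = form Us (\<lambda>us. k [] (replace ctx vs us xs))"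
        by (rule form_cong)
      then show ?thesis using k xs by (simp add: Us_def)
    qed
    then have "t \<in> cmp ?T Zs []" using tC unfolding T by (simp add: Zs)
    moreover have "k = op_mult Zs t (op_perm ctx ws Xs)"
    proof -
      have "t [] (reorder ctx ws xs) = k [] xs" if "xs \<in> vecs Xs" for xs
      proof -
        have "reorder ctx ws xs \<in> vecs Zs" unfolding Zs_def
          by (rule reorder_vecs) (use ctx ws len that in auto)
        then show ?thesis using inv'[OF that] by (simp add: t_def)
      qed
      then have "form Xs (\<lambda>xs. t [] (reorder ctx ws xs)) = form Xs (k [])" by (rule form_cong)
      also have "\<dots> = k" using k by (auto simp: form_def fun_eq_iff forms_iff)
      finally show ?thesis using perm[OF tC] by simp
    qed
    ultimately show "k \<in> (\<lambda>k. op_mult Zs k (op_perm ctx ws Xs)) ` cmp ?T Zs []" by blast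
  qed
qed

lemma wf_Atm:
  assumes R: "R \<in> rels (map sort_of vs)" and ctx: "distinct ctx" "distinct vs" "set vs \<subseteq> set ctx" "tame_ctx ctx"
  shows "wf_fm ctx (Atm R (map Var vs))"
proof -
  let ?f = "\<lambda>Xs Ys. (\<lambda>k. op_mult (reorder ctx (vs @ filter (\<lambda>v. v \<notin> set vs) ctx) Xs) k
      (op_perm ctx (vs @ filter (\<lambda>v. v \<notin> set vs) ctx) Xs)) `
      cmp (rel_times R (rel_top (map sort_of (filter (\<lambda>v. v \<notin> set vs) ctx)) []))
        (reorder ctx (vs @ filter (\<lambda>v. v \<notin> set vs) ctx) Xs) Ys"
  have int: "interp ctx (Atm R (map Var vs)) = interp_atm ctx R vs" by (simp add: comp_def)
  have "mk_rel (map sort_of ctx) [] ?f \<in> rels (map sort_of ctx)"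
  proof (rule rels_mk_rel)
    fix Xs assume Xs: "Xs \<in> atoms_of ctx"
    have "?f Xs [] = cmp (interp_atm ctx R vs) Xs []"
      using Xs by (simp add: interp_atm_def Let_def cmp_mk_rel)
    also have "\<dots> = {k \<in> opers Xs []. \<forall>xs\<in>vecs Xs.
      form (reorder ctx vs Xs) (\<lambda>us. k [] (replace ctx vs us xs)) \<in> cmp R (reorder ctx vs Xs) []}"
      by (rule cmp_interp_atm[OF R ctx Xs])
    finally have eq: "?f Xs [] = \<dots>" .
    have form_lin: "form Us (\<lambda>us. op_zero [] (h us)) = op_zero"
      "form Us (\<lambda>us. f us + g us) = (\<lambda>ys xs. form Us f ys xs + form Us g ys xs)"
      "form Us (\<lambda>us. c * f us) = (\<lambda>ys xs. c * form Us f ys xs)" for f g c h and Us :: "'a hilb list"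
      by (auto simp: form_def op_zero_def fun_eq_iff)
    show "op_subspace (?f Xs []) \<and> ?f Xs [] \<subseteq> opers Xs []"
      unfolding eq op_subspace_def using relsD(3)[OF R]
      by (auto simp: form_lin intro!: op_subspace_zero op_subspace_add op_subspace_smult op_subspace_opers)
  qed
  then show ?thesis unfolding wf_fm_def int interp_atm_def Let_def .
qed

lemma sem_Atm:
  assumes "R \<in> rels (map sort_of vs)" "distinct ctx" "distinct vs" "set vs \<subseteq> set ctx"
    "tame_ctx ctx" "Xs \<in> atoms_of ctx"
  shows "sem ctx (Atm R (map Var vs)) Xs = {k \<in> opers Xs []. \<forall>xs\<in>vecs Xs.
    form (reorder ctx vs Xs) (\<lambda>us. k [] (replace ctx vs us xs)) \<in> cmp R (reorder ctx vs Xs) []}"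
  using cmp_interp_atm[OF assms] by (simp add: comp_def)

section \<open>Quantification over a variable and its dual\<close>

lemma op_span_single: "op_span {k} = {(\<lambda>ys xs. c * k ys xs) | c. True}" (is "_ = ?S")
proof
  have "op_subspace ?S"
    unfolding op_subspace_def op_zero_def
  proof (intro conjI ballI allI)
    show "(\<lambda>ys xs. 0) \<in> ?S" by (auto intro: exI[of _ 0])
    fix f g c assume "f \<in> ?S" "g \<in> ?S"
    then obtain a b where "f = (\<lambda>ys xs. a * k ys xs)" "g = (\<lambda>ys xs. b * k ys xs)" by blast
    then have "(\<lambda>ys xs. f ys xs + g ys xs) = (\<lambda>ys xs. (a + b) * k ys xs)"
      by (simp add: distrib_right)
    then show "(\<lambda>ys xs. f ys xs + g ys xs) \<in> ?S" by blast
  next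
    fix f c assume "f \<in> ?S"
    then obtain a where "f = (\<lambda>ys xs. a * k ys xs)" by blast
    then have "(\<lambda>ys xs. c * f ys xs) = (\<lambda>ys xs. (c * a) * k ys xs)" by (simp add: mult.assoc)
    then show "(\<lambda>ys xs. c * f ys xs) \<in> ?S" by blast
  qed
  moreover have "k \<in> ?S" by (auto simp: fun_eq_iff intro: exI[of _ 1])
  ultimately show "op_span {k} \<subseteq> ?S" by (intro op_span_least) auto
  show "?S \<subseteq> op_span {k}"
    using op_span_superset[of "{k}"] by (auto intro: op_subspace_smult)
qed

lemma tame_linear_ip: "tame X \<Longrightarrow> e \<in> carrier X \<Longrightarrow> linear_form X (ip X e)"
  unfolding tame_def linear_form_def by (simp add: hermitian.ip_add_right hermitian.ip_smult_right)

lemma tame_linear_ip_dual: "tame X \<Longrightarrow> e \<in> carrier X \<Longrightarrow> linear_form (dual X) (\<lambda>u. ip X u e)"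
  using tame_linear_ip[of "dual X" e] by (simp add: linear_form_def)

lemma tame_zero: "tame X \<Longrightarrow> \<zero>\<^bsub>X\<^esub> \<in> carrier X"
  by (simp add: tame_def hermitian_def Module.module_def abelian_group_def abelian_monoid.zero_closed)

lemma linear_form_mult_const: "linear_form X f \<Longrightarrow> linear_form X (\<lambda>x. f x * c)"
  by (simp add: linear_form_def algebra_simps)

lemma op_eval_opers: "tame X \<Longrightarrow> op_eval X \<in> opers [X, dual X] []"
proof -
  assume X: "tame X"
  have "op_eval X = form [X, dual X] (\<lambda>xs. ip X (xs ! 1) (xs ! 0))"
    by (auto simp: op_eval_def form_def fun_eq_iff)
  moreover have "mlin [X, dual X] (\<lambda>xs. ip X (xs ! 1) (xs ! 0))"
    by (simp add: ball_listset_Cons tame_linear_ip[OF X] tame_linear_ip_dual[OF X])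
  ultimately show ?thesis using X form_in_opers[of "[X, dual X]"] by simp
qed

lemma rel_eq_rels:
  assumes "\<forall>X\<in>Q. tame X"
  shows "rel_eq Q \<in> rels [Q, qdual Q]"
  unfolding rel_eq_def
proof (rule rels_mk_rel)
  fix Xs assume "Xs \<in> listset [Q, qdual Q]"
  then obtain X X' where Xs: "Xs = [X, X']" "X \<in> Q" by (auto elim!: listset_ConsE)
  then show "op_subspace (if Xs ! 1 = dual (Xs ! 0) then op_span {op_eval (Xs ! 0)} else {op_zero}) \<and>
      (if Xs ! 1 = dual (Xs ! 0) then op_span {op_eval (Xs ! 0)} else {op_zero}) \<subseteq> opers Xs []"
    using assms op_eval_opers[of X] by (auto intro: op_span_least[THEN subsetD])
qed

abbreviation eval_tensor :: "'v hilb \<Rightarrow> 'v opr \<Rightarrow> 'v opr" where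
  "eval_tensor X k \<equiv> op_tensor [X, dual X] [] (op_eval X) k"

lemma eval_tensor_apply [simp]: "u \<in> carrier X \<Longrightarrow> u' \<in> carrier X \<Longrightarrow>
    eval_tensor X k [] (u # u' # xs) = ip X u' u * k [] xs"
  by (simp add: op_tensor_def op_eval_def)

lemma eval_tensor_opers: "tame X \<Longrightarrow> k \<in> opers Xs [] \<Longrightarrow> eval_tensor X k \<in> opers (X # dual X # Xs) []"
  using op_tensor_opers[OF _ op_eval_opers, of X k Xs] by simp

lemma reorder_self: "distinct ctx \<Longrightarrow> length xs = length ctx \<Longrightarrow> reorder ctx ctx xs = xs"
  by (rule nth_equalityI) (simp_all add: reorder_nth)

lemma replace_two:
  assumes "distinct (x # x' # ctx)" "length r = length ctx"
  shows "replace (x # x' # ctx) [x, x'] [u, u'] (a # b # r) = u # u' # r"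
proof -
  have "map (\<lambda>v. the ((map_of (zip (x # x' # ctx) (a # b # r)) ++ map_of (zip [x, x'] [u, u'])) v)) ctx =
      map (\<lambda>v. the (map_of (zip ctx r) v)) ctx"
    using assms(1) by (intro map_cong refl) (auto simp: map_add_def)
  also have "\<dots> = r" using reorder_self[of ctx r] assms by (simp add: reorder_def)
  finally show ?thesis using assms(1) by (auto simp: replace_def map_add_def)
qed

lemma ball_vecs2: "(\<forall>zs\<in>vecs (X # X' # Xs). P zs) \<longleftrightarrow>
    (\<forall>u\<in>carrier X. \<forall>u'\<in>carrier X'. \<forall>r\<in>vecs Xs. P (u # u' # r))"
  by (simp add: ball_listset_Cons)

context
  fixes x x' :: "'v var" and ctx :: "'v var list" and Q :: "'v qset"
  assumes Q: "sort_of x = Q" "sort_of x' = qdual Q"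
    and dist: "distinct (x # x' # ctx)" and tame_Q: "\<forall>X\<in>Q. tame X" and tame_c: "tame_ctx ctx"
begin

lemma tame_ctx2: "tame_ctx (x # x' # ctx)"
  using Q tame_Q tame_c by (auto simp: qdual_def)

lemma wf_eq: "wf_fm (x # x' # ctx) (Atm (rel_eq Q) [Var x, Var x'])"
  using wf_Atm[of "rel_eq Q" "[x, x']" "x # x' # ctx"] rel_eq_rels[OF tame_Q] Q dist tame_ctx2 by simp

lemma sem_eq:
  assumes X: "X \<in> Q" "X' \<in> qdual Q" "Xs \<in> atoms_of ctx"
  shows "sem (x # x' # ctx) (Atm (rel_eq Q) [Var x, Var x']) (X # X' # Xs) =
    (if X' = dual X then {k \<in> opers (X # X' # Xs) [].
        \<forall>r\<in>vecs Xs. \<exists>c. \<forall>u\<in>carrier X. \<forall>u'\<in>carrier X. k [] (u # u' # r) = c * ip X u' u}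
     else {op_zero})"
proof -
  have X'Q: "tame X" "tame X'" using X tame_Q by (auto simp: qdual_def)
  have XX: "X # X' # Xs \<in> atoms_of (x # x' # ctx)" using X Q by simp
  have tX: "\<forall>X\<in>set (X # X' # Xs). tame X" by (rule tame_atoms[OF tame_ctx2 XX])
  have re: "reorder (x # x' # ctx) [x, x'] (X # X' # Xs) = [X, X']" using dist by (auto simp: reorder_def)
  have form: "form [X, X'] (\<lambda>us. k [] (replace (x # x' # ctx) [x, x'] us (a # b # r))) =
      form [X, X'] (\<lambda>us. k [] (us ! 0 # us ! 1 # r))" if "r \<in> vecs Xs" for k a b r
  proof (rule form_cong)
    fix us assume "us \<in> vecs [X, X']"
    then obtain u u' where "us = [u, u']" by (auto elim!: listset_ConsE)
    moreover have "length r = length ctx" using length_listset[OF that] length_listset[OF X(3)] by simp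
    ultimately show "k [] (replace (x # x' # ctx) [x, x'] us (a # b # r)) = k [] (us ! 0 # us ! 1 # r)"
      using replace_two[OF dist, of r u u' a b] by simp
  qed
  have ne: "carrier X \<noteq> {}" "carrier X' \<noteq> {}" using tame_zero X'Q by auto
  have "sem (x # x' # ctx) (Atm (rel_eq Q) [Var x, Var x']) (X # X' # Xs) =
    {k \<in> opers (X # X' # Xs) []. \<forall>zs\<in>vecs (X # X' # Xs).
       form [X, X'] (\<lambda>us. k [] (replace (x # x' # ctx) [x, x'] us zs)) \<in> cmp (rel_eq Q) [X, X'] []}"
    using sem_Atm[of "rel_eq Q" "[x, x']" "x # x' # ctx" "X # X' # Xs"]
      rel_eq_rels[OF tame_Q] Q dist tame_ctx2 XX by (simp add: re del: interp.simps)
  also have "\<dots> = {k \<in> opers (X # X' # Xs) []. \<forall>r\<in>vecs Xs.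
       form [X, X'] (\<lambda>us. k [] (us ! 0 # us ! 1 # r)) \<in> cmp (rel_eq Q) [X, X'] []}"
    unfolding ball_vecs2 using ne by (simp add: form ex_in_conv cong: ball_cong conj_cong)
  also have "\<dots> = (if X' = dual X then {k \<in> opers (X # X' # Xs) [].
        \<forall>r\<in>vecs Xs. \<exists>c. \<forall>u\<in>carrier X. \<forall>u'\<in>carrier X. k [] (u # u' # r) = c * ip X u' u}
     else {op_zero})"
  proof (cases "X' = dual X")
    case True
    have star: "form [X, X'] (\<lambda>us. k [] (us ! 0 # us ! 1 # r)) \<in> cmp (rel_eq Q) [X, X'] [] \<longleftrightarrow>
        (\<exists>c. \<forall>u\<in>carrier X. \<forall>u'\<in>carrier X. k [] (u # u' # r) = c * ip X u' u)" for k r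
    proof -
      have "form [X, X'] (\<lambda>us. k [] (us ! 0 # us ! 1 # r)) \<in> cmp (rel_eq Q) [X, X'] [] \<longleftrightarrow>
          (\<exists>c. form [X, X'] (\<lambda>us. k [] (us ! 0 # us ! 1 # r)) = (\<lambda>ys xs. c * op_eval X ys xs))"
        using X True by (simp add: rel_eq_def cmp_mk_rel op_span_single)
      also have "\<dots> \<longleftrightarrow> (\<exists>c. \<forall>u\<in>carrier X. \<forall>u'\<in>carrier X. k [] (u # u' # r) = c * ip X u' u)"
      proof (rule ex_cong1)
        fix c
        have "form [X, X'] (\<lambda>us. k [] (us ! 0 # us ! 1 # r)) = (\<lambda>ys xs. c * op_eval X ys xs) \<longleftrightarrow>
           (\<forall>us\<in>vecs [X, X']. k [] (us ! 0 # us ! 1 # r) = c * ip X (us ! 1) (us ! 0))"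
          unfolding fun_eq_iff form_def op_eval_def using True by auto
        then show "form [X, X'] (\<lambda>us. k [] (us ! 0 # us ! 1 # r)) = (\<lambda>ys xs. c * op_eval X ys xs) \<longleftrightarrow>
           (\<forall>u\<in>carrier X. \<forall>u'\<in>carrier X. k [] (u # u' # r) = c * ip X u' u)"
          using True by (simp add: ball_listset_Cons)
      qed
      finally show ?thesis .
    qed
    show ?thesis by (simp only: star if_P[OF True])
  next
    case False
    have "k = op_zero" if k: "k \<in> opers (X # X' # Xs) []"
      "\<forall>r\<in>vecs Xs. form [X, X'] (\<lambda>us. k [] (us ! 0 # us ! 1 # r)) = op_zero" for k
    proof (rule forms_eqI[OF k(1)])
      fix zs assume "zs \<in> vecs (X # X' # Xs)"
      then obtain u u' r where z: "zs = u # u' # r" "u \<in> carrier X" "u' \<in> carrier X'" "r \<in> vecs Xs"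
        by (auto elim!: listset_ConsE)
      have "form [X, X'] (\<lambda>us. k [] (us ! 0 # us ! 1 # r)) [] [u, u'] = op_zero [] [u, u']"
        using k(2) z(4) by simp
      then show "k [] zs = op_zero [] zs" using z by (simp add: op_zero_def)
    qed simp
    moreover have "form [X, X'] (\<lambda>us. op_zero [] (us ! 0 # us ! 1 # r)) = op_zero" for r
      by (simp add: form_def op_zero_def)
    ultimately show ?thesis using False X by (auto simp: rel_eq_def cmp_mk_rel)
  qed
  finally show ?thesis .
qed

text \<open>
  The projection onto \<open>E \<times> \<top>\<close> maps each \<open>l \<otimes> l' \<otimes> k\<close> to a multiple of \<open>\<epsilon> \<otimes> k\<close>, and the
  Sasaki arrow \<open>E \<rightarrow> \<phi>\<close> contains exactly the forms whose projection onto \<open>E\<close> satisfies \<open>\<phi>\<close>.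
  Therefore, testing \<open>\<top> \<times> k\<close> against \<open>E \<rightarrow> \<phi>\<close> amounts to testing \<open>\<epsilon> \<otimes> k\<close> against \<open>\<phi>\<close>.
\<close>

lemma sem_AllEq:
  assumes wf: "wf_fm (x # x' # ctx) \<phi>" and Xs: "Xs \<in> atoms_of ctx"
  shows "sem ctx (AllEq x x' \<phi>) Xs = {k \<in> opers Xs []. \<forall>X\<in>Q.
    eval_tensor X k \<in> sem (x # x' # ctx) \<phi> (X # dual X # Xs)}"
proof -
  let ?E = "Atm (rel_eq Q) [Var x, Var x']"
  let ?I = "Impl ?E \<phi>"
  have tX: "\<forall>X\<in>set Xs. tame X" by (rule tame_atoms[OF tame_c Xs])
  have tc1: "tame_ctx (x' # ctx)" using tame_ctx2 by simp
  have wfI: "wf_fm (x # x' # ctx) ?I" using wf_eq wf by simp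
  have t1: "tensor1 X' l' k \<in> sem (x' # ctx) (All x ?I) (X' # Xs) \<longleftrightarrow>
      (\<forall>X\<in>Q. \<forall>l\<in>opers [X] []. tensor1 X l (tensor1 X' l' k) \<in> sem (x # x' # ctx) ?I (X # X' # Xs))"
    if "X' \<in> qdual Q" "l' \<in> opers [X'] []" "k \<in> opers Xs []" for X' l' k
  proof -
    have "tame X'" using that(1) tame_Q by (auto simp: qdual_def)
    then have "tensor1 X' l' k \<in> opers (X' # Xs) []" using tensor1_opers that by blast
    moreover have "X' # Xs \<in> atoms_of (x' # ctx)" using that(1) Xs Q by simp
    ultimately show ?thesis using sem_All[OF tame_ctx2 wfI] Q by simp
  qed
  have "sem ctx (AllEq x x' \<phi>) Xs = {k \<in> opers Xs []. \<forall>X'\<in>qdual Q. \<forall>l'\<in>opers [X'] [].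
      tensor1 X' l' k \<in> sem (x' # ctx) (All x ?I) (X' # Xs)}"
    unfolding AllEq_def Q(1) using sem_All[OF tc1 wf_All Xs, of x ?I] Q(2) by simp
  also have "\<dots> = {k \<in> opers Xs []. \<forall>X'\<in>qdual Q. \<forall>l'\<in>opers [X'] []. \<forall>X\<in>Q. \<forall>l\<in>opers [X] [].
      tensor1 X l (tensor1 X' l' k) \<in> sem (x # x' # ctx) ?I (X # X' # Xs)}"
    using t1 by blast
  also have "\<dots> = {k \<in> opers Xs []. \<forall>X\<in>Q. eval_tensor X k \<in> sem (x # x' # ctx) \<phi> (X # dual X # Xs)}"
  proof (intro Collect_cong conj_cong refl iffI ballI)
    fix k X
    assume k: "k \<in> opers Xs []" and X: "X \<in> Q"
      and H: "\<forall>X'\<in>qdual Q. \<forall>l'\<in>opers [X'] []. \<forall>X\<in>Q. \<forall>l\<in>opers [X] [].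
        tensor1 X l (tensor1 X' l' k) \<in> sem (x # x' # ctx) ?I (X # X' # Xs)"
    let ?Z = "X # dual X # Xs"
    have tame: "tame X" using X tame_Q by blast
    have dX: "dual X \<in> qdual Q" using X by (simp add: qdual_def)
    have Z: "?Z \<in> atoms_of (x # x' # ctx)" using X dX Xs Q by simp
    have tZ: "\<forall>X\<in>set ?Z. tame X" by (rule tame_atoms[OF tame_ctx2 Z])
    let ?EE = "sem (x # x' # ctx) ?E ?Z" and ?\<Phi> = "sem (x # x' # ctx) \<phi> ?Z"
    \<comment> \<open>\<open>\<epsilon>\<close> is the sum of the product forms \<open>\<langle>e| \<otimes> |e\<rangle>\<close> over an orthonormal basis\<close>
    define w where "w e = tensor1 X (form [X] (\<lambda>us. ip X e (hd us)))
        (tensor1 (dual X) (form [dual X] (\<lambda>us. ip X (hd us) e)) k)" for e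
    have f1: "form [X] (\<lambda>us. ip X e (hd us)) \<in> opers [X] []"
      "form [dual X] (\<lambda>us. ip X (hd us) e) \<in> opers [dual X] []" if "e \<in> carrier X" for e
      using tame that by (auto intro!: form_in_opers simp: tame_linear_ip tame_linear_ip_dual)
    have wI: "w e \<in> sem (x # x' # ctx) ?I ?Z" if "e \<in> onb X" for e
      unfolding w_def by (intro H[rule_format, OF dX _ X] f1 onb_carrier[OF tame that])
    have EC: "eval_tensor X k \<in> opers ?Z []" by (rule eval_tensor_opers[OF tame k])
    have sI: "(\<lambda>ys xs. \<Sum>e\<in>onb X. w e ys xs) \<in> sem (x # x' # ctx) ?I ?Z"
      by (rule op_subspace_sum[OF sem_subspace[OF wfI] wI])
    have "eval_tensor X k = (\<lambda>ys xs. \<Sum>e\<in>onb X. w e ys xs)"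
    proof (rule forms_eqI[OF EC subsetD[OF sem_opers[OF wfI Z] sI]])
      fix zs assume "zs \<in> vecs ?Z"
      then obtain u u' r where z: "zs = u # u' # r" "u \<in> carrier X" "u' \<in> carrier X" "r \<in> vecs Xs"
        by (auto elim!: listset_ConsE)
      have "(\<Sum>e\<in>onb X. w e [] zs) = (\<Sum>e\<in>onb X. ip X u' e * ip X e u) * k [] r"
        unfolding sum_distrib_right w_def using z by (intro sum.cong refl) simp
      then show "eval_tensor X k [] zs = (\<Sum>e\<in>onb X. w e [] zs)"
        using z onb_parseval[OF tame z(3,2)] by simp
    qed
    then have "eval_tensor X k \<in> perp ?Z (?EE \<inter> perp ?Z (?EE \<inter> ?\<Phi>))"
      using sI sem_Impl[OF tame_ctx2 wf_eq wf Z] by simp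
    moreover have "eval_tensor X k \<in> ?EE"
      unfolding sem_eq[OF X dX Xs] using EC by (auto simp: mult.commute intro!: exI[of _ "k [] _"])
    moreover have "?EE \<inter> perp ?Z (?EE \<inter> perp ?Z (?EE \<inter> ?\<Phi>)) = ?EE \<inter> ?\<Phi>"
      by (intro orthomodular tZ op_subspace_Int sem_subspace wf_eq wf le_infI1 sem_opers Z Int_lower1)
    ultimately have "eval_tensor X k \<in> ?EE \<inter> ?\<Phi>" by blast
    then show "eval_tensor X k \<in> ?\<Phi>" by blast
  next
    fix k X' l' X l
    assume k: "k \<in> opers Xs []" and H: "\<forall>X\<in>Q. eval_tensor X k \<in> sem (x # x' # ctx) \<phi> (X # dual X # Xs)"
      and X': "X' \<in> qdual Q" and l': "l' \<in> opers [X'] []" and X: "X \<in> Q" and l: "l \<in> opers [X] []"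
    let ?Z = "X # X' # Xs" and ?w = "tensor1 X l (tensor1 X' l' k)"
    have tame: "tame X" "tame X'" using X X' tame_Q by (auto simp: qdual_def)
    have Z: "?Z \<in> atoms_of (x # x' # ctx)" using X X' Xs Q by simp
    have wC: "?w \<in> opers ?Z []" by (intro tensor1_opers tame l l' k)
    show "?w \<in> sem (x # x' # ctx) ?I ?Z"
    proof (cases "X' = dual X")
      case False
      then have "sem (x # x' # ctx) ?I ?Z = opers ?Z []"
        by (intro sem_Impl_bot tame_ctx2 wf_eq wf Z) (simp add: sem_eq[OF X X' Xs] del: interp.simps)
      then show ?thesis using wC by simp
    next
      case True
      let ?EE = "sem (x # x' # ctx) ?E ?Z" and ?\<Phi> = "sem (x # x' # ctx) \<phi> ?Z"
      have EC: "eval_tensor X k \<in> opers ?Z []" using eval_tensor_opers[OF tame(1) k] True by simp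
      have "eval_tensor X k \<in> ?EE"
        unfolding sem_eq[OF X X' Xs] using EC True by (auto simp: mult.commute intro!: exI[of _ "k [] _"])
      then have EU: "eval_tensor X k \<in> ?EE \<inter> ?\<Phi>" using H X True by blast
      have "form_ip ?Z z ?w = 0" if z: "z \<in> ?EE \<inter> perp ?Z (?EE \<inter> ?\<Phi>)" for z
      proof -
        from z True obtain c where c: "\<And>r u u'. r \<in> vecs Xs \<Longrightarrow> u \<in> carrier X \<Longrightarrow> u' \<in> carrier X \<Longrightarrow>
            z [] (u # u' # r) = c r * ip X u' u"
          unfolding sem_eq[OF X X' Xs] by (simp add: bchoice_iff) blast
        define s where "s = (\<Sum>r\<in>listset (map onb Xs). cnj (c r) * k [] r)"
        have on: "onb X' = onb X" using True tame by simp
        note oc = onb_carrier[OF tame(1)]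
        \<comment> \<open>\<open>z\<close> is a multiple of \<open>\<epsilon>\<close> in its first two arguments, so its inner products see only the trace of \<open>w\<close>\<close>
        have expand: "form_ip ?Z z w = (\<Sum>e\<in>onb X. \<Sum>e'\<in>onb X. if e = e'
            then \<Sum>r\<in>listset (map onb Xs). cnj (c r) * w [] (e # e' # r) else 0)" for w
          unfolding form_ip_def list.map sum_listset_Cons on
          by (intro sum.cong refl)
            (auto simp: c[OF listset_onb_vecs[OF tX]] oc onb_ip[OF tame(1)])
        have "form_ip ?Z (eval_tensor X k) z = 0"
          using z EU by (auto simp: perp_def)
        moreover have "form_ip ?Z (eval_tensor X k) z = cnj (form_ip ?Z z (eval_tensor X k))"
          by (simp add: form_ip_def mult.commute)
        ultimately have "form_ip ?Z z (eval_tensor X k) = 0" by simp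
        moreover have "form_ip ?Z z (eval_tensor X k) = of_nat (card (onb X)) * s"
          unfolding expand by (simp add: oc onb_ip[OF tame(1)] s_def tame)
        ultimately have "card (onb X) = 0 \<or> s = 0" by simp
        moreover have "form_ip ?Z z ?w = (\<Sum>e\<in>onb X. l [] [e] * l' [] [e]) * s"
          unfolding expand s_def sum_distrib_right
          by (simp add: tame sum_distrib_left algebra_simps)
        ultimately show ?thesis using tame(1) by auto
      qed
      then show ?thesis using sem_Impl[OF tame_ctx2 wf_eq wf Z] wC by (simp add: perp_def)
    qed
  qed
  finally show ?thesis .
qed

lemma sem_ExEq:
  assumes wf: "wf_fm (x # x' # ctx) \<phi>" and Xs: "Xs \<in> atoms_of ctx"
  shows "sem ctx (ExEq x x' \<phi>) Xs = perp Xs {k \<in> opers Xs []. \<forall>X\<in>Q.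
    eval_tensor X k \<in> perp (X # dual X # Xs) (sem (x # x' # ctx) \<phi> (X # dual X # Xs))}"
proof -
  have "{k \<in> opers Xs []. \<forall>X\<in>Q. eval_tensor X k \<in> sem (x # x' # ctx) (Neg \<phi>) (X # dual X # Xs)} =
      {k \<in> opers Xs []. \<forall>X\<in>Q.
        eval_tensor X k \<in> perp (X # dual X # Xs) (sem (x # x' # ctx) \<phi> (X # dual X # Xs))}"
  proof (intro Collect_cong conj_cong refl ball_cong)
    fix k X assume X: "X \<in> Q"
    have "sem (x # x' # ctx) (Neg \<phi>) (X # dual X # Xs) =
        perp (X # dual X # Xs) (sem (x # x' # ctx) \<phi> (X # dual X # Xs))"
      by (rule sem_Neg[OF wf]) (use X Xs Q in \<open>simp add: qdual_def\<close>)
    then show "eval_tensor X k \<in> sem (x # x' # ctx) (Neg \<phi>) (X # dual X # Xs) \<longleftrightarrow>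
        eval_tensor X k \<in> perp (X # dual X # Xs) (sem (x # x' # ctx) \<phi> (X # dual X # Xs))"
      by (simp only:)
  qed
  then show ?thesis
    unfolding ExEq_def sem_Neg[OF wf_AllEq Xs] sem_AllEq[OF wf_Neg[OF wf] Xs] by (simp only:)
qed

end

section \<open>Bent relations, conjugates and classical relations\<close>

text \<open>The form \<open>x \<otimes> \<langle>y| \<mapsto> \<langle>y|f x\<rangle>\<close> of an operator \<open>f\<close> with values in \<open>Y\<close>.\<close>

definition bend :: "'v hilb list \<Rightarrow> 'v hilb \<Rightarrow> 'v opr \<Rightarrow> 'v opr" where
  "bend Xs Y f = form (Xs @ [dual Y]) (\<lambda>zs. f [last zs] (butlast zs))"

lemma listset_snoc_iff: "zs \<in> listset (As @ [A]) \<longleftrightarrow> (\<exists>xs x. zs = xs @ [x] \<and> xs \<in> listset As \<and> x \<in> A)"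
proof (induction As arbitrary: zs)
  case Nil
  show ?case by (cases zs) auto
next
  case (Cons B As)
  show ?case
  proof
    assume "zs \<in> listset ((B # As) @ [A])"
    then obtain y ys where "zs = y # ys" "y \<in> B" "ys \<in> listset (As @ [A])" by (auto elim: listset_ConsE)
    moreover then obtain xs x where "ys = xs @ [x]" "xs \<in> listset As" "x \<in> A" using Cons.IH by blast
    ultimately show "\<exists>xs x. zs = xs @ [x] \<and> xs \<in> listset (B # As) \<and> x \<in> A"
      by (intro exI[of _ "y # xs"] exI[of _ x]) simp
  next
    assume "\<exists>xs x. zs = xs @ [x] \<and> xs \<in> listset (B # As) \<and> x \<in> A"
    then show "zs \<in> listset ((B # As) @ [A])" using Cons.IH by (auto elim!: listset_ConsE)
  qed
qed

lemma listset_snocE: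
  assumes "zs \<in> listset (As @ [A])"
  obtains xs x where "zs = xs @ [x]" "xs \<in> listset As" "x \<in> A"
  using assms by (auto simp: listset_snoc_iff)

lemma snoc_in_listset [simp]: "xs @ [x] \<in> listset (As @ [A]) \<longleftrightarrow> xs \<in> listset As \<and> x \<in> A"
  by (simp add: listset_snoc_iff)

lemma mlin_snoc:
  assumes "\<And>z. z \<in> carrier Z \<Longrightarrow> mlin Xs (\<lambda>xs. f (xs @ [z]))"
    and "\<And>xs. xs \<in> vecs Xs \<Longrightarrow> linear_form Z (\<lambda>z. f (xs @ [z]))"
  shows "mlin (Xs @ [Z]) f"
  using assms
proof (induction Xs arbitrary: f)
  case (Cons X Xs)
  have "linear_form X (\<lambda>x. f (x # zs))" if zs: "zs \<in> vecs (Xs @ [Z])" for zs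
  proof -
    obtain xs z where "zs = xs @ [z]" "xs \<in> vecs Xs" "z \<in> carrier Z"
      using zs by (auto elim!: listset_snocE)
    then show ?thesis using Cons.prems(1)[of z] by simp
  qed
  moreover have "mlin (Xs @ [Z]) (\<lambda>zs. f (x # zs))" if "x \<in> carrier X" for x
    by (rule Cons.IH) (use Cons.prems(1) Cons.prems(2)[of "x # _"] that in simp_all)
  ultimately show ?case by simp
qed simp

lemma opers1_linear: "f \<in> opers Xs [Y] \<Longrightarrow> xs \<in> vecs Xs \<Longrightarrow> linear_form (dual Y) (\<lambda>y. f [y] xs)"
  by (simp add: opers_iff)

lemma opers1_mlin: "f \<in> opers Xs [Y] \<Longrightarrow> y \<in> carrier Y \<Longrightarrow> mlin Xs (f [y])"
  by (simp add: opers_iff)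

lemma opers1_iff:
  "f \<in> opers Xs [Y] \<longleftrightarrow> (\<forall>ys xs. \<not> (ys \<in> vecs [Y] \<and> xs \<in> vecs Xs) \<longrightarrow> f ys xs = 0) \<and>
     (\<forall>y\<in>carrier Y. mlin Xs (f [y])) \<and> (\<forall>xs\<in>vecs Xs. linear_form (dual Y) (\<lambda>y. f [y] xs))"
  by (simp add: opers_iff ball_listset_Cons)

lemma bend_opers:
  assumes "\<forall>X\<in>set Xs. tame X" "tame Y" "f \<in> opers Xs [Y]"
  shows "bend Xs Y f \<in> opers (Xs @ [dual Y]) []"
  unfolding bend_def
  by (intro form_in_opers mlin_snoc) (use assms opers1_linear[OF assms(3)] opers1_mlin[OF assms(3)] in auto)

lemma bend_apply [simp]: "xs \<in> vecs Xs \<Longrightarrow> y \<in> carrier Y \<Longrightarrow> bend Xs Y f [] (xs @ [y]) = f [y] xs"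
  by (simp add: bend_def)

lemma bend_surj:
  assumes "\<forall>X\<in>set Xs. tame X" "tame Y" "g \<in> opers (Xs @ [dual Y]) []"
  shows "g \<in> bend Xs Y ` opers Xs [Y]"
proof
  define f where "f = (\<lambda>ys xs. if ys \<in> vecs [Y] \<and> xs \<in> vecs Xs then g [] (xs @ ys) else 0)"
  have g: "mlin (Xs @ [dual Y]) (g [])" using assms(3) by (simp add: forms_iff)
  have m1: "mlin Xs (f [y])" if "y \<in> carrier Y" for y
  proof -
    have "mlin Xs (\<lambda>xs. g [] (xs @ [y]))" by (rule mlin_append_left[OF g]) (use that in simp)
    moreover have "mlin Xs (f [y]) \<longleftrightarrow> mlin Xs (\<lambda>xs. g [] (xs @ [y]))"
      by (rule mlin_cong[OF assms(1)]) (simp add: f_def that)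
    ultimately show ?thesis by simp
  qed
  have m2: "linear_form (dual Y) (\<lambda>y. f [y] xs)" if "xs \<in> vecs Xs" for xs
  proof -
    have "mlin [dual Y] (\<lambda>ys. g [] (xs @ ys))" by (rule mlin_append_right[OF g]) (use that in simp)
    moreover have "mlin [dual Y] (\<lambda>ys. f ys xs) \<longleftrightarrow> mlin [dual Y] (\<lambda>ys. g [] (xs @ ys))"
      by (rule mlin_cong) (use assms(2) that in \<open>auto simp: f_def\<close>)
    ultimately show ?thesis by simp
  qed
  show f: "f \<in> opers Xs [Y]"
    unfolding opers1_iff using m1 m2 by (auto simp: f_def)
  show "g = bend Xs Y f"
    by (rule forms_eqI[OF assms(3) bend_opers[OF assms(1,2) f]])
      (auto elim!: listset_snocE simp: f_def)
qed

lemma linear_op_mult: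
  "op_mult Ys s (\<lambda>ys xs. k ys xs + l ys xs) = (\<lambda>zs xs. op_mult Ys s k zs xs + op_mult Ys s l zs xs)"
  "op_mult Ys s (\<lambda>ys xs. c * k ys xs) = (\<lambda>zs xs. c * op_mult Ys s k zs xs)"
  "op_mult Ys s op_zero = op_zero" "op_mult Ys op_zero k = op_zero"
  by (simp_all add: op_mult_def op_zero_def fun_eq_iff algebra_simps sum.distrib sum_distrib_left)

lemma bend_linear: "bend Xs Y op_zero = op_zero"
  "bend Xs Y (\<lambda>ys xs. f ys xs + g ys xs) = (\<lambda>ys xs. bend Xs Y f ys xs + bend Xs Y g ys xs)"
  "bend Xs Y (\<lambda>ys xs. c * f ys xs) = (\<lambda>ys xs. c * bend Xs Y f ys xs)"
  by (auto simp: bend_def form_def op_zero_def fun_eq_iff)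

text \<open>
  The evaluation contracts the value of \<open>f\<close> with the identity on \<open>Y\<^sup>*\<close>, that is, it inserts the last
  argument into the target slot of \<open>f\<close>.
\<close>

lemma op_mult_eval_tensor_id:
  assumes tame: "\<forall>X\<in>set Xs. tame X" "tame Y" and f: "f \<in> opers Xs [Y]"
  shows "op_mult [Y, dual Y] (op_eval Y) (op_tensor Xs [Y] f (op_id [dual Y])) = bend Xs Y f"
proof (intro ext)
  fix zs xs
  let ?l = "op_mult [Y, dual Y] (op_eval Y) (op_tensor Xs [Y] f (op_id [dual Y]))"
  have expand: "?l zs xs = (\<Sum>y\<in>onb Y. \<Sum>y'\<in>onb Y. op_eval Y zs [y, y'] *
      (f [y] (take (length Xs) xs) * op_id [dual Y] [y'] (drop (length Xs) xs)))"
    using tame(2) by (simp add: op_mult_def sum_listset_Cons op_tensor_def)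
  show "?l zs xs = bend Xs Y f zs xs"
  proof (cases "zs = [] \<and> xs \<in> vecs (Xs @ [dual Y])")
    case True
    then obtain us v where xs: "xs = us @ [v]" "us \<in> vecs Xs" "v \<in> carrier Y"
      by (auto elim!: listset_snocE)
    have len: "length us = length Xs" using length_listset[OF xs(2)] by simp
    note oc = onb_carrier[OF tame(2)]
    have "?l zs xs = (\<Sum>y\<in>onb Y. \<Sum>y'\<in>onb Y. if y' = y then f [y] us * ip Y v y' else 0)"
      unfolding expand
      by (intro sum.cong refl)
        (use True xs len in \<open>auto simp: op_eval_def op_id_def oc onb_ip[OF tame(2)]\<close>)
    also have "\<dots> = (\<Sum>y\<in>onb Y. ip (dual Y) y v * f [y] us)"
      using tame(2) by (simp add: mult.commute)
    also have "\<dots> = f [v] us"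
      using linear_form_expand[of "dual Y" "\<lambda>y. f [y] us" v] opers1_linear[OF f xs(2)] tame(2) xs(3)
      by simp
    finally show ?thesis using True xs by simp
  next
    case False
    have "op_eval Y zs [y, y'] * (f [y] (take (length Xs) xs) * op_id [dual Y] [y'] (drop (length Xs) xs)) = 0"
      for y y'
    proof (cases "zs = []")
      case True
      then have no: "xs \<notin> vecs (Xs @ [dual Y])" using False by simp
      have "take (length Xs) xs \<notin> vecs Xs \<or> drop (length Xs) xs \<notin> vecs [dual Y]"
      proof (rule ccontr)
        assume "\<not> ?thesis"
        then show False using append_in_vecs[of "take (length Xs) xs" Xs "drop (length Xs) xs" "[dual Y]"] no
          by simp
      qed
      then show ?thesis using f by (auto simp: opers1_iff op_id_def)
    qed (simp add: op_eval_def)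
    then have "?l zs xs = 0" unfolding expand by simp
    also have "0 = bend Xs Y f zs xs" using False by (auto simp: bend_def form_def)
    finally show ?thesis .
  qed
qed

text \<open>
  Of the compositions in the definition of \<^const>\<open>hat\<close>, only the one through the atoms \<open>Y\<close> and
  \<open>dual Y\<close> survives, since both equality and identity vanish between different atoms.
\<close>

lemma cmp_hat:
  assumes B: "is_brel B" "src B = Qs" "tgt B = [Q]"
    and tame: "\<forall>X\<in>Q. tame X" "\<And>Xs. Xs \<in> listset Qs \<Longrightarrow> \<forall>X\<in>set Xs. tame X"
    and Xs: "Xs \<in> listset Qs" and Y: "Y \<in> Q"
  shows "cmp (hat B) (Xs @ [dual Y]) [] = bend Xs Y ` cmp B Xs [Y]"
proof -
  let ?W = "bend Xs Y ` cmp B Xs [Y]"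
  let ?T = "rel_times B (rel_id [qdual Q])"
  let ?G = "{op_mult Ys s r | Ys s r. Ys \<in> listset [Q, qdual Q] \<and> s \<in> cmp (rel_eq Q) Ys [] \<and>
      r \<in> cmp ?T (Xs @ [dual Y]) Ys}"
  have dY: "dual Y \<in> qdual Q" using Y by (simp add: qdual_def)
  have XsY: "Xs @ [dual Y] \<in> listset (Qs @ [qdual Q])" using Xs dY listset_snoc_iff by blast
  have hat: "cmp (hat B) (Xs @ [dual Y]) [] = op_span ?G"
    using XsY B by (simp add: hat_def Let_def rel_comp_def cmp_mk_rel rel_times_def rel_id_def rel_eq_def)
  have lenX: "length Xs = length Qs" by (rule length_listset[OF Xs])
  have bO: "cmp B Xs [Y'] \<subseteq> opers Xs [Y']" if "Y' \<in> Q" for Y'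
    using is_brelD(2)[OF B(1)] B(2,3) Xs that by simp
  have W: "op_subspace ?W"
    unfolding op_subspace_def
    by (auto simp flip: bend_linear(2,3) intro!: imageI op_subspace_add op_subspace_smult is_brelD(1)[OF B(1)])
       (metis bend_linear(1) image_eqI is_brelD(1)[OF B(1)] op_subspace_zero)
  have T: "cmp ?T (Xs @ [dual Y]) [Y1, Y2] = op_span {op_tensor Xs [Y1] f i | f i.
      f \<in> cmp B Xs [Y1] \<and> i \<in> (if Y2 = dual Y then op_span {op_id [dual Y]} else {op_zero})}"
    if "Y1 \<in> Q" "Y2 \<in> qdual Q" for Y1 Y2
    using that XsY dY B lenX by (simp add: rel_times_def rel_id_def cmp_mk_rel eq_commute[of "dual Y" Y2])
  have "?G \<subseteq> ?W"
  proof
    fix g assume "g \<in> ?G"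
    then obtain Ys s r where g: "g = op_mult Ys s r" "Ys \<in> listset [Q, qdual Q]" "s \<in> cmp (rel_eq Q) Ys []"
      "r \<in> cmp ?T (Xs @ [dual Y]) Ys" by blast
    obtain Y1 Y2 where Ys: "Ys = [Y1, Y2]" "Y1 \<in> Q" "Y2 \<in> qdual Q"
      using g(2) by (auto elim!: listset_ConsE)
    show "g \<in> ?W"
    proof (cases "Y2 = dual Y1")
      case False
      then have "s = op_zero" using g(3) Ys by (simp add: rel_eq_def cmp_mk_rel)
      then show ?thesis using op_subspace_zero[OF W] g(1) by (simp add: linear_op_mult)
    next
      case True
      obtain c where s: "s = (\<lambda>ys xs. c * op_eval Y1 ys xs)"
        using g(3) Ys True by (auto simp: rel_eq_def cmp_mk_rel op_span_single)
      have "{op_tensor Xs [Y1] f i | f i. f \<in> cmp B Xs [Y1] \<and>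
          i \<in> (if Y2 = dual Y then op_span {op_id [dual Y]} else {op_zero})} \<subseteq> {r. op_mult Ys s r \<in> ?W}"
      proof
        fix r assume "r \<in> {op_tensor Xs [Y1] f i | f i. f \<in> cmp B Xs [Y1] \<and>
          i \<in> (if Y2 = dual Y then op_span {op_id [dual Y]} else {op_zero})}"
        then obtain f i where r: "r = op_tensor Xs [Y1] f i" "f \<in> cmp B Xs [Y1]"
          "i \<in> (if Y2 = dual Y then op_span {op_id [dual Y]} else {op_zero})" by blast
        show "r \<in> {r. op_mult Ys s r \<in> ?W}"
        proof (cases "Y2 = dual Y")
          case False
          then have "r = op_zero" using r by (auto simp: op_tensor_def op_zero_def fun_eq_iff)
          then show ?thesis using op_subspace_zero[OF W] by (simp add: linear_op_mult)
        next
          case eq: True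
          then have YY: "Y1 = Y" using True by simp
          obtain d where i: "i = (\<lambda>ys xs. d * op_id [dual Y] ys xs)"
            using r(3) eq by (auto simp: op_span_single)
          have "op_mult Ys s r = (\<lambda>zs xs. c * d *
              op_mult [Y, dual Y] (op_eval Y) (op_tensor Xs [Y] f (op_id [dual Y])) zs xs)"
            unfolding Ys(1) True YY r(1) s i op_mult_def op_tensor_def
            by (simp add: fun_eq_iff sum_distrib_left algebra_simps)
          also have "\<dots> = (\<lambda>zs xs. c * d * bend Xs Y f zs xs)"
            using op_mult_eval_tensor_id[OF tame(2)[OF Xs], of Y f] tame(1) Y bO[OF Y] r(2) YY by auto
          also have "\<dots> \<in> ?W" using r(2) YY by (intro op_subspace_smult[OF W]) simp
          finally show ?thesis by simp
        qed
      qed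
      moreover have "op_subspace {r. op_mult Ys s r \<in> ?W}"
        unfolding op_subspace_def
        by (auto simp only: mem_Collect_eq linear_op_mult intro!: op_subspace_zero op_subspace_add op_subspace_smult W)
      ultimately have "cmp ?T (Xs @ [dual Y]) Ys \<subseteq> {r. op_mult Ys s r \<in> ?W}"
        unfolding Ys(1) T[OF Ys(2,3)] by (rule op_span_least)
      then show ?thesis using g(1,4) by blast
    qed
  qed
  then have "op_span ?G \<subseteq> ?W" using W by (rule op_span_least)
  moreover have "?W \<subseteq> op_span ?G"
  proof
    fix g assume "g \<in> ?W"
    then obtain f where f: "f \<in> cmp B Xs [Y]" "g = bend Xs Y f" by blast
    have "op_eval Y \<in> cmp (rel_eq Q) [Y, dual Y] []"
      using Y dY op_span_superset[of "{op_eval Y}"] by (simp add: rel_eq_def cmp_mk_rel)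
    moreover have "op_tensor Xs [Y] f (op_id [dual Y]) \<in> cmp ?T (Xs @ [dual Y]) [Y, dual Y]"
      unfolding T[OF Y dY] using f(1) op_span_superset[of "{op_id [dual Y]}"]
      by (intro subsetD[OF op_span_superset]) auto
    moreover have "g = op_mult [Y, dual Y] (op_eval Y) (op_tensor Xs [Y] f (op_id [dual Y]))"
      using op_mult_eval_tensor_id[OF tame(2)[OF Xs], of Y f] tame(1) Y bO[OF Y] f by auto
    ultimately have "g \<in> ?G" using Y dY
      by (intro CollectI exI[of _ "[Y, dual Y]"] exI[of _ "op_eval Y"] exI conjI) auto
    then show "g \<in> op_span ?G" by (rule subsetD[OF op_span_superset])
  qed
  ultimately show ?thesis unfolding hat by (rule subset_antisym)
qed

lemma hat_rels:
  assumes B: "is_brel B" "src B = Qs" "tgt B = [Q]"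
    and tame: "\<forall>X\<in>Q. tame X" "\<And>Xs. Xs \<in> listset Qs \<Longrightarrow> \<forall>X\<in>set Xs. tame X"
  shows "hat B \<in> rels (Qs @ [qdual Q])"
proof -
  obtain f where f: "hat B = mk_rel (Qs @ [qdual Q]) [] f" "\<And>Xs Ys. op_subspace (f Xs Ys)"
    using B by (auto simp: hat_def Let_def rel_comp_def rel_times_def rel_id_def rel_eq_def)
  show ?thesis unfolding f(1)
  proof (rule rels_mk_rel)
    fix Zs assume Z: "Zs \<in> listset (Qs @ [qdual Q])"
    then obtain Xs Y where Zs: "Zs = Xs @ [dual Y]" "Xs \<in> listset Qs" "Y \<in> Q"
      by (auto simp: listset_snoc_iff qdual_def)
    have "f Zs [] = bend Xs Y ` cmp B Xs [Y]"
      using cmp_hat[OF B tame Zs(2,3)] Z unfolding f(1) Zs(1) by (simp add: cmp_mk_rel)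
    also have "\<dots> \<subseteq> opers Zs []"
      using bend_opers[OF tame(2)[OF Zs(2)], of Y] tame(1) Zs is_brelD(2)[OF B(1), of Xs "[Y]"] B(2,3) by auto
    finally show "op_subspace (f Zs []) \<and> f Zs [] \<subseteq> opers Zs []" using f(2) by simp
  qed
qed

lemma mlin_cnj: "mlin Xs f \<Longrightarrow> mlin (map dual Xs) (\<lambda>xs. cnj (f xs))"
  by (induction Xs arbitrary: f) (auto simp: linear_form_def)

lemma op_conj_opers: "k \<in> opers Xs Ys \<Longrightarrow> op_conj k \<in> opers (map dual Xs) (map dual Ys)"
  unfolding opers_iff op_conj_def using mlin_cnj[of Xs] mlin_cnj[of "map dual Ys"] by auto

lemma op_conj_op_conj [simp]: "op_conj (op_conj k) = k"
  by (simp add: op_conj_def)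

lemma qdual_qdual [simp]: "qdual (qdual Q) = Q"
  by (auto simp: qdual_def image_image)

lemma listset_qdual: "Xs \<in> listset (map qdual Qs) \<longleftrightarrow> map dual Xs \<in> listset Qs"
proof (induction Qs arbitrary: Xs)
  case (Cons Q Qs)
  have "X \<in> qdual Q \<longleftrightarrow> dual X \<in> Q" for X
    unfolding qdual_def by (auto intro: image_eqI[of X dual "dual X"])
  then show ?case using Cons by (cases Xs) simp_all
qed simp

lemma map_dual_dual [simp]: "map (dual \<circ> dual) Xs = Xs"
  by (induction Xs) simp_all

lemma cmp_conj_rel:
  "Xs \<in> listset (map qdual (src R)) \<Longrightarrow> Ys \<in> listset (map qdual (tgt R)) \<Longrightarrow>
    cmp (conj_rel R) Xs Ys = op_conj ` cmp R (map dual Xs) (map dual Ys)"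
  by (simp add: conj_rel_def cmp_mk_rel)

lemma src_conj_rel [simp]: "src (conj_rel R) = map qdual (src R)"
  and tgt_conj_rel [simp]: "tgt (conj_rel R) = map qdual (tgt R)"
  by (simp_all add: conj_rel_def)

lemma op_subspace_conj:
  assumes V: "op_subspace V"
  shows "op_subspace (op_conj ` V)"
  unfolding op_subspace_def
proof (intro conjI ballI allI)
  show "op_zero \<in> op_conj ` V"
    by (rule image_eqI[OF _ op_subspace_zero[OF V]]) (simp add: op_conj_def op_zero_def)
  show "(\<lambda>ys xs. k ys xs + l ys xs) \<in> op_conj ` V" if "k \<in> op_conj ` V" "l \<in> op_conj ` V" for k l
  proof (rule image_eqI)
    show "(\<lambda>ys xs. op_conj k ys xs + op_conj l ys xs) \<in> V"
      by (rule op_subspace_add[OF V]) (use that in auto)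
  qed (simp add: op_conj_def)
  show "(\<lambda>ys xs. c * k ys xs) \<in> op_conj ` V" if "k \<in> op_conj ` V" for k c
  proof (rule image_eqI)
    show "(\<lambda>ys xs. cnj c * op_conj k ys xs) \<in> V"
      by (rule op_subspace_smult[OF V]) (use that in auto)
  qed (simp add: op_conj_def)
qed

lemma is_brel_conj_rel:
  assumes R: "is_brel R"
  shows "is_brel (conj_rel R)"
  unfolding conj_rel_def
proof (rule is_brel_mk_rel)
  fix Xs Ys assume "Xs \<in> listset (map qdual (src R))" "Ys \<in> listset (map qdual (tgt R))"
  then have "cmp R (map dual Xs) (map dual Ys) \<subseteq> opers (map dual Xs) (map dual Ys)"
    by (intro is_brelD[OF R]) (simp_all add: listset_qdual)
  then have "op_conj ` cmp R (map dual Xs) (map dual Ys) \<subseteq> opers Xs Ys"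
    using op_conj_opers[of _ "map dual Xs" "map dual Ys"] by fastforce
  then show "op_subspace (op_conj ` cmp R (map dual Xs) (map dual Ys)) \<and>
      op_conj ` cmp R (map dual Xs) (map dual Ys) \<subseteq> opers Xs Ys"
    using op_subspace_conj is_brelD(1)[OF R] by blast
qed

lemma conj_rel_rels: "R \<in> rels Qs \<Longrightarrow> conj_rel R \<in> rels (map qdual Qs)"
  using is_brel_conj_rel[of R] by (auto simp: rels_def)

lemma op_conj_image_opers: "op_conj ` opers (map dual Xs) (map dual Ys) = opers Xs Ys"
proof (intro subset_antisym subsetI)
  show "k \<in> opers Xs Ys" if "k \<in> op_conj ` opers (map dual Xs) (map dual Ys)" for k
    using that op_conj_opers[of _ "map dual Xs" "map dual Ys"] by auto
  show "k \<in> op_conj ` opers (map dual Xs) (map dual Ys)" if "k \<in> opers Xs Ys" for k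
    using op_conj_opers[OF that] by (intro image_eqI[of _ _ "op_conj k"]) simp_all
qed

lemma ord_rel_brel: "is_brel (ord_rel C A D B r)"
  unfolding ord_rel_def by (rule is_brel_mk_rel) auto

lemma src_ord_rel [simp]: "src (ord_rel C A D B r) = [C ` A]"
  and tgt_ord_rel [simp]: "tgt (ord_rel C A D B r) = [D ` B]"
  by (simp_all add: ord_rel_def)

lemma cmp_ord_rel:
  assumes "inj_on C A" "inj_on D B" "a \<in> A" "b \<in> B"
  shows "cmp (ord_rel C A D B r) [C a] [D b] = (if (a, b) \<in> r then opers [C a] [D b] else {op_zero})"
proof -
  have "(\<exists>a'\<in>A. \<exists>b'\<in>B. (a', b') \<in> r \<and> C a = C a' \<and> D b = D b') \<longleftrightarrow> (a, b) \<in> r"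
    using assms by (auto simp: inj_on_eq_iff)
  then show ?thesis using assms by (simp add: ord_rel_def cmp_mk_rel)
qed

lemma cmp_hat_ord_rel:
  assumes "inj_on C A" "inj_on D B" "a \<in> A" "b \<in> B" "\<forall>a\<in>A. tame (C a)" "\<forall>b\<in>B. tame (D b)"
  shows "cmp (hat (ord_rel C A D B r)) [C a, dual (D b)] [] =
    (if (a, b) \<in> r then opers [C a, dual (D b)] [] else {op_zero})"
proof -
  have "cmp (hat (ord_rel C A D B r)) ([C a] @ [dual (D b)]) [] =
      bend [C a] (D b) ` cmp (ord_rel C A D B r) [C a] [D b]"
    by (rule cmp_hat[OF ord_rel_brel, of C A D B r "[C ` A]" "D ` B"])
      (use assms in \<open>auto elim!: listset_ConsE\<close>)
  moreover have "bend [C a] (D b) ` opers [C a] [D b] = opers [C a, dual (D b)] []"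
    using bend_surj[of "[C a]" "D b"] bend_opers[of "[C a]" "D b"] assms by auto
  ultimately show ?thesis using cmp_ord_rel[OF assms(1-4)] by (simp add: bend_linear)
qed

lemma hat_ord_rel_rels:
  assumes "\<forall>a\<in>A. tame (C a)" "\<forall>b\<in>B. tame (D b)"
  shows "hat (ord_rel C A D B r) \<in> rels [C ` A, qdual (D ` B)]"
proof -
  have "hat (ord_rel C A D B r) \<in> rels ([C ` A] @ [qdual (D ` B)])"
    by (rule hat_rels[OF ord_rel_brel]) (use assms in \<open>auto elim!: listset_ConsE\<close>)
  then show ?thesis by simp
qed

section \<open>Projections\<close>

text \<open>
  The vector is \<open>\<Sum>\<^sub>e cnj (f e) e\<close>.
\<close>

lemma riesz:
  assumes X: "tame X" and f: "linear_form X f"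
  shows "\<exists>v\<in>carrier X. \<forall>x\<in>carrier X. f x = ip X v x"
proof -
  interpret hermitian X using X by (simp add: tame_def)
  let ?g = "\<lambda>e. cnj (f e) \<odot>\<^bsub>X\<^esub> e"
  have g: "?g \<in> onb X \<rightarrow> carrier X" using onb_carrier[OF X] by auto
  have vC: "finsum X ?g (onb X) \<in> carrier X" using g by (rule finsum_closed)
  have "f x = ip X (finsum X ?g (onb X)) x" if x: "x \<in> carrier X" for x
  proof -
    have "ip X (finsum X ?g (onb X)) x = cnj (\<Sum>e\<in>onb X. ip X x (?g e))"
      using ip_sym[OF vC x] ip_finsum_right[OF onb_finite[OF X] g x] by simp
    also have "\<dots> = (\<Sum>e\<in>onb X. ip X e x * f e)"
      unfolding cnj_sum
    proof (rule sum.cong[OF refl])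
      fix e assume "e \<in> onb X"
      then have e: "e \<in> carrier X" by (rule onb_carrier[OF X])
      show "cnj (ip X x (?g e)) = ip X e x * f e"
        using ip_smult_right[OF x e, of "cnj (f e)"] ip_sym[OF e x] by simp
    qed
    also have "\<dots> = f x" using linear_form_expand[OF X f x] by simp
    finally show ?thesis by simp
  qed
  with vC show ?thesis by blast
qed

context hermitian
begin

lemma projectionsD:
  assumes "p \<in> projections X"
  shows "x \<in> carrier X \<Longrightarrow> p x \<in> carrier X"
    and "x \<in> carrier X \<Longrightarrow> y \<in> carrier X \<Longrightarrow> p (x \<oplus>\<^bsub>X\<^esub> y) = p x \<oplus>\<^bsub>X\<^esub> p y"
    and "x \<in> carrier X \<Longrightarrow> p (c \<odot>\<^bsub>X\<^esub> x) = c \<odot>\<^bsub>X\<^esub> p x"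
    and "x \<in> carrier X \<Longrightarrow> p (p x) = p x"
    and "x \<in> carrier X \<Longrightarrow> y \<in> carrier X \<Longrightarrow> ip X x (p y) = ip X (p x) y"
    and "p \<in> extensional (carrier X)"
proof -
  have hom: "p \<in> LinearCombinations.module_hom class_ring X X" and ext: "p \<in> extensional (carrier X)"
    and idem: "\<forall>x\<in>carrier X. p (p x) = p x"
    and adj: "\<forall>x\<in>carrier X. \<forall>y\<in>carrier X. ip X x (p y) = ip X (p x) y"
    using assms unfolding projections_def by blast+
  show "x \<in> carrier X \<Longrightarrow> p x \<in> carrier X" using LinearCombinations.module_hom_closed[OF hom] by blast
  show "x \<in> carrier X \<Longrightarrow> y \<in> carrier X \<Longrightarrow> p (x \<oplus>\<^bsub>X\<^esub> y) = p x \<oplus>\<^bsub>X\<^esub> p y"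
    by (rule LinearCombinations.module_hom_add[OF hom])
  show "x \<in> carrier X \<Longrightarrow> p (c \<odot>\<^bsub>X\<^esub> x) = c \<odot>\<^bsub>X\<^esub> p x"
    by (rule LinearCombinations.module_hom_smult[OF hom]) simp_all
  show "x \<in> carrier X \<Longrightarrow> p (p x) = p x" using idem by blast
  show "x \<in> carrier X \<Longrightarrow> y \<in> carrier X \<Longrightarrow> ip X x (p y) = ip X (p x) y" using adj by blast
  show "p \<in> extensional (carrier X)" by (rule ext)
qed

lemma projection_range_subsp:
  assumes p: "p \<in> projections X"
  shows "subsp (p ` carrier X)"
  unfolding subsp_def
proof (intro conjI ballI allI)
  have "p \<zero>\<^bsub>X\<^esub> = \<zero>\<^bsub>X\<^esub>"
    using projectionsD(3)[OF p zero_closed, of 0] projectionsD(1)[OF p zero_closed] smult_l_null by simp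
  then show "\<zero>\<^bsub>X\<^esub> \<in> p ` carrier X" by (metis image_eqI zero_closed)
  show "p ` carrier X \<subseteq> carrier X" using projectionsD(1)[OF p] by blast
  show "x \<oplus>\<^bsub>X\<^esub> y \<in> p ` carrier X" if "x \<in> p ` carrier X" "y \<in> p ` carrier X" for x y
  proof -
    from that obtain u v where "x = p u" "y = p v" "u \<in> carrier X" "v \<in> carrier X" by blast
    then show ?thesis using projectionsD(2)[OF p, of u v] by (intro image_eqI[of _ _ "u \<oplus>\<^bsub>X\<^esub> v"]) simp_all
  qed
  show "c \<odot>\<^bsub>X\<^esub> x \<in> p ` carrier X" if "x \<in> p ` carrier X" for x c
  proof -
    from that obtain u where "x = p u" "u \<in> carrier X" by blast
    then show ?thesis using projectionsD(3)[OF p, of u c] by (intro image_eqI[of _ _ "c \<odot>\<^bsub>X\<^esub> u"]) simp_all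
  qed
qed

text \<open>
  Equal ranges give \<open>p q = q\<close> and \<open>q p = p\<close>; taking adjoints, \<open>p = p q\<close>.
\<close>

lemma projection_eq_if_range_eq:
  assumes p: "p \<in> projections X" and q: "q \<in> projections X" and eq: "p ` carrier X = q ` carrier X"
  shows "p = q"
proof (rule extensionalityI[OF projectionsD(6)[OF p] projectionsD(6)[OF q]])
  note P = projectionsD[OF p] and Q = projectionsD[OF q]
  fix x assume x: "x \<in> carrier X"
  have pq: "p (q y) = q y" if y: "y \<in> carrier X" for y
  proof -
    have "q y \<in> p ` carrier X" using y eq by blast
    then show ?thesis using P(4) by auto
  qed
  have qp: "q (p y) = p y" if y: "y \<in> carrier X" for y
  proof -
    have "p y \<in> q ` carrier X" using y eq by blast
    then show ?thesis using Q(4) by auto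
  qed
  show "p x = q x"
  proof (rule ip_ext)
    fix v assume v: "v \<in> carrier X"
    have "ip X v (p x) = ip X v (q (p x))" using qp[OF x] by simp
    also have "\<dots> = ip X (p (q v)) x" using P(1,5) Q(1,5) v x by simp
    also have "\<dots> = ip X v (q x)" using pq[OF v] Q(5) v x by simp
    finally show "ip X v (p x) = ip X v (q x)" .
  qed (use P(1) Q(1) x in auto)
qed

text \<open>
  The square of the norm of \<open>y = p b' x\<close> is the sum of those of all \<open>p b y\<close>, and the
  summand for \<open>b'\<close> already exhausts it.
\<close>

lemma projections_sum_one_orthogonal:
  assumes B: "finite B" and p: "\<And>b. b \<in> B \<Longrightarrow> p b \<in> projections X"
    and sum: "\<And>x. x \<in> carrier X \<Longrightarrow> finsum X (\<lambda>b. p b x) B = x"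
    and b: "b \<in> B" "b' \<in> B" "b \<noteq> b'" and x: "x \<in> carrier X"
  shows "p b (p b' x) = \<zero>\<^bsub>X\<^esub>"
proof -
  define y where "y = p b' x"
  have y: "y \<in> carrier X" unfolding y_def using projectionsD(1)[OF p] b x by simp
  have py: "p c y \<in> carrier X" if "c \<in> B" for c using projectionsD(1)[OF p] that y by simp
  have n: "ip X y (p c y) = ip X (p c y) (p c y)" if "c \<in> B" for c
    using projectionsD(4)[OF p[OF that] y] projectionsD(5)[OF p[OF that] y py[OF that]] by simp
  have nn: "0 \<le> Re (ip X z z)" if "z \<in> carrier X" for z
    using ip_pos[OF that] ip_zero_right[OF that] by (cases "z = \<zero>\<^bsub>X\<^esub>") auto
  have b'y: "p b' y = y" unfolding y_def using projectionsD(4)[OF p] b x by simp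
  have "ip X y y = (\<Sum>c\<in>B. ip X y (p c y))"
    using ip_finsum_right[OF B _ y, of "\<lambda>c. p c y"] sum[OF y] py by auto
  also have "\<dots> = (\<Sum>c\<in>B. ip X (p c y) (p c y))" by (rule sum.cong) (auto simp: n)
  also have "\<dots> = ip X y y + (\<Sum>c\<in>B - {b'}. ip X (p c y) (p c y))"
    using sum.remove[OF B b(2), of "\<lambda>c. ip X (p c y) (p c y)"] b'y by simp
  finally have "(\<Sum>c\<in>B - {b'}. Re (ip X (p c y) (p c y))) = 0" by (simp flip: Re_sum)
  then have "\<forall>c\<in>B - {b'}. Re (ip X (p c y) (p c y)) = 0"
    using B nn py by (subst (asm) sum_nonneg_eq_0_iff) auto
  then have "Re (ip X (p b y) (p b y)) = 0" using b by blast
  then have "ip X (p b y) (p b y) = 0" using ip_self_real[OF py[OF b(1)]] by simp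
  then show ?thesis using ip_self_0[OF py[OF b(1)]] by (simp add: y_def)
qed

lemma orthogonal_projection:
  assumes W: "subsp W" and bound: "\<And>E. orthonormal E \<Longrightarrow> card E \<le> N"
  obtains p where "p \<in> projections X" "p ` carrier X = W" "\<And>v x. v \<in> W \<Longrightarrow> x \<in> carrier X \<Longrightarrow> ip X v (p x) = ip X v x"
proof -
  have WC: "W \<subseteq> carrier X" using W by (simp add: subsp_def)
  have "\<forall>x\<in>carrier X. \<exists>w\<in>W. \<forall>v\<in>W. ip X v x = ip X v w"
    using orthogonal_projection_exists[OF W bound] by blast
  then obtain q where q: "\<And>x. x \<in> carrier X \<Longrightarrow> q x \<in> W"
    "\<And>x v. x \<in> carrier X \<Longrightarrow> v \<in> W \<Longrightarrow> ip X v x = ip X v (q x)" by metis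
  note uniq = subsp_eqI[OF W]
  have fix_W: "q w = w" if "w \<in> W" for w
    by (rule uniq) (use q that WC in auto)
  define p where "p = restrict q (carrier X)"
  have p: "p x = q x" if "x \<in> carrier X" for x using that by (simp add: p_def)
  have qC: "q x \<in> carrier X" if "x \<in> carrier X" for x using q(1)[OF that] WC by blast
  have vC: "v \<in> carrier X" if "v \<in> W" for v using that WC by blast
  have "p \<in> projections X"
    unfolding projections_def LinearCombinations.module_hom_def
  proof (intro CollectI conjI IntI allI impI ballI)
    show "p \<in> carrier X \<rightarrow> carrier X" using p qC by auto
    show "p \<in> extensional (carrier X)" by (simp add: p_def)
    show "p (x \<oplus>\<^bsub>X\<^esub> y) = p x \<oplus>\<^bsub>X\<^esub> p y" if "x \<in> carrier X \<and> y \<in> carrier X" for x y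
    proof -
      have x: "x \<in> carrier X" and y: "y \<in> carrier X" using that by auto
      have "q (x \<oplus>\<^bsub>X\<^esub> y) = q x \<oplus>\<^bsub>X\<^esub> q y"
      proof (rule uniq)
        show "q x \<oplus>\<^bsub>X\<^esub> q y \<in> W" using W q(1) x y by (simp add: subsp_def)
        show "ip X v (q (x \<oplus>\<^bsub>X\<^esub> y)) = ip X v (q x \<oplus>\<^bsub>X\<^esub> q y)" if v: "v \<in> W" for v
          using q(2)[OF x v] q(2)[OF y v] q(2)[OF a_closed[OF x y] v] vC[OF v] x y qC
          by (simp add: ip_add_right)
      qed (simp add: q x y)
      then show ?thesis using p x y by simp
    qed
    show "p (c \<odot>\<^bsub>X\<^esub> x) = c \<odot>\<^bsub>X\<^esub> p x" if "c \<in> carrier (class_ring :: complex ring) \<and> x \<in> carrier X" for c x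
    proof -
      have x: "x \<in> carrier X" using that by auto
      have "q (c \<odot>\<^bsub>X\<^esub> x) = c \<odot>\<^bsub>X\<^esub> q x"
      proof (rule uniq)
        show "c \<odot>\<^bsub>X\<^esub> q x \<in> W" using W q(1) x by (simp add: subsp_def)
        show "ip X v (q (c \<odot>\<^bsub>X\<^esub> x)) = ip X v (c \<odot>\<^bsub>X\<^esub> q x)" if v: "v \<in> W" for v
          using q(2)[OF x v] q(2)[OF smult_carrier[OF x] v, of c] vC[OF v] x qC
          by (simp add: ip_smult_right)
      qed (simp add: q x)
      then show ?thesis using p x by simp
    qed
    show "p (p x) = p x" if "x \<in> carrier X" for x using p that qC fix_W q(1) by simp
    show "ip X x (p y) = ip X (p x) y" if x: "x \<in> carrier X" and y: "y \<in> carrier X" for x y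
    proof -
      have "ip X (q x) y = ip X (q x) (q y)" using q(2)[OF y q(1)[OF x]] .
      also have "\<dots> = cnj (ip X (q y) (q x))" by (rule ip_sym[OF qC[OF x] qC[OF y]])
      also have "\<dots> = cnj (ip X (q y) x)" using q(2)[OF x q(1)[OF y]] by simp
      also have "\<dots> = ip X x (q y)" by (rule ip_sym[OF x qC[OF y], symmetric])
      finally show ?thesis using p x y by simp
    qed
  qed
  moreover have "p ` carrier X = W"
  proof (intro subset_antisym subsetI)
    show "w \<in> W" if "w \<in> p ` carrier X" for w using that p q(1) by auto
    show "w \<in> p ` carrier X" if "w \<in> W" for w
      using that fix_W[OF that] p[OF vC[OF that]] vC[OF that] by (intro image_eqI[of _ _ w]) auto
  qed
  moreover have "ip X v (p x) = ip X v x" if "v \<in> W" "x \<in> carrier X" for v x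
    using q(2)[OF that(2,1)] p[OF that(2)] by simp
  ultimately show thesis using that by blast
qed

end

section \<open>One-dimensional atoms\<close>

definition line :: "'v hilb \<Rightarrow> bool" where
  "line X \<longleftrightarrow> tame X \<and> (\<exists>u. onb X = {u})"

definition line_vec :: "'v hilb \<Rightarrow> 'v" where
  "line_vec X = the_elem (onb X)"

lemma line_tame [simp]: "line X \<Longrightarrow> tame X"
  by (simp add: line_def)

lemma onb_line: "line X \<Longrightarrow> onb X = {line_vec X}"
  unfolding line_def line_vec_def by (elim conjE exE) simp

lemma line_dual [simp]: "line (dual X) \<longleftrightarrow> line X"
  by (cases "tame X") (simp_all add: line_def)

lemma line_vec_dual [simp]: "line X \<Longrightarrow> line_vec (dual X) = line_vec X"
  by (simp add: line_vec_def)

lemma line_vec_carrier [simp]: "line X \<Longrightarrow> line_vec X \<in> carrier X"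
  using onb_carrier[of X "line_vec X"] onb_line[of X] by simp

lemma line_vec_ip [simp]: "line X \<Longrightarrow> ip X (line_vec X) (line_vec X) = 1"
  using onb_ip[of X "line_vec X" "line_vec X"] onb_line[of X] by simp

lemma line_parseval: "line X \<Longrightarrow> x \<in> carrier X \<Longrightarrow> y \<in> carrier X \<Longrightarrow>
    ip X x (line_vec X) * ip X (line_vec X) y = ip X x y"
  using onb_parseval[of X x y] onb_line[of X] by simp

lemma line_expand: "line X \<Longrightarrow> linear_form X f \<Longrightarrow> x \<in> carrier X \<Longrightarrow> f x = ip X (line_vec X) x * f (line_vec X)"
  using linear_form_expand[of X f x] onb_line[of X] by simp

text \<open>
  Orthonormal sets have at most one element, and the empty set is complete only in the zero space, whose
  dimension is 0.
\<close>

lemma line_atoms_line: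
  assumes "line_atoms C A" "a \<in> A"
  shows "line (C a)"
proof -
  let ?X = "C a"
  have fd: "fd_hilbert ?X" and dim: "vectorspace.dim class_ring ?X = 1"
    using assms by (auto simp: line_atoms_def)
  interpret V: vectorspace class_ring ?X using fd by (simp add: fd_hilbert_def)
  have t: "tame ?X" by (rule fd_hilbert_tame[OF fd])
  have onb: "is_onb ?X (onb ?X)" using t by (simp add: tame_def)
  have "card (onb ?X) \<le> 1"
    using fd_hilbert_orthonormal_card[OF fd hermitian.is_onb_orthonormal[OF fd_hilbert_hermitian[OF fd] onb]] dim
    by simp
  moreover have "onb ?X \<noteq> {}"
  proof
    assume "onb ?X = {}"
    then have "carrier ?X = {\<zero>\<^bsub>?X\<^esub>}" using onb tame_zero[OF t] unfolding is_onb_def by blast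
    then have "V.gen_set {}" unfolding V.span_def V.lincomb_def by force
    then have "V.dim \<le> card ({} :: 'b set)" by (intro V.gen_ge_dim) simp_all
    then show False using dim by simp
  qed
  ultimately have "card (onb ?X) = 1" using onb_finite[OF t] card_0_eq[of "onb ?X"] by linarith
  then show ?thesis using t by (auto simp: line_def card_1_singleton_iff)
qed

text \<open>The operator \<open>\<langle>v| \<otimes> \<langle>line_vec X|\<close> from \<open>H \<otimes> X\<close> to the line \<open>Y\<close> spanned by \<open>line_vec Y\<close>.\<close>

definition bra_op :: "'v hilb \<Rightarrow> 'v hilb \<Rightarrow> 'v hilb \<Rightarrow> 'v \<Rightarrow> 'v opr" where
  "bra_op H X Y v = (\<lambda>ys xs. if ys \<in> vecs [Y] \<and> xs \<in> vecs [H, X]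
     then ip H v (xs ! 0) * ip X (line_vec X) (xs ! 1) * ip Y (ys ! 0) (line_vec Y) else 0)"

lemma bra_op_apply [simp]:
  "h \<in> carrier H \<Longrightarrow> x \<in> carrier X \<Longrightarrow> y \<in> carrier Y \<Longrightarrow>
    bra_op H X Y v [y] [h, x] = ip H v h * ip X (line_vec X) x * ip Y y (line_vec Y)"
  by (simp add: bra_op_def)

lemma linear_form_const_mult: "linear_form X f \<Longrightarrow> linear_form X (\<lambda>x. c * f x)"
  by (simp add: linear_form_def algebra_simps)

lemma in_vecs1: "ys \<in> listset [A] \<longleftrightarrow> (\<exists>y\<in>A. ys = [y])"
  by (auto elim!: listset_ConsE)

lemma in_vecs2: "xs \<in> listset [A, B] \<longleftrightarrow> (\<exists>x\<in>A. \<exists>y\<in>B. xs = [x, y])"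
  by (auto elim!: listset_ConsE)

lemma opers2_iff:
  assumes "tame H" "tame X" "tame Y"
  shows "f \<in> opers [H, X] [Y] \<longleftrightarrow> (\<forall>ys xs. \<not> (ys \<in> vecs [Y] \<and> xs \<in> vecs [H, X]) \<longrightarrow> f ys xs = 0) \<and>
     (\<forall>h\<in>carrier H. \<forall>x\<in>carrier X. \<forall>y\<in>carrier Y. linear_form H (\<lambda>h. f [y] [h, x]) \<and>
        linear_form X (\<lambda>x. f [y] [h, x]) \<and> linear_form (dual Y) (\<lambda>y. f [y] [h, x]))"
  unfolding opers1_iff using assms[THEN tame_zero] by (simp add: ball_listset_Cons) blast

context
  fixes H X Y :: "'v hilb"
  assumes H: "tame H" and X: "line X" and Y: "line Y"
begin

lemma bra_op_opers:
  assumes "v \<in> carrier H"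
  shows "bra_op H X Y v \<in> opers [H, X] [Y]"
proof -
  have "linear_form H (\<lambda>h. bra_op H X Y v [y] [h, x]) \<and>
        linear_form X (\<lambda>x. bra_op H X Y v [y] [h, x]) \<and> linear_form (dual Y) (\<lambda>y. bra_op H X Y v [y] [h, x])"
    if "h \<in> carrier H" "x \<in> carrier X" "y \<in> carrier Y" for h x y
  proof -
    have "mlin [H] (\<lambda>hs. bra_op H X Y v [y] [hd hs, x]) \<longleftrightarrow>
        mlin [H] (\<lambda>hs. ip H v (hd hs) * (ip X (line_vec X) x * ip Y y (line_vec Y)))"
      by (rule mlin_cong) (use H that in \<open>auto simp: in_vecs1\<close>)
    moreover have "mlin [X] (\<lambda>xs. bra_op H X Y v [y] [h, hd xs]) \<longleftrightarrow>
        mlin [X] (\<lambda>xs. (ip H v h * ip Y y (line_vec Y)) * ip X (line_vec X) (hd xs))"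
      by (rule mlin_cong) (use X that in \<open>auto simp: in_vecs1\<close>)
    moreover have "mlin [dual Y] (\<lambda>ys. bra_op H X Y v [hd ys] [h, x]) \<longleftrightarrow>
        mlin [dual Y] (\<lambda>ys. (ip H v h * ip X (line_vec X) x) * ip Y (hd ys) (line_vec Y))"
      by (rule mlin_cong) (use Y that in \<open>auto simp: in_vecs1\<close>)
    ultimately show ?thesis
      using linear_form_mult_const[OF tame_linear_ip[OF H assms]]
        linear_form_const_mult[OF tame_linear_ip[OF line_tame[OF X] line_vec_carrier[OF X]]]
        linear_form_const_mult[OF tame_linear_ip_dual[OF line_tame[OF Y] line_vec_carrier[OF Y]]]
      by simp
  qed
  then show ?thesis
    unfolding opers2_iff[OF H line_tame[OF X] line_tame[OF Y]] by (auto simp: bra_op_def)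
qed

text \<open>
  Expand the arguments in the two lines and apply Riesz in the remaining one.
\<close>

lemma bra_op_exists:
  assumes f: "f \<in> opers [H, X] [Y]"
  shows "\<exists>v\<in>carrier H. f = bra_op H X Y v"
proof -
  note f' = f[unfolded opers2_iff[OF H line_tame[OF X] line_tame[OF Y]]]
  have "linear_form H (\<lambda>h. f [line_vec Y] [h, line_vec X])"
    using f' X Y tame_zero[OF H] by auto
  then obtain v where v: "v \<in> carrier H" "\<And>h. h \<in> carrier H \<Longrightarrow> f [line_vec Y] [h, line_vec X] = ip H v h"
    using riesz[OF H] by blast
  have "f [y] [h, x] = bra_op H X Y v [y] [h, x]"
    if hxy: "h \<in> carrier H" "x \<in> carrier X" "y \<in> carrier Y" for h x y
  proof -
    have "f [y] [h, x] = ip X (line_vec X) x * f [y] [h, line_vec X]"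
      using line_expand[OF X, of "\<lambda>x. f [y] [h, x]" x] f' hxy by blast
    also have "f [y] [h, line_vec X] = ip Y y (line_vec Y) * f [line_vec Y] [h, line_vec X]"
      using line_expand[of "dual Y" "\<lambda>y. f [y] [h, line_vec X]" y] f' hxy X Y by simp
    finally show ?thesis using v(2)[OF hxy(1)] hxy by simp
  qed
  then have "f ys xs = bra_op H X Y v ys xs" for ys xs
    using f' by (cases "ys \<in> vecs [Y] \<and> xs \<in> vecs [H, X]") (auto simp: in_vecs1 in_vecs2 bra_op_def)
  then show ?thesis using v(1) by blast
qed

lemma bra_op_inj:
  assumes "v \<in> carrier H" "w \<in> carrier H" "bra_op H X Y v = bra_op H X Y w"
  shows "v = w"
proof -
  interpret hermitian H using H by (simp add: tame_def)
  have "ip H v h = ip H w h" if "h \<in> carrier H" for h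
  proof -
    have "bra_op H X Y v [line_vec Y] [h, line_vec X] = bra_op H X Y w [line_vec Y] [h, line_vec X]"
      using assms(3) by simp
    then show ?thesis using that X Y by simp
  qed
  then have "ip H h v = ip H h w" if "h \<in> carrier H" for h
    using ip_sym[OF that assms(1)] ip_sym[OF that assms(2)] that by simp
  then show ?thesis by (rule ip_ext[OF assms(1,2)])
qed

lemma bra_op_linear:
  shows "bra_op H X Y \<zero>\<^bsub>H\<^esub> = op_zero"
    and "v \<in> carrier H \<Longrightarrow> w \<in> carrier H \<Longrightarrow>
      bra_op H X Y (v \<oplus>\<^bsub>H\<^esub> w) = (\<lambda>ys xs. bra_op H X Y v ys xs + bra_op H X Y w ys xs)"
    and "v \<in> carrier H \<Longrightarrow> bra_op H X Y (c \<odot>\<^bsub>H\<^esub> v) = (\<lambda>ys xs. cnj c * bra_op H X Y v ys xs)"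
proof -
  interpret hermitian H using H by (simp add: tame_def)
  show "bra_op H X Y \<zero>\<^bsub>H\<^esub> = op_zero"
    by (auto simp: bra_op_def op_zero_def fun_eq_iff in_vecs1 in_vecs2)
  show "bra_op H X Y (v \<oplus>\<^bsub>H\<^esub> w) = (\<lambda>ys xs. bra_op H X Y v ys xs + bra_op H X Y w ys xs)"
    if "v \<in> carrier H" "w \<in> carrier H"
    using that by (auto simp: bra_op_def fun_eq_iff in_vecs1 in_vecs2 ip_add_left algebra_simps)
  show "bra_op H X Y (c \<odot>\<^bsub>H\<^esub> v) = (\<lambda>ys xs. cnj c * bra_op H X Y v ys xs)" if "v \<in> carrier H"
    using that by (auto simp: bra_op_def fun_eq_iff in_vecs1 in_vecs2 ip_smult_left)
qed

lemma bra_op_comp: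
  assumes p: "p \<in> projections H" and v: "v \<in> carrier H"
  shows "op_mult [H, X] (bra_op H X Y v) (op_tensor [H] [H] (op_of H H p) (op_id [X])) = bra_op H X Y (p v)"
proof (intro ext)
  interpret hermitian H using H by (simp add: tame_def)
  fix ys xs
  let ?l = "op_mult [H, X] (bra_op H X Y v) (op_tensor [H] [H] (op_of H H p) (op_id [X]))"
  have e: "?l ys xs = (\<Sum>h\<in>onb H. bra_op H X Y v ys [h, line_vec X] *
      (op_of H H p [h] (take 1 xs) * op_id [X] [line_vec X] (drop 1 xs)))"
    using onb_line[OF X] by (simp add: op_mult_def sum_listset_Cons op_tensor_def)
  show "?l ys xs = bra_op H X Y (p v) ys xs"
  proof (cases "ys \<in> vecs [Y] \<and> xs \<in> vecs [H, X]")
    case True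
    then obtain y h x where yx: "ys = [y]" "y \<in> carrier Y" "xs = [h, x]" "h \<in> carrier H" "x \<in> carrier X"
      by (auto simp: in_vecs1 in_vecs2)
    have "?l ys xs = (\<Sum>e\<in>onb H. ip H v e * ip H e (p h)) * (ip X (line_vec X) x * ip Y y (line_vec Y))"
      unfolding e sum_distrib_right
      by (rule sum.cong) (use yx X in \<open>simp_all add: onb_carrier[OF H] op_of_def op_id_def\<close>)
    also have "(\<Sum>e\<in>onb H. ip H v e * ip H e (p h)) = ip H (p v) h"
      using onb_parseval[OF H v, of "p h"] projectionsD(1,5)[OF p] v yx by simp
    finally show ?thesis using yx by simp
  next
    case False
    have "bra_op H X Y v ys [h, line_vec X] * (op_of H H p [h] (take 1 xs) * op_id [X] [line_vec X] (drop 1 xs)) = 0" for h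
    proof (cases "ys \<in> vecs [Y]")
      case True
      then have "xs \<notin> vecs [H, X]" using False by simp
      then have "take 1 xs \<notin> vecs [H] \<or> drop 1 xs \<notin> vecs [X]"
        by (cases xs) (auto simp: in_vecs1 in_vecs2)
      then show ?thesis by (auto simp: op_of_def op_id_def)
    qed (simp add: bra_op_def)
    then have "?l ys xs = 0" unfolding e by simp
    then show ?thesis using False by (auto simp: bra_op_def)
  qed
qed

end

section \<open>Families of projections and functions\<close>

lemma cmp_rel_adj: "Xs \<in> listset (src F) \<Longrightarrow> Ys \<in> listset (tgt F) \<Longrightarrow> cmp (rel_adj F) Ys Xs = op_adj ` cmp F Xs Ys"
  by (simp add: rel_adj_def cmp_mk_rel)

lemma op_span_single_le: "op_subspace V \<Longrightarrow> op_span {k} \<subseteq> V \<longleftrightarrow> k \<in> V"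
  using op_span_superset[of "{k}"] op_span_least[of "{k}" V] by blast

lemma cmp_adj_comp:
  assumes "Xs \<in> listset (src F)"
  shows "cmp (rel_comp (rel_adj F) F) Xs Xs = op_span {op_mult Ys (op_adj s) r | Ys s r.
    Ys \<in> listset (tgt F) \<and> s \<in> cmp F Xs Ys \<and> r \<in> cmp F Xs Ys}"
proof -
  have "{op_mult Ys s r | Ys s r. Ys \<in> listset (tgt F) \<and> s \<in> cmp (rel_adj F) Ys Xs \<and> r \<in> cmp F Xs Ys} =
      {op_mult Ys (op_adj s) r | Ys s r. Ys \<in> listset (tgt F) \<and> s \<in> cmp F Xs Ys \<and> r \<in> cmp F Xs Ys}"
    (is "?L = ?R")
  proof (intro subset_antisym subsetI)
    fix k assume "k \<in> ?L"
    then obtain Ys s r where k: "k = op_mult Ys s r" "Ys \<in> listset (tgt F)"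
      "s \<in> cmp (rel_adj F) Ys Xs" "r \<in> cmp F Xs Ys" by blast
    obtain s' where "s = op_adj s'" "s' \<in> cmp F Xs Ys"
      using k(3) unfolding cmp_rel_adj[OF assms k(2)] by blast
    with k show "k \<in> ?R" by blast
  next
    fix k assume "k \<in> ?R"
    then obtain Ys s r where k: "k = op_mult Ys (op_adj s) r" "Ys \<in> listset (tgt F)"
      "s \<in> cmp F Xs Ys" "r \<in> cmp F Xs Ys" by blast
    have "op_adj s \<in> cmp (rel_adj F) Ys Xs" unfolding cmp_rel_adj[OF assms k(2)] using k(3) by blast
    with k show "k \<in> ?L" by blast
  qed
  then show ?thesis using assms by (simp add: rel_comp_def cmp_mk_rel rel_adj_def[of F])
qed

lemma cmp_comp_adj:
  assumes "Ys \<in> listset (tgt F)" "Zs \<in> listset (tgt F)"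
  shows "cmp (rel_comp F (rel_adj F)) Ys Zs = op_span {op_mult Xs s (op_adj r) | Xs s r.
    Xs \<in> listset (src F) \<and> s \<in> cmp F Xs Zs \<and> r \<in> cmp F Xs Ys}"
proof -
  have "{op_mult Xs s r | Xs s r. Xs \<in> listset (src F) \<and> s \<in> cmp F Xs Zs \<and> r \<in> cmp (rel_adj F) Ys Xs} =
      {op_mult Xs s (op_adj r) | Xs s r. Xs \<in> listset (src F) \<and> s \<in> cmp F Xs Zs \<and> r \<in> cmp F Xs Ys}"
    (is "?L = ?R")
  proof (intro subset_antisym subsetI)
    fix k assume "k \<in> ?L"
    then obtain Xs s r where k: "k = op_mult Xs s r" "Xs \<in> listset (src F)"
      "s \<in> cmp F Xs Zs" "r \<in> cmp (rel_adj F) Ys Xs" by blast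
    obtain r' where "r = op_adj r'" "r' \<in> cmp F Xs Ys"
      using k(4) unfolding cmp_rel_adj[OF k(2) assms(1)] by blast
    with k show "k \<in> ?R" by blast
  next
    fix k assume "k \<in> ?R"
    then obtain Xs s r where k: "k = op_mult Xs s (op_adj r)" "Xs \<in> listset (src F)"
      "s \<in> cmp F Xs Zs" "r \<in> cmp F Xs Ys" by blast
    have "op_adj r \<in> cmp (rel_adj F) Ys Xs" unfolding cmp_rel_adj[OF k(2) assms(1)] using k(4) by blast
    with k show "k \<in> ?L" by blast
  qed
  then show ?thesis using assms by (simp add: rel_comp_def cmp_mk_rel rel_adj_def[of F])
qed

lemma rel_id_le_adj_comp_iff:
  "rel_le (rel_id (src F)) (rel_comp (rel_adj F) F) \<longleftrightarrow> (\<forall>Xs\<in>listset (src F). op_id Xs \<in>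
    op_span {op_mult Ys (op_adj s) r | Ys s r. Ys \<in> listset (tgt F) \<and> s \<in> cmp F Xs Ys \<and> r \<in> cmp F Xs Ys})"
    (is "?l \<longleftrightarrow> (\<forall>Xs\<in>_. op_id Xs \<in> op_span (?G Xs))")
proof -
  have zero: "{op_zero} \<subseteq> cmp (rel_comp (rel_adj F) F) Xs Ys" for Xs Ys
    by (simp add: rel_comp_def cmp_mk_rel op_subspace_zero)
  have st: "src (rel_comp (rel_adj F) F) = src F" "tgt (rel_comp (rel_adj F) F) = src F"
    "src (rel_id (src F)) = src F" "tgt (rel_id (src F)) = src F"
    by (simp_all add: rel_comp_def rel_adj_def rel_id_def)
  have ident: "cmp (rel_id (src F)) Xs Ys = (if Xs \<in> listset (src F) \<and> Xs = Ys then op_span {op_id Xs} else {op_zero})"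
    for Xs Ys by (auto simp: rel_id_def cmp_mk_rel)
  have "?l \<longleftrightarrow> (\<forall>Xs\<in>listset (src F). op_span {op_id Xs} \<subseteq> cmp (rel_comp (rel_adj F) F) Xs Xs)"
  proof
    assume ?l
    then have le: "cmp (rel_id (src F)) Xs Xs \<subseteq> cmp (rel_comp (rel_adj F) F) Xs Xs" for Xs
      unfolding rel_le_def by blast
    show "\<forall>Xs\<in>listset (src F). op_span {op_id Xs} \<subseteq> cmp (rel_comp (rel_adj F) F) Xs Xs"
    proof
      fix Xs assume "Xs \<in> listset (src F)"
      then show "op_span {op_id Xs} \<subseteq> cmp (rel_comp (rel_adj F) F) Xs Xs"
        using le[of Xs] by (simp only: ident simp_thms if_True)
    qed
  next
    assume H: "\<forall>Xs\<in>listset (src F). op_span {op_id Xs} \<subseteq> cmp (rel_comp (rel_adj F) F) Xs Xs"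
    have "cmp (rel_id (src F)) Xs Ys \<subseteq> cmp (rel_comp (rel_adj F) F) Xs Ys" for Xs Ys
      unfolding ident using H zero[of Xs Ys] by (cases "Xs \<in> listset (src F) \<and> Xs = Ys") auto
    then show ?l unfolding rel_le_def st by blast
  qed
  also have "\<dots> \<longleftrightarrow> (\<forall>Xs\<in>listset (src F). op_id Xs \<in> op_span (?G Xs))"
    by (intro ball_cong refl) (simp only: cmp_adj_comp op_span_single_le[OF op_span_subspace])
  finally show ?thesis .
qed

lemma comp_adj_le_rel_id_iff:
  "rel_le (rel_comp F (rel_adj F)) (rel_id (tgt F)) \<longleftrightarrow>
    (\<forall>Ys\<in>listset (tgt F). \<forall>Zs\<in>listset (tgt F). \<forall>Xs\<in>listset (src F). \<forall>s\<in>cmp F Xs Zs. \<forall>r\<in>cmp F Xs Ys.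
      op_mult Xs s (op_adj r) \<in> (if Ys = Zs then op_span {op_id Ys} else {op_zero}))"
proof -
  let ?I = "\<lambda>Ys Zs. if Ys = Zs then op_span {op_id Ys} else {op_zero}"
  let ?G = "\<lambda>Ys Zs. {op_mult Xs s (op_adj r) | Xs s r. Xs \<in> listset (src F) \<and> s \<in> cmp F Xs Zs \<and> r \<in> cmp F Xs Ys}"
  let ?at = "\<lambda>Ys Zs. Ys \<in> listset (tgt F) \<and> Zs \<in> listset (tgt F)"
  have off: "cmp (rel_comp F (rel_adj F)) Ys Zs = {op_zero}" if "\<not> ?at Ys Zs" for Ys Zs
    using that by (auto simp: rel_comp_def cmp_mk_rel rel_adj_def)
  have I: "op_subspace (?I Ys Zs)" for Ys Zs by simp
  have ident: "cmp (rel_id (tgt F)) Ys Zs = (if ?at Ys Zs then ?I Ys Zs else {op_zero})" for Ys Zs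
    by (simp add: rel_id_def cmp_mk_rel)
  have st: "src (rel_comp F (rel_adj F)) = tgt F" "tgt (rel_comp F (rel_adj F)) = tgt F"
    "src (rel_id (tgt F)) = tgt F" "tgt (rel_id (tgt F)) = tgt F"
    by (simp_all add: rel_comp_def rel_adj_def rel_id_def)
  have *: "cmp (rel_comp F (rel_adj F)) Ys Zs \<subseteq> cmp (rel_id (tgt F)) Ys Zs \<longleftrightarrow>
      (?at Ys Zs \<longrightarrow> ?G Ys Zs \<subseteq> ?I Ys Zs)" for Ys Zs
  proof (cases "?at Ys Zs")
    case True
    have "op_span (?G Ys Zs) \<subseteq> ?I Ys Zs \<longleftrightarrow> ?G Ys Zs \<subseteq> ?I Ys Zs"
    proof
      show "?G Ys Zs \<subseteq> ?I Ys Zs" if "op_span (?G Ys Zs) \<subseteq> ?I Ys Zs"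
        using op_span_superset that by (rule order_trans)
    qed (rule op_span_least[OF _ I])
    then show ?thesis using True by (simp only: ident cmp_comp_adj simp_thms if_True)
  next
    case False
    show ?thesis unfolding off[OF False] ident if_not_P[OF False] using False by blast
  qed
  have "rel_le (rel_comp F (rel_adj F)) (rel_id (tgt F)) \<longleftrightarrow>
      (\<forall>Ys\<in>listset (tgt F). \<forall>Zs\<in>listset (tgt F). ?G Ys Zs \<subseteq> ?I Ys Zs)"
    unfolding rel_le_def st * by blast
  also have "\<dots> \<longleftrightarrow> (\<forall>Ys\<in>listset (tgt F). \<forall>Zs\<in>listset (tgt F). \<forall>Xs\<in>listset (src F).
      \<forall>s\<in>cmp F Xs Zs. \<forall>r\<in>cmp F Xs Ys. op_mult Xs s (op_adj r) \<in> ?I Ys Zs)"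
    by (intro ball_cong refl) blast
  finally show ?thesis .
qed

lemma bra_op_adj_comp:
  assumes H: "tame H" and X: "line X" and Y: "line Y" and v: "v \<in> carrier H" "w \<in> carrier H"
    and h: "h \<in> carrier H" "h' \<in> carrier H" "x \<in> carrier X" "x' \<in> carrier X"
  shows "op_mult [Y] (op_adj (bra_op H X Y w)) (bra_op H X Y v) [h', x'] [h, x] =
    ip H h' w * ip H v h * ip X x' x"
proof -
  interpret hermitian H using H by (simp add: tame_def)
  interpret X: hermitian X using line_tame[OF X] by (simp add: tame_def)
  have "op_mult [Y] (op_adj (bra_op H X Y w)) (bra_op H X Y v) [h', x'] [h, x] =
      cnj (ip H w h' * ip X (line_vec X) x') * (ip H v h * ip X (line_vec X) x)"
    using h X Y by (simp add: op_mult_def sum_listset_Cons onb_line op_adj_def)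
  also have "\<dots> = ip H h' w * ip H v h * (ip X x' (line_vec X) * ip X (line_vec X) x)"
    using ip_sym[OF h(2) v(2)] X.ip_sym[OF h(4) line_vec_carrier[OF X]] by simp
  finally show ?thesis using line_parseval[OF X h(4,3)] by simp
qed

lemma bra_op_comp_adj:
  assumes H: "tame H" and X: "line X" and Y: "line Y" "line Z" and v: "v \<in> carrier H" "w \<in> carrier H"
  shows "op_mult [H, X] (bra_op H X Z w) (op_adj (bra_op H X Y v)) = (\<lambda>zs ys.
    ip H w v * (if zs \<in> vecs [Z] \<and> ys \<in> vecs [Y] then ip Z (zs ! 0) (line_vec Z) * ip Y (line_vec Y) (ys ! 0) else 0))"
proof (intro ext)
  fix zs ys
  interpret hermitian H using H by (simp add: tame_def)
  interpret Y: hermitian Y using line_tame[OF Y(1)] by (simp add: tame_def)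
  show "op_mult [H, X] (bra_op H X Z w) (op_adj (bra_op H X Y v)) zs ys =
    ip H w v * (if zs \<in> vecs [Z] \<and> ys \<in> vecs [Y] then ip Z (zs ! 0) (line_vec Z) * ip Y (line_vec Y) (ys ! 0) else 0)"
  proof (cases "zs \<in> vecs [Z] \<and> ys \<in> vecs [Y]")
    case True
    then obtain z y where zy: "zs = [z]" "z \<in> carrier Z" "ys = [y]" "y \<in> carrier Y" by (auto simp: in_vecs1)
    have "op_mult [H, X] (bra_op H X Z w) (op_adj (bra_op H X Y v)) zs ys =
        (\<Sum>e\<in>onb H. ip H w e * cnj (ip H v e)) * (ip Z z (line_vec Z) * cnj (ip Y y (line_vec Y)))"
      unfolding sum_distrib_right op_mult_def list.map sum_listset_Cons onb_line[OF X]
      by (intro sum.cong refl) (use zy X in \<open>simp add: op_adj_def onb_carrier[OF H]\<close>)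
    also have "(\<Sum>e\<in>onb H. ip H w e * cnj (ip H v e)) = (\<Sum>e\<in>onb H. ip H w e * ip H e v)"
      by (intro sum.cong refl) (use ip_sym[OF onb_carrier[OF H] v(1)] in simp)
    also have "\<dots> = ip H w v" by (rule onb_parseval[OF H v(2,1)])
    also have "cnj (ip Y y (line_vec Y)) = ip Y (line_vec Y) y"
      by (rule Y.ip_sym[symmetric]) (use zy Y in simp_all)
    finally show ?thesis using zy by simp
  next
    case False
    then show ?thesis by (auto simp: op_mult_def op_adj_def bra_op_def)
  qed
qed

locale quantum_functions =
  fixes H :: "'v hilb" and C :: "'a \<Rightarrow> 'v hilb" and A :: "'a set" and D :: "'b \<Rightarrow> 'v hilb" and B :: "'b set"
  assumes fdH: "fd_hilbert H" and finB: "finite B" and C: "line_atoms C A" and D: "line_atoms D B"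
begin

sublocale H: hermitian H
  by (rule fd_hilbert_hermitian[OF fdH])

lemma tameH [simp]: "tame H"
  by (rule fd_hilbert_tame[OF fdH])

lemma lineC [simp]: "a \<in> A \<Longrightarrow> line (C a)"
  by (rule line_atoms_line[OF C])

lemma lineD [simp]: "b \<in> B \<Longrightarrow> line (D b)"
  by (rule line_atoms_line[OF D])

lemma injC: "inj_on C A" and injD: "inj_on D B"
  using C D by (auto simp: line_atoms_def)

abbreviation K :: "'a \<Rightarrow> 'b \<Rightarrow> 'v \<Rightarrow> 'v opr" where
  "K a b \<equiv> bra_op H (C a) (D b)"

abbreviation src_q :: "'v qset list" where "src_q \<equiv> [{H}, C ` A]"
abbreviation tgt_q :: "'v qset list" where "tgt_q \<equiv> [D ` B]"

lemma src_q_iff: "Xs \<in> listset src_q \<longleftrightarrow> (\<exists>a\<in>A. Xs = [H, C a])"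
  by (auto elim!: listset_ConsE)

lemma ball_src_q: "(\<forall>Xs\<in>listset src_q. P Xs) \<longleftrightarrow> (\<forall>a\<in>A. P [H, C a])"
  unfolding Ball_def src_q_iff by auto

lemma tgt_q_iff: "Ys \<in> listset tgt_q \<longleftrightarrow> (\<exists>b\<in>B. Ys = [D b])"
  by (auto elim!: listset_ConsE)

lemma ball_tgt_q: "(\<forall>Ys\<in>listset tgt_q. P Ys) \<longleftrightarrow> (\<forall>b\<in>B. P [D b])"
  unfolding Ball_def tgt_q_iff by auto

abbreviation families :: "('a \<Rightarrow> 'b \<Rightarrow> 'v \<Rightarrow> 'v) set" where
  "families \<equiv> {p \<in> proj_families H A B. sums_to_one H A B p}"

lemma family_proj: "p \<in> proj_families H A B \<Longrightarrow> a \<in> A \<Longrightarrow> b \<in> B \<Longrightarrow> p a b \<in> projections H"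
  by (auto simp: proj_families_def PiE_iff)

lemma family_carrier: "p \<in> proj_families H A B \<Longrightarrow> a \<in> A \<Longrightarrow> b \<in> B \<Longrightarrow> x \<in> carrier H \<Longrightarrow> p a b x \<in> carrier H"
  by (rule H.projectionsD(1)[OF family_proj])

text \<open>
  Composing \<open>\<langle>v|\<close> with a projection \<open>p\<close> gives \<open>\<langle>p v|\<close>, so the component is described by the range of \<open>p\<close>.
\<close>

lemma cmp_fun_of_family:
  assumes p: "p \<in> proj_families H A B" and a: "a \<in> A" and b: "b \<in> B"
  shows "cmp (fun_of_family H C A D B p) [H, C a] [D b] = K a b ` (p a b ` carrier H)"
proof -
  have "cmp (fun_of_family H C A D B p) [H, C a] [D b] =
      {op_mult [H, C a] l (op_tensor [H] [H] (op_of H H (p a b)) (op_id [C a])) | l. l \<in> opers [H, C a] [D b]}"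
    using a b injC injD by (auto simp: fun_of_family_def cmp_mk_rel inj_on_eq_iff)
  also have "\<dots> = {op_mult [H, C a] (K a b v) (op_tensor [H] [H] (op_of H H (p a b)) (op_id [C a])) | v. v \<in> carrier H}"
    using bra_op_exists[of H "C a" "D b"] bra_op_opers[of H "C a" "D b"] a b by fastforce
  also have "\<dots> = {K a b (p a b v) | v. v \<in> carrier H}"
    by (intro Collect_cong ex_cong1)
      (use bra_op_comp[OF tameH lineC[OF a] lineD[OF b] family_proj[OF p a b]] in auto)
  finally show ?thesis by blast
qed

lemma op_subspace_K_image:
  assumes "a \<in> A" "b \<in> B" "H.subsp W"
  shows "op_subspace (K a b ` W)"
  unfolding op_subspace_def
proof (intro conjI ballI allI)
  have W: "W \<subseteq> carrier H" "\<zero>\<^bsub>H\<^esub> \<in> W" using assms(3) by (auto simp: H.subsp_def)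
  note lin = bra_op_linear[of H "C a" "D b"]
  show "op_zero \<in> K a b ` W" by (rule image_eqI[OF _ W(2)]) (use lin(1) assms in simp)
  show "(\<lambda>ys xs. k ys xs + l ys xs) \<in> K a b ` W" if kl: "k \<in> K a b ` W" "l \<in> K a b ` W" for k l
  proof -
    from kl obtain v w where "k = K a b v" "l = K a b w" "v \<in> W" "w \<in> W" by blast
    moreover from this have "v \<in> carrier H" "w \<in> carrier H" using W(1) by auto
    moreover from calculation have "v \<oplus>\<^bsub>H\<^esub> w \<in> W" using assms(3) by (simp add: H.subsp_def)
    ultimately show ?thesis using lin(2)[of v w] assms W by (intro image_eqI[of _ _ "v \<oplus>\<^bsub>H\<^esub> w"]) auto
  qed
  show "(\<lambda>ys xs. c * k ys xs) \<in> K a b ` W" if k: "k \<in> K a b ` W" for k c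
  proof -
    from k obtain v where "k = K a b v" "v \<in> W" by blast
    moreover from this have "v \<in> carrier H" using W(1) by auto
    moreover from calculation have "cnj c \<odot>\<^bsub>H\<^esub> v \<in> W" using assms(3) by (simp add: H.subsp_def)
    ultimately show ?thesis using lin(3)[of v "cnj c"] assms W by (intro image_eqI[of _ _ "cnj c \<odot>\<^bsub>H\<^esub> v"]) auto
  qed
qed

lemma fun_of_family_brel:
  assumes p: "p \<in> proj_families H A B"
  shows "is_brel (fun_of_family H C A D B p)" "src (fun_of_family H C A D B p) = src_q"
    "tgt (fun_of_family H C A D B p) = tgt_q"
proof -
  show st: "src (fun_of_family H C A D B p) = src_q" "tgt (fun_of_family H C A D B p) = tgt_q"
    by (simp_all add: fun_of_family_def)
  have "op_subspace (cmp (fun_of_family H C A D B p) Xs Ys) \<and> cmp (fun_of_family H C A D B p) Xs Ys \<subseteq> opers Xs Ys"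
    if XY: "Xs \<in> listset src_q" "Ys \<in> listset tgt_q" for Xs Ys
  proof -
    obtain a b where ab: "a \<in> A" "b \<in> B" "Xs = [H, C a]" "Ys = [D b]"
      using XY unfolding src_q_iff tgt_q_iff by blast
    have "K a b ` (p a b ` carrier H) \<subseteq> opers Xs Ys"
      using bra_op_opers[of H "C a" "D b"] ab family_carrier[OF p ab(1,2)] by auto
    then show ?thesis
      using op_subspace_K_image[OF ab(1,2) H.projection_range_subsp[OF family_proj[OF p ab(1,2)]]]
        cmp_fun_of_family[OF p ab(1,2)] ab by simp
  qed
  moreover have "cmp (fun_of_family H C A D B p) Xs Ys = {op_zero}"
    if "\<not> (Xs \<in> listset src_q \<and> Ys \<in> listset tgt_q)" for Xs Ys
    using that by (auto simp: fun_of_family_def cmp_mk_rel)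
  ultimately show "is_brel (fun_of_family H C A D B p)" unfolding is_brel_def st by auto
qed

text \<open>
  The components of a relation from \<open>X \<times> A\<close> to \<open>B\<close> are given by subspaces \<open>W a b\<close> of \<open>H\<close>.
  The second condition says that for each \<open>a\<close> the subspaces are pairwise orthogonal. Given
  this, the first one says that their sum is \<open>H\<close>.
\<close>

lemma is_function_iff:
  assumes F: "is_brel F" "src F = src_q" "tgt F = tgt_q"
    and W: "\<And>a b. a \<in> A \<Longrightarrow> b \<in> B \<Longrightarrow> cmp F [H, C a] [D b] = K a b ` W a b"
    and WC: "\<And>a b. a \<in> A \<Longrightarrow> b \<in> B \<Longrightarrow> W a b \<subseteq> carrier H"
  shows "is_function F \<longleftrightarrow>
    (\<forall>a\<in>A. op_id [H, C a] \<in> op_span {op_mult [D b] (op_adj (K a b w)) (K a b v) | b w v.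
       b \<in> B \<and> w \<in> W a b \<and> v \<in> W a b}) \<and>
    (\<forall>a\<in>A. \<forall>b\<in>B. \<forall>b'\<in>B. b \<noteq> b' \<longrightarrow> (\<forall>v\<in>W a b. \<forall>w\<in>W a b'. ip H w v = 0))"
proof -
  have total: "rel_le (rel_id (src F)) (rel_comp (rel_adj F) F) \<longleftrightarrow>
      (\<forall>a\<in>A. op_id [H, C a] \<in> op_span {op_mult [D b] (op_adj (K a b w)) (K a b v) | b w v.
         b \<in> B \<and> w \<in> W a b \<and> v \<in> W a b})"
  proof -
    have star: "{op_mult Ys (op_adj s) r | Ys s r. Ys \<in> listset tgt_q \<and> s \<in> cmp F [H, C a] Ys \<and> r \<in> cmp F [H, C a] Ys} =
      {op_mult [D b] (op_adj (K a b w)) (K a b v) | b w v. b \<in> B \<and> w \<in> W a b \<and> v \<in> W a b}" (is "?L = ?R")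
      if a: "a \<in> A" for a
    proof (intro subset_antisym subsetI)
      fix k assume "k \<in> ?L"
      then obtain b s r where k: "b \<in> B" "k = op_mult [D b] (op_adj s) r" "s \<in> cmp F [H, C a] [D b]" "r \<in> cmp F [H, C a] [D b]"
        unfolding tgt_q_iff by blast
      then show "k \<in> ?R" unfolding W[OF a k(1)] by blast
    next
      fix k assume "k \<in> ?R"
      then obtain b w v where k: "k = op_mult [D b] (op_adj (K a b w)) (K a b v)" "b \<in> B" "w \<in> W a b" "v \<in> W a b"
        by blast
      then have "K a b w \<in> cmp F [H, C a] [D b]" "K a b v \<in> cmp F [H, C a] [D b]" unfolding W[OF a k(2)] by auto
      then show "k \<in> ?L" using k(1,2) unfolding tgt_q_iff by blast
    qed
    show ?thesis
      unfolding F(2,3) rel_id_le_adj_comp_iff[of F, unfolded F(2,3)] ball_src_q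
      by (simp only: star cong: ball_cong)
  qed
  have single: "op_mult [H, C a] (K a b' w) (op_adj (K a b v)) \<in>
        (if [D b] = [D b'] then op_span {op_id [D b]} else {op_zero}) \<longleftrightarrow> b = b' \<or> ip H w v = 0"
    if a: "a \<in> A" and b: "b \<in> B" "b' \<in> B" and v: "v \<in> W a b" and w: "w \<in> W a b'" for a b b' v w
  proof -
    have vw: "v \<in> carrier H" "w \<in> carrier H" using v w WC a b by auto
    note mult = bra_op_comp_adj[OF tameH lineC[OF a] lineD[OF b(1)] lineD[OF b(2)] vw]
    show ?thesis
    proof (cases "b = b'")
      case True
      have "op_mult [H, C a] (K a b' w) (op_adj (K a b v)) = (\<lambda>zs ys. ip H w v * op_id [D b] zs ys)"
        unfolding mult using line_parseval[OF lineD[OF b(1)]] True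
        by (auto simp: op_id_def fun_eq_iff in_vecs1)
      then show ?thesis using True by (auto simp: op_span_single)
    next
      case False
      then have ne: "D b \<noteq> D b'" using injD b by (auto simp: inj_on_eq_iff)
      have "op_mult [H, C a] (K a b' w) (op_adj (K a b v)) = op_zero \<longleftrightarrow> ip H w v = 0"
      proof
        assume "op_mult [H, C a] (K a b' w) (op_adj (K a b v)) = op_zero"
        then have "op_mult [H, C a] (K a b' w) (op_adj (K a b v)) [line_vec (D b')] [line_vec (D b)] = 0"
          by (simp add: op_zero_def)
        then show "ip H w v = 0" unfolding mult using b by simp
      next
        assume "ip H w v = 0"
        then show "op_mult [H, C a] (K a b' w) (op_adj (K a b v)) = op_zero"
          unfolding mult by (simp add: op_zero_def)
      qed
      then show ?thesis using False ne by simp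
    qed
  qed
  have deterministic: "rel_le (rel_comp F (rel_adj F)) (rel_id (tgt F)) \<longleftrightarrow>
      (\<forall>a\<in>A. \<forall>b\<in>B. \<forall>b'\<in>B. b \<noteq> b' \<longrightarrow> (\<forall>v\<in>W a b. \<forall>w\<in>W a b'. ip H w v = 0))"
  proof -
    have "rel_le (rel_comp F (rel_adj F)) (rel_id (tgt F)) \<longleftrightarrow>
      (\<forall>b\<in>B. \<forall>b'\<in>B. \<forall>a\<in>A. \<forall>s\<in>cmp F [H, C a] [D b']. \<forall>r\<in>cmp F [H, C a] [D b].
        op_mult [H, C a] s (op_adj r) \<in> (if [D b] = [D b'] then op_span {op_id [D b]} else {op_zero}))"
      unfolding F(2,3) comp_adj_le_rel_id_iff[of F, unfolded F(2,3)] ball_src_q ball_tgt_q ..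
    also have "\<dots> \<longleftrightarrow> (\<forall>b\<in>B. \<forall>b'\<in>B. \<forall>a\<in>A. \<forall>w\<in>W a b'. \<forall>v\<in>W a b.
        op_mult [H, C a] (K a b' w) (op_adj (K a b v)) \<in> (if [D b] = [D b'] then op_span {op_id [D b]} else {op_zero}))"
      by (intro ball_cong refl) (simp add: W)
    also have "\<dots> \<longleftrightarrow> (\<forall>b\<in>B. \<forall>b'\<in>B. \<forall>a\<in>A. \<forall>w\<in>W a b'. \<forall>v\<in>W a b. b = b' \<or> ip H w v = 0)"
      by (intro ball_cong refl single)
    also have "\<dots> \<longleftrightarrow> (\<forall>a\<in>A. \<forall>b\<in>B. \<forall>b'\<in>B. b \<noteq> b' \<longrightarrow> (\<forall>v\<in>W a b. \<forall>w\<in>W a b'. ip H w v = 0))"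
      by blast
    finally show ?thesis .
  qed
  show ?thesis by (simp only: is_function_def F(1) total deterministic simp_thms)
qed

lemma family_orthogonal:
  assumes p: "p \<in> families" and "a \<in> A" "b \<in> B" "b' \<in> B" "b \<noteq> b'" "x \<in> carrier H"
  shows "p a b (p a b' x) = \<zero>\<^bsub>H\<^esub>"
proof (rule H.projections_sum_one_orthogonal[where p = "p a" and B = B])
  show "p a c \<in> projections H" if "c \<in> B" for c using family_proj p assms(2) that by blast
  show "finsum H (\<lambda>b. p a b x) B = x" if "x \<in> carrier H" for x
    using p assms(2) that by (auto simp: sums_to_one_def)
qed (use assms finB in auto)

text \<open>
  The identity of \<open>H\<close> is the sum of the operators \<open>p a b |e\<rangle>\<langle>e| p a b\<close> over \<open>b\<close> and an orthonormal
  basis, each of which is a product of two operators in a component of \<open>F\<close>.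
\<close>

lemma fun_of_family_function:
  assumes p: "p \<in> families"
  shows "fun_of_family H C A D B p \<in> qfunctions src_q tgt_q"
proof -
  have pf: "p \<in> proj_families H A B" using p by blast
  note P = H.projectionsD[OF family_proj[OF pf]]
  let ?F = "fun_of_family H C A D B p"
  have "is_function ?F"
  proof (rule is_function_iff[where W = "\<lambda>a b. p a b ` carrier H", THEN iffD2, OF fun_of_family_brel[OF pf]],
      goal_cases)
    case (1 a b)
    then show ?case by (rule cmp_fun_of_family[OF pf])
  next
    case (2 a b)
    then show ?case using P(1) by blast
  next
    case 3
    show ?case
    proof (intro conjI ballI impI)
    fix a assume a: "a \<in> A"
    let ?G = "{op_mult [D b] (op_adj (K a b w)) (K a b v) | b w v. b \<in> B \<and> w \<in> p a b ` carrier H \<and> v \<in> p a b ` carrier H}"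
    let ?g = "\<lambda>b e. op_mult [D b] (op_adj (K a b (p a b e))) (K a b (p a b e))"
    have "(\<lambda>ys xs. \<Sum>b\<in>B. \<Sum>e\<in>onb H. ?g b e ys xs) \<in> op_span ?G"
      by (intro op_subspace_sum op_span_subspace subsetD[OF op_span_superset])
        (use onb_carrier[OF tameH] in blast)
    moreover have "op_id [H, C a] = (\<lambda>ys xs. \<Sum>b\<in>B. \<Sum>e\<in>onb H. ?g b e ys xs)"
    proof (intro ext)
      fix ys xs
      show "op_id [H, C a] ys xs = (\<Sum>b\<in>B. \<Sum>e\<in>onb H. ?g b e ys xs)"
      proof (cases "ys \<in> vecs [H, C a] \<and> xs \<in> vecs [H, C a]")
        case True
        then obtain h' x' h x where yx: "ys = [h', x']" "xs = [h, x]" "h' \<in> carrier H" "h \<in> carrier H"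
          "x' \<in> carrier (C a)" "x \<in> carrier (C a)" by (auto simp: in_vecs2)
        have "(\<Sum>e\<in>onb H. ?g b e ys xs) = ip H h' (p a b h) * ip (C a) x' x" if b: "b \<in> B" for b
        proof -
          note P = P[OF a b]
          have "(\<Sum>e\<in>onb H. ?g b e ys xs) = (\<Sum>e\<in>onb H. ip H (p a b h') e * ip H e (p a b h)) * ip (C a) x' x"
            unfolding sum_distrib_right
          proof (rule sum.cong[OF refl])
            fix e assume "e \<in> onb H"
            then have e: "e \<in> carrier H" by (rule onb_carrier[OF tameH])
            show "?g b e ys xs = ip H (p a b h') e * ip H e (p a b h) * ip (C a) x' x"
              unfolding yx(1,2) bra_op_adj_comp[OF tameH lineC[OF a] lineD[OF b] P(1)[OF e] P(1)[OF e] yx(4,3,6,5)]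
              using P(5) yx e by simp
          qed
          also have "(\<Sum>e\<in>onb H. ip H (p a b h') e * ip H e (p a b h)) = ip H h' (p a b h)"
            using onb_parseval[OF tameH P(1)[OF yx(3)] P(1)[OF yx(4)]] P(4,5) P(1) yx by simp
          finally show ?thesis .
        qed
        then have "(\<Sum>b\<in>B. \<Sum>e\<in>onb H. ?g b e ys xs) = (\<Sum>b\<in>B. ip H h' (p a b h)) * ip (C a) x' x"
          by (simp add: sum_distrib_right)
        also have "(\<Sum>b\<in>B. ip H h' (p a b h)) = ip H h' (finsum H (\<lambda>b. p a b h) B)"
          by (rule H.ip_finsum_right[symmetric]) (use finB P(1)[OF a] yx in auto)
        also have "finsum H (\<lambda>b. p a b h) B = h" using p a yx by (auto simp: sums_to_one_def)
        finally show ?thesis using yx by (simp add: op_id_def)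
      next
        case False
        then show ?thesis by (auto simp: op_id_def op_mult_def op_adj_def bra_op_def)
      qed
    qed
    ultimately show "op_id [H, C a] \<in> op_span ?G" by simp
  next
    fix a b b' v w
    assume a: "a \<in> A" and b: "b \<in> B" "b' \<in> B" "b \<noteq> b'" and "v \<in> p a b ` carrier H" "w \<in> p a b' ` carrier H"
    then obtain x y where xy: "v = p a b x" "w = p a b' y" "x \<in> carrier H" "y \<in> carrier H" by blast
    have "ip H w v = ip H y (p a b' (p a b x))"
      unfolding xy using P(5)[OF a b(2) xy(4) P(1)[OF a b(1) xy(3)]] by simp
    also have "p a b' (p a b x) = \<zero>\<^bsub>H\<^esub>" by (rule family_orthogonal[OF p a b(2,1)]) (use b xy in auto)
    finally show "ip H w v = 0" using xy by simp
    qed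
  qed
  then show ?thesis using fun_of_family_brel[OF pf] by (simp add: qfunctions_def)
qed

lemma fun_of_family_inj: "inj_on (fun_of_family H C A D B) families"
proof (rule inj_onI)
  fix p q assume p: "p \<in> families" and q: "q \<in> families"
    and eq: "fun_of_family H C A D B p = fun_of_family H C A D B q"
  have pf: "p \<in> proj_families H A B" "q \<in> proj_families H A B" using p q by auto
  have "p a b = q a b" if ab: "a \<in> A" "b \<in> B" for a b
  proof (rule H.projection_eq_if_range_eq)
    have "K a b ` (p a b ` carrier H) = K a b ` (q a b ` carrier H)"
      using cmp_fun_of_family[OF pf(1) ab] cmp_fun_of_family[OF pf(2) ab] eq by simp
    moreover have "inj_on (K a b) (carrier H)"
      by (rule inj_onI, rule bra_op_inj[of H "C a" "D b"]) (use ab in auto)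
    moreover have "p a b ` carrier H \<subseteq> carrier H" "q a b ` carrier H \<subseteq> carrier H"
      using family_carrier[OF pf(1) ab] family_carrier[OF pf(2) ab] by blast+
    ultimately show "p a b ` carrier H = q a b ` carrier H"
      by (simp only: inj_on_image_eq_iff)
  qed (intro family_proj pf ab)+
  then have "p a = q a" if "a \<in> A" for a
    using pf that by (intro PiE_ext[of "p a" B "\<lambda>_. projections H" "q a"]) (auto simp: proj_families_def)
  then show "p = q"
    using pf by (intro PiE_ext[of p A "\<lambda>_. B \<rightarrow>\<^sub>E projections H" q]) (auto simp: proj_families_def)
qed

text \<open>
  Take for \<open>p a b\<close> the orthogonal projection onto \<open>W a b\<close>. Then \<open>z = x - \<Sum>\<^sub>b p a b x\<close> is
  orthogonal to all \<open>W a b\<close>, so \<open>\<langle>z|k z\<rangle>\<close> vanishes for every product \<open>k\<close> of operators in the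
  components of \<open>F\<close>; as these products span the identity, \<open>\<langle>z|z\<rangle> = 0\<close>.
\<close>

lemma fun_of_family_surj:
  assumes "F \<in> qfunctions src_q tgt_q"
  shows "F \<in> fun_of_family H C A D B ` families"
proof -
  have F: "is_brel F" "src F = src_q" "tgt F = tgt_q" and isf: "is_function F"
    using assms by (auto simp: qfunctions_def is_function_def)
  define W where "W a b = {v \<in> carrier H. K a b v \<in> cmp F [H, C a] [D b]}" for a b
  have W: "cmp F [H, C a] [D b] = K a b ` W a b" if "a \<in> A" "b \<in> B" for a b
  proof -
    have "cmp F [H, C a] [D b] \<subseteq> opers [H, C a] [D b]"
      by (rule is_brelD(2)[OF F(1)]) (use F that in auto)
    then show ?thesis using bra_op_exists[of H "C a" "D b"] that by (fastforce simp: W_def)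
  qed
  have WC: "W a b \<subseteq> carrier H" for a b by (auto simp: W_def)
  have sub: "H.subsp (W a b)" if "a \<in> A" "b \<in> B" for a b
  proof -
    note lin = bra_op_linear[of H "C a" "D b"] and V = is_brelD(1)[OF F(1), of "[H, C a]" "[D b]"]
    show ?thesis
      unfolding H.subsp_def W_def using that lin op_subspace_zero[OF V] op_subspace_add[OF V] op_subspace_smult[OF V]
      by simp
  qed
  have ex: "\<exists>p. p \<in> projections H \<and> p ` carrier H = W a b \<and>
      (\<forall>v\<in>W a b. \<forall>x\<in>carrier H. ip H v (p x) = ip H v x)" if "a \<in> A" "b \<in> B" for a b
    using H.orthogonal_projection[OF sub[OF that] fd_hilbert_orthonormal_card[OF fdH]] by metis
  define q where "q a b = (SOME p. p \<in> projections H \<and> p ` carrier H = W a b \<and>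
      (\<forall>v\<in>W a b. \<forall>x\<in>carrier H. ip H v (p x) = ip H v x))" for a b
  have q': "q a b \<in> projections H \<and> q a b ` carrier H = W a b \<and>
      (\<forall>v\<in>W a b. \<forall>x\<in>carrier H. ip H v (q a b x) = ip H v x)" if "a \<in> A" "b \<in> B" for a b
    unfolding q_def by (rule someI_ex[OF ex[OF that]])
  have q: "q a b \<in> projections H" "q a b ` carrier H = W a b"
    "v \<in> W a b \<Longrightarrow> x \<in> carrier H \<Longrightarrow> ip H v (q a b x) = ip H v x" if "a \<in> A" "b \<in> B" for a b v x
    using q'[OF that] by blast+
  define p where "p = (\<lambda>a\<in>A. \<lambda>b\<in>B. q a b)"
  have p: "p a b = q a b" if "a \<in> A" "b \<in> B" for a b using that by (simp add: p_def)
  have pf: "p \<in> proj_families H A B" unfolding proj_families_def p_def using q(1) by auto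
  have isf': "\<forall>a\<in>A. op_id [H, C a] \<in> op_span {op_mult [D b] (op_adj (K a b w)) (K a b v) | b w v.
       b \<in> B \<and> w \<in> W a b \<and> v \<in> W a b}"
    "\<forall>a\<in>A. \<forall>b\<in>B. \<forall>b'\<in>B. b \<noteq> b' \<longrightarrow> (\<forall>v\<in>W a b. \<forall>w\<in>W a b'. ip H w v = 0)"
    by (rule is_function_iff[of F W, THEN iffD1, THEN conjunct1], fact F(1), fact F(2), fact F(3), fact W, rule WC, fact isf)
      (rule is_function_iff[of F W, THEN iffD1, THEN conjunct2], fact F(1), fact F(2), fact F(3), fact W, rule WC, fact isf)
  have "finsum H (\<lambda>b. p a b x) B = x" if a: "a \<in> A" and x: "x \<in> carrier H" for a x
  proof -
    let ?s = "finsum H (\<lambda>b. p a b x) B"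
    have pC: "(\<lambda>b. p a b x) \<in> B \<rightarrow> carrier H" using family_carrier[OF pf a] x by blast
    have sC: "?s \<in> carrier H" using pC by (rule H.finsum_closed)
    have vs: "ip H v ?s = ip H v x" if b: "b \<in> B" and v: "v \<in> W a b" for b v
    proof -
      have vC: "v \<in> carrier H" using v WC by blast
      have "ip H v ?s = (\<Sum>b'\<in>B. ip H v (p a b' x))" by (rule H.ip_finsum_right[OF finB pC vC])
      also have "\<dots> = (\<Sum>b'\<in>B. if b' = b then ip H v x else 0)"
      proof (rule sum.cong[OF refl])
        fix b' assume b': "b' \<in> B"
        have "ip H v (p a b' x) = 0" if "b' \<noteq> b"
        proof -
          have "p a b' x \<in> W a b'" using q(2)[OF a b'] p[OF a b'] x by auto
          then show ?thesis using isf'(2) a b b' v that by blast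
        qed
        then show "ip H v (p a b' x) = (if b' = b then ip H v x else 0)"
          using q(3)[OF a b v x] p[OF a b] by auto
      qed
      also have "\<dots> = ip H v x" using finB b by simp
      finally show ?thesis .
    qed
    define z where "z = x \<oplus>\<^bsub>H\<^esub> (- 1) \<odot>\<^bsub>H\<^esub> ?s"
    have zC: "z \<in> carrier H" unfolding z_def using x sC by simp
    have ipz: "ip H v z = ip H v x - ip H v ?s" if "v \<in> carrier H" for v
      unfolding z_def using that x sC by (simp add: H.ip_add_right H.ip_smult_right)
    let ?u = "line_vec (C a)"
    let ?V = "{k :: 'v opr. k [z, ?u] [z, ?u] = 0}"
    have uC: "?u \<in> carrier (C a)" using a by simp
    have "op_span {op_mult [D b] (op_adj (K a b w)) (K a b v) | b w v. b \<in> B \<and> w \<in> W a b \<and> v \<in> W a b} \<subseteq> ?V"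
    proof (rule op_span_least)
      show "op_subspace ?V" by (simp add: op_subspace_def op_zero_def)
      have "op_mult [D b] (op_adj (K a b w)) (K a b v) [z, ?u] [z, ?u] = 0"
        if b: "b \<in> B" and w: "w \<in> W a b" and v: "v \<in> W a b" for b w v
      proof -
        have C: "w \<in> carrier H" "v \<in> carrier H" using w v WC by auto
        show ?thesis
          unfolding bra_op_adj_comp[OF tameH lineC[OF a] lineD[OF b] C(2,1) zC zC uC uC]
          using ipz[OF C(2)] vs[OF b v] by simp
      qed
      then show "{op_mult [D b] (op_adj (K a b w)) (K a b v) | b w v. b \<in> B \<and> w \<in> W a b \<and> v \<in> W a b} \<subseteq> ?V" by blast
    qed
    then have "op_id [H, C a] [z, ?u] [z, ?u] = 0" using isf'(1) a by blast
    then have "ip H z z = 0" using zC a by (simp add: op_id_def)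
    then have "z = \<zero>\<^bsub>H\<^esub>" by (rule H.ip_self_0[OF zC])
    then have "ip H v ?s = ip H v x" if "v \<in> carrier H" for v using ipz[OF that] that by simp
    then show ?thesis by (rule H.ip_ext[OF sC x])
  qed
  then have fam: "p \<in> families" using pf by (simp add: sums_to_one_def)
  have "F = fun_of_family H C A D B p"
  proof (rule is_brel_eqI[OF F(1) fun_of_family_brel(1)[OF pf]])
    fix Xs Ys assume "Xs \<in> listset (src F)" "Ys \<in> listset (tgt F)"
    then obtain a b where ab: "a \<in> A" "b \<in> B" "Xs = [H, C a]" "Ys = [D b]"
      unfolding F src_q_iff tgt_q_iff by blast
    show "cmp F Xs Ys = cmp (fun_of_family H C A D B p) Xs Ys"
      unfolding ab(3,4) W[OF ab(1,2)] cmp_fun_of_family[OF pf ab(1,2)] p[OF ab(1,2)] q(2)[OF ab(1,2)] ..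
  qed (simp_all add: F fun_of_family_brel[OF pf])
  then show ?thesis using fam by blast
qed

lemma fun_of_family_bij:
  "bij_betw (fun_of_family H C A D B) families (qfunctions src_q tgt_q)"
  unfolding bij_betw_def
  using fun_of_family_inj fun_of_family_function fun_of_family_surj by blast

end

section \<open>Evaluating the sentence\<close>

lemma replace_split:
  assumes ctx: "distinct ctx" "distinct vs" "set vs \<subseteq> set ctx" and len: "length xs = length ctx"
  shows "replace ctx vs (reorder ctx vs xs) xs = xs"
proof -
  let ?rest = "filter (\<lambda>v. v \<notin> set vs) ctx"
  have "replace ctx vs (reorder ctx vs xs) xs =
      reorder (vs @ ?rest) ctx (reorder ctx vs xs @ reorder ctx ?rest xs)"
    by (rule replace_eq_reorder[symmetric]) (use ctx len in auto)
  also have "\<dots> = xs" unfolding reorder_append[symmetric]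
    by (rule reorder_inverse) (use ctx len in auto)
  finally show ?thesis .
qed

lemma slice_opers:
  assumes ctx: "distinct ctx" "distinct vs" "set vs \<subseteq> set ctx" and len: "length Xs = length ctx"
    and tame: "\<forall>X\<in>set Xs. tame X" and k: "k \<in> opers Xs []" and xs: "xs \<in> vecs Xs"
  shows "form (reorder ctx vs Xs) (\<lambda>us. k [] (replace ctx vs us xs)) \<in> opers (reorder ctx vs Xs) []"
proof -
  define rest where "rest = filter (\<lambda>v. v \<notin> set vs) ctx"
  define ws where "ws = vs @ rest"
  define Us Rs where "Us = reorder ctx vs Xs" and "Rs = reorder ctx rest Xs"
  have ws: "distinct ws" "set ws = set ctx" using ctx by (auto simp: ws_def rest_def)
  have Zs: "reorder ctx ws Xs = Us @ Rs" by (simp add: ws_def Us_def Rs_def reorder_append)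
  have bk: "reorder ws ctx (Us @ Rs) = Xs" unfolding Zs[symmetric]
    by (rule reorder_inverse) (use ctx ws len in auto)
  have lxs: "length xs = length ctx" using length_listset[OF xs] len by simp
  have rs: "reorder ctx rest xs \<in> vecs Rs" unfolding Rs_def
    by (rule reorder_vecs) (use ctx len xs in \<open>auto simp: rest_def\<close>)
  have tU: "\<forall>X\<in>set Us. tame X"
  proof
    fix X assume "X \<in> set Us"
    then obtain j where j: "j < length vs" "X = Us ! j" by (auto simp: in_set_conv_nth Us_def)
    obtain i where i: "i < length ctx" "vs ! j = ctx ! i" using set_nthE[OF ctx(3) j(1)] .
    have "X = Xs ! i" unfolding j(2) Us_def by (rule reorder_nth[OF ctx(1) len i(1) j(1) i(2)])
    then show "tame X" using tame i len by simp
  qed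
  have "mlin (Us @ Rs) (\<lambda>zs. k [] (reorder ws ctx zs))"
  proof (rule mlin_reorder[OF ws(1) ctx(1) ws(2)[symmetric]])
    show "length (Us @ Rs) = length ws" by (simp add: Us_def Rs_def ws_def)
    show "mlin (reorder ws ctx (Us @ Rs)) (k [])" unfolding bk using k by (simp add: forms_iff)
  qed
  then have "mlin Us (\<lambda>us. k [] (reorder ws ctx (us @ reorder ctx rest xs)))"
    by (rule mlin_append_left[OF _ rs])
  then have "form Us (\<lambda>us. k [] (reorder ws ctx (us @ reorder ctx rest xs))) \<in> opers Us []"
    by (rule form_in_opers[OF tU])
  moreover have "form Us (\<lambda>us. k [] (reorder ws ctx (us @ reorder ctx rest xs))) =
      form Us (\<lambda>us. k [] (replace ctx vs us xs))"
  proof (rule form_cong)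
    fix us assume "us \<in> vecs Us"
    then have "length us = length vs" using length_listset[of us] by (simp add: Us_def)
    then show "k [] (reorder ws ctx (us @ reorder ctx rest xs)) = k [] (replace ctx vs us xs)"
      unfolding ws_def using replace_eq_reorder[OF ctx(1,3) lxs, of us rest] by (simp add: rest_def)
  qed
  ultimately show ?thesis by (simp add: Us_def)
qed

lemma sem_Atm_top:
  assumes R: "R \<in> rels (map sort_of vs)" and ctx: "distinct ctx" "distinct vs" "set vs \<subseteq> set ctx"
    "tame_ctx ctx" and Xs: "Xs \<in> atoms_of ctx"
    and top: "cmp R (reorder ctx vs Xs) [] = opers (reorder ctx vs Xs) []"
  shows "sem ctx (Atm R (map Var vs)) Xs = opers Xs []"
proof -
  have len: "length Xs = length ctx" using length_listset[OF Xs] by simp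
  have "form (reorder ctx vs Xs) (\<lambda>us. k [] (replace ctx vs us xs)) \<in> opers (reorder ctx vs Xs) []"
    if "k \<in> opers Xs []" "xs \<in> vecs Xs" for k xs
    by (rule slice_opers[OF ctx(1-3) len tame_atoms[OF ctx(4) Xs] that])
  then show ?thesis unfolding sem_Atm[OF R ctx Xs] top by blast
qed

lemma sem_Atm_bot:
  assumes R: "R \<in> rels (map sort_of vs)" and ctx: "distinct ctx" "distinct vs" "set vs \<subseteq> set ctx"
    "tame_ctx ctx" and Xs: "Xs \<in> atoms_of ctx"
    and bot: "cmp R (reorder ctx vs Xs) [] = {op_zero}"
  shows "sem ctx (Atm R (map Var vs)) Xs = {op_zero}"
proof -
  have len: "length Xs = length ctx" using length_listset[OF Xs] by simp
  have "k = op_zero" if k: "k \<in> opers Xs []"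
    and z: "\<forall>xs\<in>vecs Xs. form (reorder ctx vs Xs) (\<lambda>us. k [] (replace ctx vs us xs)) = op_zero" for k
  proof (rule forms_eqI[OF k])
    fix xs assume xs: "xs \<in> vecs Xs"
    have "form (reorder ctx vs Xs) (\<lambda>us. k [] (replace ctx vs us xs)) [] (reorder ctx vs xs) = 0"
      using z xs by (simp add: op_zero_def)
    moreover have "reorder ctx vs xs \<in> vecs (reorder ctx vs Xs)"
      by (rule reorder_vecs) (use ctx len xs in auto)
    ultimately show "k [] xs = op_zero [] xs"
      using replace_split[OF ctx(1-3), of xs] length_listset[OF xs] len by (simp add: op_zero_def)
  qed simp
  moreover have "form Us (\<lambda>us. op_zero [] (h us)) = op_zero" for Us h
    by (simp add: form_def op_zero_def)
  ultimately show ?thesis unfolding sem_Atm[OF R ctx Xs] bot by auto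
qed

text \<open>
  Between the two quantifiers there is a double negation of a universal formula, which cancels.
\<close>

lemma sem_ExEq_ExEq:
  assumes Q: "sort_of y = Q" "sort_of y' = qdual Q" "sort_of z = P" "sort_of z' = qdual P"
    and dist: "distinct (z # z' # y # y' # ctx)" and tame: "\<forall>X\<in>Q. tame X" "\<forall>X\<in>P. tame X" "tame_ctx ctx"
    and wf: "wf_fm (z # z' # y # y' # ctx) \<phi>" and Xs: "Xs \<in> atoms_of ctx"
  shows "sem ctx (ExEq y y' (ExEq z z' \<phi>)) Xs = perp Xs {k \<in> opers Xs []. \<forall>Y\<in>Q. \<forall>Z\<in>P.
    eval_tensor Z (eval_tensor Y k) \<in> perp (Z # dual Z # Y # dual Y # Xs)
      (sem (z # z' # y # y' # ctx) \<phi> (Z # dual Z # Y # dual Y # Xs))}"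
proof -
  have tc: "tame_ctx (y # y' # ctx)" using tame Q by (auto simp: qdual_def)
  have inner: "perp (Y # dual Y # Xs) (sem (y # y' # ctx) (ExEq z z' \<phi>) (Y # dual Y # Xs)) =
    {k \<in> opers (Y # dual Y # Xs) []. \<forall>Z\<in>P. eval_tensor Z k \<in> perp (Z # dual Z # Y # dual Y # Xs)
      (sem (z # z' # y # y' # ctx) \<phi> (Z # dual Z # Y # dual Y # Xs))}" (is "_ = ?L") if Y: "Y \<in> Q" for Y
  proof -
    let ?c = "y # y' # ctx" and ?Z = "Y # dual Y # Xs"
    have YX: "?Z \<in> atoms_of ?c" using Y Xs Q by (simp add: qdual_def)
    have "sem ?c (AllEq z z' (Neg \<phi>)) ?Z = {k \<in> opers ?Z []. \<forall>X\<in>P.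
        eval_tensor X k \<in> sem (z # z' # ?c) (Neg \<phi>) (X # dual X # ?Z)}"
      by (rule sem_AllEq[OF Q(3,4) dist tame(2) tc wf_Neg[OF wf] YX])
    also have "\<dots> = ?L"
    proof (intro Collect_cong conj_cong refl ball_cong)
      fix k X assume X: "X \<in> P"
      have "sem (z # z' # ?c) (Neg \<phi>) (X # dual X # ?Z) =
          perp (X # dual X # ?Z) (sem (z # z' # ?c) \<phi> (X # dual X # ?Z))"
        by (rule sem_Neg[OF wf]) (use X YX Q in \<open>simp add: qdual_def\<close>)
      then show "eval_tensor X k \<in> sem (z # z' # ?c) (Neg \<phi>) (X # dual X # ?Z) \<longleftrightarrow>
          eval_tensor X k \<in> perp (X # dual X # ?Z) (sem (z # z' # ?c) \<phi> (X # dual X # ?Z))"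
        by (simp only:)
    qed
    finally have L: "sem ?c (AllEq z z' (Neg \<phi>)) ?Z = ?L" .
    have "perp ?Z (perp ?Z ?L) = ?L"
      unfolding L[symmetric]
      by (intro perp_perp tame_atoms[OF tc YX] sem_subspace sem_opers YX wf_AllEq)
    then show ?thesis
      unfolding sem_ExEq[OF Q(3,4) dist tame(2) tc wf YX] .
  qed
  have "distinct (y # y' # ctx)" using dist by simp
  from sem_ExEq[OF Q(1,2) this tame(1,3) wf_ExEq Xs, of z z' \<phi>]
  have "sem ctx (ExEq y y' (ExEq z z' \<phi>)) Xs = perp Xs {k \<in> opers Xs []. \<forall>Y\<in>Q.
      eval_tensor Y k \<in> perp (Y # dual Y # Xs) (sem (y # y' # ctx) (ExEq z z' \<phi>) (Y # dual Y # Xs))}" .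
  also have "{k \<in> opers Xs []. \<forall>Y\<in>Q.
      eval_tensor Y k \<in> perp (Y # dual Y # Xs) (sem (y # y' # ctx) (ExEq z z' \<phi>) (Y # dual Y # Xs))} =
    {k \<in> opers Xs []. \<forall>Y\<in>Q. \<forall>Z\<in>P. eval_tensor Z (eval_tensor Y k) \<in> perp (Z # dual Z # Y # dual Y # Xs)
      (sem (z # z' # y # y' # ctx) \<phi> (Z # dual Z # Y # dual Y # Xs))}"
  proof (intro Collect_cong conj_cong refl ball_cong)
    fix k Y assume k: "k \<in> opers Xs []" and Y: "Y \<in> Q"
    have "eval_tensor Y k \<in> opers (Y # dual Y # Xs) []" using eval_tensor_opers k Y tame(1) by blast
    then show "eval_tensor Y k \<in> perp (Y # dual Y # Xs) (sem (y # y' # ctx) (ExEq z z' \<phi>) (Y # dual Y # Xs)) \<longleftrightarrow>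
      (\<forall>Z\<in>P. eval_tensor Z (eval_tensor Y k) \<in> perp (Z # dual Z # Y # dual Y # Xs)
        (sem (z # z' # y # y' # ctx) \<phi> (Z # dual Z # Y # dual Y # Xs)))"
      unfolding inner[OF Y] by simp
  qed
  finally show ?thesis .
qed

text \<open>
  The components of \<open>hat F\<close> for the function \<open>F\<close> of a family \<open>p\<close>: a form \<open>\<langle>v| \<otimes> \<dots>\<close> has \<open>v\<close> in
  the range of \<open>p\<close> if and only if it is unchanged when \<open>p\<close> is applied to its first argument.
\<close>

lemma bent_range_iff:
  assumes H: "tame H" and X: "line X" and Y: "line Y" and p: "p \<in> projections H"
    and g: "g \<in> opers [H, X, dual Y] []"
  shows "g \<in> bend [H, X] Y ` bra_op H X Y ` p ` carrier H \<longleftrightarrow>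
    (\<forall>h\<in>carrier H. \<forall>x\<in>carrier X. \<forall>y\<in>carrier Y. g [] [p h, x, y] = g [] [h, x, y])"
proof -
  interpret hermitian H using H by (simp add: tame_def)
  note P = projectionsD[OF p]
  have ev: "bend [H, X] Y (bra_op H X Y v) [] [h, x, y] = ip H v h * ip X (line_vec X) x * ip Y y (line_vec Y)"
    if "h \<in> carrier H" "x \<in> carrier X" "y \<in> carrier Y" for v h x y
    using bend_apply[of "[h, x]" "[H, X]" y Y] that by simp
  show ?thesis
  proof
    assume "g \<in> bend [H, X] Y ` bra_op H X Y ` p ` carrier H"
    then obtain v where v: "g = bend [H, X] Y (bra_op H X Y (p v))" "v \<in> carrier H" by blast
    have "ip H (p v) (p h) = ip H (p v) h" if h: "h \<in> carrier H" for h
      using P(5)[OF P(1)[OF v(2)] h] P(4)[OF v(2)] by simp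
    then show "\<forall>h\<in>carrier H. \<forall>x\<in>carrier X. \<forall>y\<in>carrier Y. g [] [p h, x, y] = g [] [h, x, y]"
      unfolding v(1) using P(1) ev by simp
  next
    assume inv: "\<forall>h\<in>carrier H. \<forall>x\<in>carrier X. \<forall>y\<in>carrier Y. g [] [p h, x, y] = g [] [h, x, y]"
    obtain f where f: "f \<in> opers [H, X] [Y]" "g = bend [H, X] Y f"
      using bend_surj[of "[H, X]" Y g] H X Y g by auto
    obtain v where v: "v \<in> carrier H" "f = bra_op H X Y v" using bra_op_exists[OF H X Y f(1)] by blast
    have "ip H v (p h) = ip H v h" if h: "h \<in> carrier H" for h
    proof -
      have "g [] [p h, line_vec X, line_vec Y] = g [] [h, line_vec X, line_vec Y]"
        using inv h X Y by simp
      then show ?thesis unfolding f(2) v(2) using ev P(1) h X Y by simp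
    qed
    then have "ip H h (p v) = ip H h v" if h: "h \<in> carrier H" for h
      using P(5)[OF h v(1)] ip_sym[OF P(1)[OF h] v(1)] ip_sym[OF h v(1)] h by simp
    then have "p v = v" by (intro ip_ext P(1) v(1))
    then show "g \<in> bend [H, X] Y ` bra_op H X Y ` p ` carrier H"
      unfolding f(2) v(2) using v(1) by (metis imageI)
  qed
qed

lemma op_conj_bend: "op_conj (bend Xs Y f) = bend (map dual Xs) (dual Y) (op_conj f)"
  by (auto simp: op_conj_def bend_def form_def fun_eq_iff comp_def)

lemma conj_bent_range_iff:
  assumes H: "tame H" and X: "line X" and Y: "line Y" and p: "p \<in> projections H"
    and g: "g \<in> opers [dual H, dual X, Y] []"
  shows "g \<in> bend [dual H, dual X] (dual Y) ` op_conj ` bra_op H X Y ` p ` carrier H \<longleftrightarrow>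
    (\<forall>h\<in>carrier H. \<forall>x\<in>carrier X. \<forall>y\<in>carrier Y. g [] [p h, x, y] = g [] [h, x, y])"
proof -
  have "bend [dual H, dual X] (dual Y) (op_conj f) = op_conj (bend [H, X] Y f)" for f
    by (simp add: op_conj_bend)
  then have "bend [dual H, dual X] (dual Y) ` op_conj ` bra_op H X Y ` p ` carrier H =
      op_conj ` bend [H, X] Y ` bra_op H X Y ` p ` carrier H"
    by (simp add: image_image)
  moreover have "g \<in> op_conj ` V \<longleftrightarrow> op_conj g \<in> V" for V
    by (metis image_iff op_conj_op_conj)
  moreover have "op_conj g \<in> opers [H, X, dual Y] []"
    using op_conj_opers[OF g] by simp
  ultimately show ?thesis
    using bent_range_iff[OF H X Y p, of "op_conj g"] by (simp add: op_conj_def)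
qed

text \<open>
  Inner product of a sesquilinear form with a form of rank one.
\<close>

lemma sandwich:
  assumes H: "tame H" and z: "z \<in> carrier H" and y: "y \<in> carrier H"
    and l1: "\<And>h'. h' \<in> carrier H \<Longrightarrow> linear_form H (\<lambda>h. W h h')"
    and l2: "\<And>h. h \<in> carrier H \<Longrightarrow> linear_form (dual H) (W h)"
  shows "(\<Sum>e\<in>onb H. \<Sum>e'\<in>onb H. cnj (W e e') * (ip H e' y * ip H z e)) = cnj (W z y)"
proof -
  interpret hermitian H using H by (simp add: tame_def)
  note oc = onb_carrier[OF H]
  have "W z y = (\<Sum>e\<in>onb H. ip H e z * W e y)"
    by (rule linear_form_expand[OF H l1[OF y] z])
  also have "\<dots> = (\<Sum>e\<in>onb H. \<Sum>e'\<in>onb H. ip H e z * (ip H y e' * W e e'))"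
  proof (rule sum.cong[OF refl])
    fix e assume e: "e \<in> onb H"
    have "W e y = (\<Sum>e'\<in>onb H. ip H y e' * W e e')"
      using linear_form_expand[of "dual H" "W e" y] l2[OF oc[OF e]] H y by simp
    then show "ip H e z * W e y = (\<Sum>e'\<in>onb H. ip H e z * (ip H y e' * W e e'))"
      by (simp add: sum_distrib_left)
  qed
  finally have "cnj (W z y) = (\<Sum>e\<in>onb H. \<Sum>e'\<in>onb H. cnj (ip H e z * (ip H y e' * W e e')))"
    by (simp only: cnj_sum)
  also have "\<dots> = (\<Sum>e\<in>onb H. \<Sum>e'\<in>onb H. cnj (W e e') * (ip H e' y * ip H z e))"
  proof (intro sum.cong refl)
    fix e e' assume "e \<in> onb H" "e' \<in> onb H"
    then have "e \<in> carrier H" "e' \<in> carrier H" using oc by auto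
    then show "cnj (ip H e z * (ip H y e' * W e e')) = cnj (W e e') * (ip H e' y * ip H z e)"
      using ip_sym[of z e] ip_sym[of e' y] z y by simp
  qed
  finally show ?thesis by simp
qed

lemma replace_Nil: "replace [] vs us ts = []"
  by (simp add: replace_def)

lemma replace_Cons:
  assumes "c \<notin> set cs"
  shows "replace (c # cs) vs us (t # ts) =
    (case map_of (zip vs us) c of None \<Rightarrow> t | Some u \<Rightarrow> u) # replace cs vs us ts"
proof -
  have "the ((map_of (zip (c # cs) (t # ts)) ++ map_of (zip vs us)) v) = the ((map_of (zip cs ts) ++ map_of (zip vs us)) v)"
    if "v \<in> set cs" for v
    using that assms by (auto simp: map_add_def split: option.split)
  then show ?thesis by (simp add: replace_def map_add_def split: option.split)
qed

context quantum_functions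
begin

lemma tame_src_q: "Xs \<in> listset src_q \<Longrightarrow> \<forall>X\<in>set Xs. tame X"
  unfolding src_q_iff by auto

lemma tame_tgt: "\<forall>X\<in>D ` B. tame X"
  by auto

context
  fixes p assumes p: "p \<in> proj_families H A B"
begin

abbreviation Fp :: "'v brel" where "Fp \<equiv> fun_of_family H C A D B p"

lemma hat_F_rels: "hat Fp \<in> rels [{H}, C ` A, qdual (D ` B)]"
  using hat_rels[OF fun_of_family_brel[OF p] tame_tgt tame_src_q] by simp

lemma cmp_hat_F:
  assumes "a \<in> A" "b \<in> B"
  shows "cmp (hat Fp) [H, C a, dual (D b)] [] = bend [H, C a] (D b) ` K a b ` p a b ` carrier H"
proof -
  have "cmp (hat Fp) ([H, C a] @ [dual (D b)]) [] = bend [H, C a] (D b) ` cmp Fp [H, C a] [D b]"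
    by (rule cmp_hat[OF fun_of_family_brel[OF p] tame_tgt tame_src_q]) (use assms in auto)
  then show ?thesis by (simp add: cmp_fun_of_family[OF p assms])
qed

lemma conj_F_brel: "is_brel (conj_rel Fp)" "src (conj_rel Fp) = map qdual src_q" "tgt (conj_rel Fp) = [qdual (D ` B)]"
  using is_brel_conj_rel[OF fun_of_family_brel(1)[OF p]] fun_of_family_brel(2,3)[OF p] by simp_all

lemma tame_conj: "\<forall>X\<in>qdual (D ` B). tame X" "Xs \<in> listset (map qdual src_q) \<Longrightarrow> \<forall>X\<in>set Xs. tame X"
proof -
  show "\<forall>X\<in>qdual (D ` B). tame X" by (auto simp: qdual_def)
  assume "Xs \<in> listset (map qdual src_q)"
  then have "\<forall>X\<in>set (map dual Xs). tame X" unfolding listset_qdual by (rule tame_src_q)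
  then show "\<forall>X\<in>set Xs. tame X" by simp
qed

lemma hat_conj_F_rels: "hat (conj_rel Fp) \<in> rels [qdual {H}, qdual (C ` A), D ` B]"
  using hat_rels[OF conj_F_brel tame_conj] by simp

lemma cmp_hat_conj_F:
  assumes "a \<in> A" "b \<in> B"
  shows "cmp (hat (conj_rel Fp)) [dual H, dual (C a), D b] [] =
    bend [dual H, dual (C a)] (dual (D b)) ` op_conj ` K a b ` p a b ` carrier H"
proof -
  have XY: "[dual H, dual (C a)] \<in> listset (map qdual src_q)" "dual (D b) \<in> qdual (D ` B)"
    using assms by (simp_all add: qdual_def)
  have "cmp (hat (conj_rel Fp)) ([dual H, dual (C a)] @ [dual (dual (D b))]) [] =
      bend [dual H, dual (C a)] (dual (D b)) ` cmp (conj_rel Fp) [dual H, dual (C a)] [dual (D b)]"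
    by (rule cmp_hat[OF conj_F_brel tame_conj XY])
  also have "cmp (conj_rel Fp) [dual H, dual (C a)] [dual (D b)] = op_conj ` cmp Fp [H, C a] [D b]"
    using XY cmp_conj_rel[of "[dual H, dual (C a)]" Fp "[dual (D b)]"] fun_of_family_brel[OF p] by simp
  finally show ?thesis by (simp add: cmp_fun_of_family[OF p assms])
qed

lemma sem_hat_F:
  assumes sorts: "map sort_of vs = [{H}, C ` A, qdual (D ` B)]"
    and ctx: "distinct ctx" "distinct vs" "set vs \<subseteq> set ctx" "tame_ctx ctx" and Xs: "Xs \<in> atoms_of ctx"
    and re: "reorder ctx vs Xs = [H, C a, dual (D b)]" and ab: "a \<in> A" "b \<in> B"
  shows "sem ctx (Atm (hat Fp) (map Var vs)) Xs = {k \<in> opers Xs []. \<forall>xs\<in>vecs Xs.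
    \<forall>h\<in>carrier H. \<forall>c\<in>carrier (C a). \<forall>d\<in>carrier (D b).
      k [] (replace ctx vs [p a b h, c, d] xs) = k [] (replace ctx vs [h, c, d] xs)}"
proof -
  have R: "hat Fp \<in> rels (map sort_of vs)" using hat_F_rels sorts by simp
  have len: "length Xs = length ctx" using length_listset[OF Xs] by simp
  show ?thesis
    unfolding sem_Atm[OF R ctx Xs] re
  proof (intro Collect_cong conj_cong refl ball_cong)
    fix k xs assume k: "k \<in> opers Xs []" and xs: "xs \<in> vecs Xs"
    let ?g = "form [H, C a, dual (D b)] (\<lambda>us. k [] (replace ctx vs us xs))"
    have g: "?g \<in> opers [H, C a, dual (D b)] []"
      using slice_opers[OF ctx(1-3) len tame_atoms[OF ctx(4) Xs] k xs] re by simp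
    show "?g \<in> cmp (hat Fp) [H, C a, dual (D b)] [] \<longleftrightarrow>
        (\<forall>h\<in>carrier H. \<forall>c\<in>carrier (C a). \<forall>d\<in>carrier (D b).
          k [] (replace ctx vs [p a b h, c, d] xs) = k [] (replace ctx vs [h, c, d] xs))"
      unfolding cmp_hat_F[OF ab] bent_range_iff[OF tameH lineC[OF ab(1)] lineD[OF ab(2)] family_proj[OF p ab] g]
      using family_carrier[OF p ab] by simp
  qed
qed

lemma sem_hat_conj_F:
  assumes sorts: "map sort_of vs = [qdual {H}, qdual (C ` A), D ` B]"
    and ctx: "distinct ctx" "distinct vs" "set vs \<subseteq> set ctx" "tame_ctx ctx" and Xs: "Xs \<in> atoms_of ctx"
    and re: "reorder ctx vs Xs = [dual H, dual (C a), D b]" and ab: "a \<in> A" "b \<in> B"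
  shows "sem ctx (Atm (hat (conj_rel Fp)) (map Var vs)) Xs = {k \<in> opers Xs []. \<forall>xs\<in>vecs Xs.
    \<forall>h\<in>carrier H. \<forall>c\<in>carrier (C a). \<forall>d\<in>carrier (D b).
      k [] (replace ctx vs [p a b h, c, d] xs) = k [] (replace ctx vs [h, c, d] xs)}"
proof -
  have R: "hat (conj_rel Fp) \<in> rels (map sort_of vs)" using hat_conj_F_rels sorts by simp
  have len: "length Xs = length ctx" using length_listset[OF Xs] by simp
  show ?thesis
    unfolding sem_Atm[OF R ctx Xs] re
  proof (intro Collect_cong conj_cong refl ball_cong)
    fix k xs assume k: "k \<in> opers Xs []" and xs: "xs \<in> vecs Xs"
    let ?g = "form [dual H, dual (C a), D b] (\<lambda>us. k [] (replace ctx vs us xs))"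
    have g: "?g \<in> opers [dual H, dual (C a), D b] []"
      using slice_opers[OF ctx(1-3) len tame_atoms[OF ctx(4) Xs] k xs] re by simp
    show "?g \<in> cmp (hat (conj_rel Fp)) [dual H, dual (C a), D b] [] \<longleftrightarrow>
        (\<forall>h\<in>carrier H. \<forall>c\<in>carrier (C a). \<forall>d\<in>carrier (D b).
          k [] (replace ctx vs [p a b h, c, d] xs) = k [] (replace ctx vs [h, c, d] xs))"
      unfolding cmp_hat_conj_F[OF ab] conj_bent_range_iff[OF tameH lineC[OF ab(1)] lineD[OF ab(2)] family_proj[OF p ab] g]
      using family_carrier[OF p ab] by simp
  qed
qed

end

end

text \<open>
  The variables \<open>z, z', y, y'\<close> are those that the unfolding of
  \<open>R(F\<^sub>*(x', a1'), F(x, a2))\<close>, for \<open>R\<close> the conjugate of \<open>hat S\<close>, binds for its first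
  and second argument. Fixing them as parameters leaves the terms free of their indices.
\<close>

locale homomorphism_sentence = quantum_functions H C A D B
  for H :: "'v hilb" and C :: "'a \<Rightarrow> 'v hilb" and A :: "'a set" and D :: "'b \<Rightarrow> 'v hilb" and B :: "'b set" +
  fixes p :: "'a \<Rightarrow> 'b \<Rightarrow> 'v \<Rightarrow> 'v" and adjA :: "'a rel" and adjB :: "'b rel"
    and x x' a1 a1' a2 a2' z z' y y' :: "'v var"
  assumes p: "p \<in> families"
    and sorts: "sort_of x = {H}" "sort_of x' = qdual {H}" "sort_of a1 = C ` A" "sort_of a1' = qdual (C ` A)"
      "sort_of a2 = C ` A" "sort_of a2' = qdual (C ` A)"
      "sort_of z = qdual (D ` B)" "sort_of z' = D ` B" "sort_of y = D ` B" "sort_of y' = qdual (D ` B)"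
    and distinct_vars: "distinct [z, z', y, y', a2, a2', a1, a1', x, x']"
begin

lemma pf: "p \<in> proj_families H A B"
  using p by blast

abbreviation "R \<equiv> ord_rel C A C A adjA"
abbreviation "S \<equiv> ord_rel D B D B adjB"
abbreviation "F \<equiv> fun_of_family H C A D B p"
abbreviation "ctx6 \<equiv> [a2, a2', a1, a1', x, x']"
abbreviation "ctx10 \<equiv> [z, z', y, y', a2, a2', a1, a1', x, x']"
abbreviation "atoms6 i j \<equiv> [C j, dual (C j), C i, dual (C i), H, dual H]"
abbreviation "atoms10 b0 b1 i j \<equiv>
  [dual (D b0), D b0, D b1, dual (D b1), C j, dual (C j), C i, dual (C i), H, dual H]"

definition atom_S :: "'v fm" where "atom_S = Atm (conj_rel (hat S)) (map Var [z, y])"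
definition atom_F' :: "'v fm" where "atom_F' = Atm (hat (conj_rel F)) (map Var [x', a1', z'])"
definition atom_F :: "'v fm" where "atom_F = Atm (hat F) (map Var [x, a2, y'])"
definition matrix_fm :: "'v fm" where "matrix_fm = Conj (Conj atom_S atom_F') atom_F"

lemma distinct_vars_rev: "distinct [x', x, a1', a1, a2', a2, y', y, z', z]"
  using distinct_rev[THEN iffD2, OF distinct_vars] by simp

lemma distinct10: "distinct ctx10" and distinct6: "distinct ctx6"
  using distinct_vars by simp_all

lemma tame10: "tame_ctx ctx10" and tame6: "tame_ctx ctx6"
  using sorts by (auto simp: qdual_def)

lemma atoms6_in: "i \<in> A \<Longrightarrow> j \<in> A \<Longrightarrow> atoms6 i j \<in> atoms_of ctx6"
  using sorts by (simp add: qdual_def)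

lemma atoms10_in: "i \<in> A \<Longrightarrow> j \<in> A \<Longrightarrow> b0 \<in> B \<Longrightarrow> b1 \<in> B \<Longrightarrow> atoms10 b0 b1 i j \<in> atoms_of ctx10"
  using sorts by (simp add: qdual_def)

lemma reorder10:
  "reorder ctx10 [z, y] [t0, t1, t2, t3, t4, t5, t6, t7, t8, t9] = [t0, t2]"
  "reorder ctx10 [x', a1', z'] [t0, t1, t2, t3, t4, t5, t6, t7, t8, t9] = [t9, t7, t1]"
  "reorder ctx10 [x, a2, y'] [t0, t1, t2, t3, t4, t5, t6, t7, t8, t9] = [t8, t4, t3]"
  using distinct_vars distinct_vars_rev by (simp_all add: reorder_def)

lemma reorder6: "reorder ctx6 [a1, a2'] [t4, t5, t6, t7, t8, t9] = [t6, t5]"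
  using distinct_vars distinct_vars_rev by (simp_all add: reorder_def)

lemma replace10:
  "replace ctx10 [x', a1', z'] [h, c, d] [t0, t1, t2, t3, t4, t5, t6, t7, t8, t9] = [t0, d, t2, t3, t4, t5, t6, c, t8, h]"
  "replace ctx10 [x, a2, y'] [h, c, d] [t0, t1, t2, t3, t4, t5, t6, t7, t8, t9] = [t0, t1, t2, d, c, t5, t6, t7, h, t9]"
  using distinct_vars distinct_vars_rev by (simp_all add: replace_Cons replace_Nil)

lemma conj_hat_S_rels: "conj_rel (hat S) \<in> rels [qdual (D ` B), D ` B]"
proof -
  have "hat S \<in> rels [D ` B, qdual (D ` B)]" by (rule hat_ord_rel_rels) auto
  from conj_rel_rels[OF this] show ?thesis by simp
qed

lemma cmp_conj_hat_S:
  assumes "b0 \<in> B" "b1 \<in> B"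
  shows "cmp (conj_rel (hat S)) [dual (D b0), D b1] [] =
    (if (b0, b1) \<in> adjB then opers [dual (D b0), D b1] [] else {op_zero})"
proof -
  have S: "hat S \<in> rels [D ` B, qdual (D ` B)]" by (rule hat_ord_rel_rels) auto
  have "dual (D b0) \<in> qdual (D ` B)" using assms by (simp add: qdual_def)
  then have "cmp (conj_rel (hat S)) [dual (D b0), D b1] [] = op_conj ` cmp (hat S) [D b0, dual (D b1)] []"
    using cmp_conj_rel[of "[dual (D b0), D b1]" "hat S" "[]"] relsD(1,2)[OF S] assms by simp
  also have "cmp (hat S) [D b0, dual (D b1)] [] = (if (b0, b1) \<in> adjB then opers [D b0, dual (D b1)] [] else {op_zero})"
    by (rule cmp_hat_ord_rel[OF injD injD assms]) auto
  finally show ?thesis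
    using op_conj_image_opers[of "[dual (D b0), D b1]" "[]"] by (simp add: op_conj_def op_zero_def)
qed

lemma sub10: "set [z, y] \<subseteq> set ctx10" "set [x', a1', z'] \<subseteq> set ctx10" "set [x, a2, y'] \<subseteq> set ctx10"
  and dist10: "distinct [z, y]" "distinct [x', a1', z']" "distinct [x, a2, y']"
  using distinct_vars by auto

lemma wf_matrix: "wf_fm ctx10 atom_S" "wf_fm ctx10 atom_F'" "wf_fm ctx10 atom_F" "wf_fm ctx10 matrix_fm"
proof -
  show S: "wf_fm ctx10 atom_S" unfolding atom_S_def
    by (rule wf_Atm[OF _ distinct10 dist10(1) sub10(1) tame10]) (use conj_hat_S_rels sorts in simp)
  show F': "wf_fm ctx10 atom_F'" unfolding atom_F'_def
    by (rule wf_Atm[OF _ distinct10 dist10(2) sub10(2) tame10]) (use hat_conj_F_rels[OF pf] sorts in simp)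
  show F: "wf_fm ctx10 atom_F" unfolding atom_F_def
    by (rule wf_Atm[OF _ distinct10 dist10(3) sub10(3) tame10]) (use hat_F_rels[OF pf] sorts in simp)
  show "wf_fm ctx10 matrix_fm" unfolding matrix_fm_def by (intro wf_Conj S F F')
qed

abbreviation "d b \<equiv> line_vec (D b)"

abbreviation eval10 :: "'b \<Rightarrow> 'b \<Rightarrow> 'v opr \<Rightarrow> 'v opr" where
  "eval10 b0 b1 k \<equiv> eval_tensor (dual (D b0)) (eval_tensor (D b1) k)"

lemma eval10_opers: "b0 \<in> B \<Longrightarrow> b1 \<in> B \<Longrightarrow> k \<in> opers Xs [] \<Longrightarrow>
    eval10 b0 b1 k \<in> opers (dual (D b0) # D b0 # D b1 # dual (D b1) # Xs) []"
  using eval_tensor_opers[of "dual (D b0)" "eval_tensor (D b1) k"] eval_tensor_opers[of "D b1" k Xs] by simp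

lemma eval10_apply [simp]: "b0 \<in> B \<Longrightarrow> b1 \<in> B \<Longrightarrow> eval10 b0 b1 k [] (d b0 # d b0 # d b1 # d b1 # hs) = k [] hs"
  using eval_tensor_apply[of "d b0" "dual (D b0)" "d b0"] by simp

context
  fixes i j assumes ij: "i \<in> A" "j \<in> A"
begin

abbreviation "A6 \<equiv> atoms6 i j"
abbreviation "A10 b0 b1 \<equiv> atoms10 b0 b1 i j"

lemma sem_matrix:
  assumes b: "b0 \<in> B" "b1 \<in> B"
  shows "sem ctx10 matrix_fm (A10 b0 b1) = sem ctx10 atom_S (A10 b0 b1) \<inter> sem ctx10 atom_F' (A10 b0 b1) \<inter> sem ctx10 atom_F (A10 b0 b1)"
  unfolding matrix_fm_def
  using sem_Conj[OF wf_Conj[OF wf_matrix(1,2)] atoms10_in[OF ij b], of atom_F] sem_Conj[OF wf_matrix(1) atoms10_in[OF ij b], of atom_F']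
  by (simp del: interp.simps)

lemma sem_atom_S:
  assumes b: "b0 \<in> B" "b1 \<in> B"
  shows "sem ctx10 atom_S (A10 b0 b1) = (if (b0, b1) \<in> adjB then opers (A10 b0 b1) [] else {op_zero})"
proof -
  have R: "conj_rel (hat S) \<in> rels (map sort_of [z, y])" using conj_hat_S_rels sorts by simp
  note A10 = atoms10_in[OF ij b]
  show ?thesis
  proof (cases "(b0, b1) \<in> adjB")
    case True
    have "sem ctx10 atom_S (A10 b0 b1) = opers (A10 b0 b1) []"
      unfolding atom_S_def
      by (rule sem_Atm_top[OF R distinct10 dist10(1) sub10(1) tame10 A10])
        (use True cmp_conj_hat_S[OF b] in \<open>simp only: reorder10 if_True simp_thms\<close>)
    then show ?thesis using True by (simp only: if_True simp_thms)
  next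
    case False
    have "sem ctx10 atom_S (A10 b0 b1) = {op_zero}"
      unfolding atom_S_def
      by (rule sem_Atm_bot[OF R distinct10 dist10(1) sub10(1) tame10 A10])
        (use False cmp_conj_hat_S[OF b] in \<open>simp only: reorder10 if_False simp_thms\<close>)
    then show ?thesis using False by (simp only: if_False simp_thms)
  qed
qed

lemma sem_atom_F':
  assumes b: "b0 \<in> B" "b1 \<in> B"
  shows "sem ctx10 atom_F' (A10 b0 b1) = {k \<in> opers (A10 b0 b1) []. \<forall>xs\<in>vecs (A10 b0 b1).
    \<forall>h\<in>carrier H. \<forall>c\<in>carrier (C i). \<forall>d\<in>carrier (D b0).
      k [] (replace ctx10 [x', a1', z'] [p i b0 h, c, d] xs) = k [] (replace ctx10 [x', a1', z'] [h, c, d] xs)}"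
  unfolding atom_F'_def
  by (rule sem_hat_conj_F[OF pf _ distinct10 dist10(2) sub10(2) tame10 atoms10_in[OF ij b] _ ij(1) b(1)])
    (simp_all add: sorts reorder10)

lemma sem_atom_F:
  assumes b: "b0 \<in> B" "b1 \<in> B"
  shows "sem ctx10 atom_F (A10 b0 b1) = {k \<in> opers (A10 b0 b1) []. \<forall>xs\<in>vecs (A10 b0 b1).
    \<forall>h\<in>carrier H. \<forall>c\<in>carrier (C j). \<forall>d\<in>carrier (D b1).
      k [] (replace ctx10 [x, a2, y'] [p j b1 h, c, d] xs) = k [] (replace ctx10 [x, a2, y'] [h, c, d] xs)}"
  unfolding atom_F_def
  by (rule sem_hat_F[OF pf _ distinct10 dist10(3) sub10(3) tame10 atoms10_in[OF ij b] _ ij(2) b(2)])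
    (simp_all add: sorts reorder10)

abbreviation "c1 \<equiv> line_vec (C i)"
abbreviation "c2 \<equiv> line_vec (C j)"
lemma carr: "c1 \<in> carrier (C i)" "c2 \<in> carrier (C j)" "b \<in> B \<Longrightarrow> d b \<in> carrier (D b)"
  using ij by simp_all

lemma sem_matrix_invariant:
  assumes b: "b0 \<in> B" "b1 \<in> B" and w: "w \<in> sem ctx10 matrix_fm (A10 b0 b1)"
    and h: "h \<in> carrier H" "h' \<in> carrier H"
  shows "w [] [d b0, d b0, d b1, d b1, c2, c2, c1, c1, p j b1 h, h'] = w [] [d b0, d b0, d b1, d b1, c2, c2, c1, c1, h, h']"
    and "w [] [d b0, d b0, d b1, d b1, c2, c2, c1, c1, h, p i b0 h'] = w [] [d b0, d b0, d b1, d b1, c2, c2, c1, c1, h, h']"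
proof -
  let ?xs = "[d b0, d b0, d b1, d b1, c2, c2, c1, c1, h, h']"
  have xs: "?xs \<in> vecs (A10 b0 b1)" using h b carr by simp
  have wF: "w \<in> sem ctx10 atom_F (A10 b0 b1)" "w \<in> sem ctx10 atom_F' (A10 b0 b1)"
    using w unfolding sem_matrix[OF b] by blast+
  have "w [] (replace ctx10 [x, a2, y'] [p j b1 h, c2, d b1] ?xs) = w [] (replace ctx10 [x, a2, y'] [h, c2, d b1] ?xs)"
    using wF(1) xs h carr b unfolding sem_atom_F[OF b] by blast
  then show "w [] [d b0, d b0, d b1, d b1, c2, c2, c1, c1, p j b1 h, h'] = w [] ?xs"
    unfolding replace10 .
  have "w [] (replace ctx10 [x', a1', z'] [p i b0 h', c1, d b0] ?xs) = w [] (replace ctx10 [x', a1', z'] [h', c1, d b0] ?xs)"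
    using wF(2) xs h carr b unfolding sem_atom_F'[OF b] by blast
  then show "w [] [d b0, d b0, d b1, d b1, c2, c2, c1, c1, h, p i b0 h'] = w [] ?xs"
    unfolding replace10 .
qed

abbreviation eval6 :: "'v opr \<Rightarrow> 'v opr" where
  "eval6 k \<equiv> eval_tensor (C j) (eval_tensor (C i) k)"

lemma eval6_opers: "k \<in> opers Xs [] \<Longrightarrow> eval6 k \<in> opers (C j # dual (C j) # C i # dual (C i) # Xs) []"
  using ij by (intro eval_tensor_opers) simp_all

lemma eval6_apply [simp]: "eval6 k [] (c2 # c2 # c1 # c1 # hs) = k [] hs"
  using ij by simp

lemma form_ip6: "form_ip A6 l k = (\<Sum>e\<in>onb H. \<Sum>e'\<in>onb H.
    cnj (l [] [c2, c2, c1, c1, e, e']) * k [] [c2, c2, c1, c1, e, e'])"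
  using ij by (simp add: form_ip_def sum_listset_Cons onb_line)

lemma form_ip10: "b0 \<in> B \<Longrightarrow> b1 \<in> B \<Longrightarrow> form_ip (A10 b0 b1) l k = (\<Sum>e\<in>onb H. \<Sum>e'\<in>onb H.
    cnj (l [] [d b0, d b0, d b1, d b1, c2, c2, c1, c1, e, e']) * k [] [d b0, d b0, d b1, d b1, c2, c2, c1, c1, e, e'])"
  using ij by (simp add: form_ip_def sum_listset_Cons onb_line)

text \<open>
  The complement of the existential formula: existential quantifiers are negated universal ones.
\<close>

definition test_forms :: "'v opr set" where
  "test_forms = {k \<in> opers A6 []. \<forall>b0\<in>B. \<forall>b1\<in>B. \<forall>w\<in>sem ctx10 matrix_fm (A10 b0 b1).
     form_ip (A10 b0 b1) w (eval10 b0 b1 k) = 0}"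

lemma sem_exists: "sem ctx6 (ExEq y y' (ExEq z z' matrix_fm)) A6 = perp A6 test_forms"
proof -
  have Q: "sort_of y = D ` B" "sort_of y' = qdual (D ` B)" "sort_of z = qdual (D ` B)" "sort_of z' = qdual (qdual (D ` B))"
    using sorts by simp_all
  have tame: "\<forall>X\<in>D ` B. tame X" "\<forall>X\<in>qdual (D ` B). tame X" by (auto simp: qdual_def)
  have "sem ctx6 (ExEq y y' (ExEq z z' matrix_fm)) A6 = perp A6 {k \<in> opers A6 []. \<forall>Y\<in>D ` B. \<forall>Z\<in>qdual (D ` B).
    eval_tensor Z (eval_tensor Y k) \<in> perp (Z # dual Z # Y # dual Y # A6)
      (sem ctx10 matrix_fm (Z # dual Z # Y # dual Y # A6))}"
    by (rule sem_ExEq_ExEq[OF Q distinct10 tame tame6 wf_matrix(4) atoms6_in[OF ij]])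
  also have "{k \<in> opers A6 []. \<forall>Y\<in>D ` B. \<forall>Z\<in>qdual (D ` B).
    eval_tensor Z (eval_tensor Y k) \<in> perp (Z # dual Z # Y # dual Y # A6)
      (sem ctx10 matrix_fm (Z # dual Z # Y # dual Y # A6))} =
    {k \<in> opers A6 []. \<forall>b1\<in>B. \<forall>b0\<in>B. eval10 b0 b1 k \<in> perp (A10 b0 b1) (sem ctx10 matrix_fm (A10 b0 b1))}"
    by (simp add: qdual_def del: interp.simps)
  also have "\<dots> = test_forms"
    unfolding test_forms_def perp_def using eval10_opers[of _ _ _ A6] by blast
  finally show ?thesis .
qed

end

end

lemma linear_form_zero:
  assumes "tame X" "linear_form X f"
  shows "f \<zero>\<^bsub>X\<^esub> = 0"
proof -
  interpret hermitian X using assms(1) by (simp add: tame_def)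
  have "f (\<zero>\<^bsub>X\<^esub> \<oplus>\<^bsub>X\<^esub> \<zero>\<^bsub>X\<^esub>) = f \<zero>\<^bsub>X\<^esub> + f \<zero>\<^bsub>X\<^esub>"
    using assms(2) zero_closed unfolding linear_form_def by blast
  then show ?thesis by simp
qed

context homomorphism_sentence
begin

context
  fixes i j assumes ij: "i \<in> A" "j \<in> A"
begin

text \<open>
  The summand of \<open>1\<^sub>H\<close> at adjacent \<open>b0, b1\<close> is invariant since projections are idempotent.
\<close>

lemma product_form_in_matrix:
  assumes b: "b0 \<in> B" "b1 \<in> B" "(b0, b1) \<in> adjB"
  shows "eval10 b0 b1 (eval6 i j (form [H, dual H] (\<lambda>us. ip H (us ! 1) (p i b0 (p j b1 (us ! 0))))))
    \<in> sem ctx10 matrix_fm (A10 i j b0 b1)" (is "?w \<in> _")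
proof -
  note P1 = H.projectionsD[OF family_proj[OF pf ij(1) b(1)]] and P2 = H.projectionsD[OF family_proj[OF pf ij(2) b(2)]]
  let ?g = "\<lambda>us. ip H (us ! 1) (p i b0 (p j b1 (us ! 0)))"
  have "mlin [H, dual H] ?g"
    using P1(1) P2(1) tame_linear_ip_dual[OF tameH]
    by (auto simp: ball_listset_Cons linear_form_def P1(2,3) P2(2,3) H.ip_add_right H.ip_smult_right H.ip_add_left H.ip_smult_left)
  then have "form [H, dual H] ?g \<in> opers [H, dual H] []" by (intro form_in_opers) simp_all
  then have "?w \<in> opers (A10 i j b0 b1) []" by (intro eval10_opers eval6_opers ij b)
  moreover define w where "w = ?w"
  ultimately have w: "w \<in> opers (A10 i j b0 b1) []" by (simp only:)
  have val: "w [] [t0, t1, t2, t3, t4, t5, t6, t7, h, h'] =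
      ip (D b0) t0 t1 * (ip (D b1) t3 t2 * (ip (C j) t5 t4 * (ip (C i) t7 t6 * ip H h' (p i b0 (p j b1 h)))))"
    if "t0 \<in> carrier (D b0)" "t1 \<in> carrier (D b0)" "t2 \<in> carrier (D b1)" "t3 \<in> carrier (D b1)"
      "t4 \<in> carrier (C j)" "t5 \<in> carrier (C j)" "t6 \<in> carrier (C i)" "t7 \<in> carrier (C i)"
      "h \<in> carrier H" "h' \<in> carrier H" for t0 t1 t2 t3 t4 t5 t6 t7 h h'
    unfolding w_def using that eval_tensor_apply[of t0 "dual (D b0)" t1] by simp
  have "w \<in> sem ctx10 atom_F' (A10 i j b0 b1)"
    unfolding sem_atom_F'[OF ij b(1,2)]
  proof (intro CollectI conjI w, unfold list.map ball_listset_Cons carrier_dual, intro ballI, goal_cases)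
    case (1 t0 t1 t2 t3 t4 t5 t6 t7 t8 t9 xs h c d)
    then show ?case using P1(1,4,5) P2(1) by (simp add: replace10 val)
  qed
  moreover have "w \<in> sem ctx10 atom_F (A10 i j b0 b1)"
    unfolding sem_atom_F[OF ij b(1,2)]
  proof (intro CollectI conjI w, unfold list.map ball_listset_Cons carrier_dual, intro ballI, goal_cases)
    case (1 t0 t1 t2 t3 t4 t5 t6 t7 t8 t9 xs h c d)
    then show ?case using P1(1) P2(1,4) by (simp add: replace10 val)
  qed
  moreover have "w \<in> sem ctx10 atom_S (A10 i j b0 b1)"
    unfolding sem_atom_S[OF ij b(1,2)] using b(3) w by (simp only: if_True simp_thms)
  ultimately show ?thesis unfolding sem_matrix[OF ij b(1,2)] w_def by blast
qed

text \<open>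
  Split \<open>1\<^sub>H\<close> into the products \<open>p i b0 \<cdot> p j b1\<close>. Those at adjacent \<open>b0, b1\<close> are orthogonal
  to the test forms by the preceding lemma, and the others are zero.
\<close>

lemma orthogonality_imp_sem:
  assumes orth: "\<And>b0 b1 v. b0 \<in> B \<Longrightarrow> b1 \<in> B \<Longrightarrow> (b0, b1) \<notin> adjB \<Longrightarrow> v \<in> carrier H \<Longrightarrow>
      p i b0 (p j b1 v) = \<zero>\<^bsub>H\<^esub>"
    and k: "k \<in> opers [] []"
  shows "eval6 i j (eval_tensor H k) \<in> perp (A6 i j) (test_forms i j)" (is "?\<kappa> \<in> _")
proof -
  note oc = onb_carrier[OF tameH]
  have pC: "p a b v \<in> carrier H" if "a \<in> A" "b \<in> B" "v \<in> carrier H" for a b v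
    by (rule family_carrier[OF pf that])
  have sum1: "(\<Sum>b\<in>B. ip H u (p a b v)) = ip H u v" if a: "a \<in> A" and uv: "u \<in> carrier H" "v \<in> carrier H" for a u v
  proof -
    have "(\<Sum>b\<in>B. ip H u (p a b v)) = ip H u (finsum H (\<lambda>b. p a b v) B)"
      by (rule H.ip_finsum_right[symmetric]) (use finB pC a uv in auto)
    also have "finsum H (\<lambda>b. p a b v) B = v" using p a uv by (auto simp: sums_to_one_def)
    finally show ?thesis .
  qed
  have "form_ip (A6 i j) l ?\<kappa> = 0" if l: "l \<in> test_forms i j" for l
  proof -
    let ?L = "\<lambda>e e'. l [] [c2 j, c2 j, c1 i, c1 i, e, e']"
    have T: "(\<Sum>e\<in>onb H. \<Sum>e'\<in>onb H. cnj (?L e e') * ip H e' (p i b0 (p j b1 e))) = 0"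
      if b: "b0 \<in> B" "b1 \<in> B" for b0 b1
    proof (cases "(b0, b1) \<in> adjB")
      case False
      then show ?thesis using orth[OF b False] oc by simp
    next
      case True
      let ?g = "form [H, dual H] (\<lambda>us. ip H (us ! 1) (p i b0 (p j b1 (us ! 0))))"
      have "0 = cnj (form_ip (A10 i j b0 b1) (eval10 b0 b1 (eval6 i j ?g)) (eval10 b0 b1 l))"
        using l product_form_in_matrix[OF b True] b unfolding test_forms_def[OF ij] by simp
      also have "\<dots> = (\<Sum>e\<in>onb H. \<Sum>e'\<in>onb H. cnj (?L e e') * ip H e' (p i b0 (p j b1 e)))"
        unfolding form_ip10[OF ij b] eval10_apply[OF b] eval6_apply[OF ij] cnj_sum
        by (intro sum.cong refl) (simp add: oc mult.commute)
      finally show ?thesis by simp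
    qed
    have "form_ip (A6 i j) l ?\<kappa> = (\<Sum>e\<in>onb H. \<Sum>e'\<in>onb H. cnj (?L e e') * (ip H e' e * k [] []))"
      unfolding form_ip6[OF ij] eval6_apply[OF ij] by (intro sum.cong refl) (simp add: oc)
    also have "\<dots> = (\<Sum>e\<in>onb H. \<Sum>e'\<in>onb H. \<Sum>b1\<in>B. \<Sum>b0\<in>B.
        k [] [] * (cnj (?L e e') * ip H e' (p i b0 (p j b1 e))))"
    proof (intro sum.cong refl)
      fix e e' assume "e \<in> onb H" "e' \<in> onb H"
      then have ee: "e \<in> carrier H" "e' \<in> carrier H" using oc by auto
      have ip: "ip H e' e = (\<Sum>b1\<in>B. \<Sum>b0\<in>B. ip H e' (p i b0 (p j b1 e)))"
        using sum1[OF ij(2) ee(2,1)] sum1[OF ij(1) ee(2) pC[OF ij(2) _ ee(1)]] by simp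
      have "cnj (?L e e') * (ip H e' e * k [] []) = (k [] [] * cnj (?L e e')) * ip H e' e"
        by (simp only: mult_ac)
      also have "\<dots> = (\<Sum>b1\<in>B. \<Sum>b0\<in>B. (k [] [] * cnj (?L e e')) * ip H e' (p i b0 (p j b1 e)))"
        unfolding ip sum_distrib_left ..
      finally show "cnj (?L e e') * (ip H e' e * k [] []) =
          (\<Sum>b1\<in>B. \<Sum>b0\<in>B. k [] [] * (cnj (?L e e') * ip H e' (p i b0 (p j b1 e))))"
        by (simp only: mult.assoc)
    qed
    also have "\<dots> = (\<Sum>b1\<in>B. \<Sum>b0\<in>B. k [] [] * (\<Sum>e\<in>onb H. \<Sum>e'\<in>onb H.
        cnj (?L e e') * ip H e' (p i b0 (p j b1 e))))"
      unfolding sum_distrib_left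
      by (simp only: sum.swap[of _ B "onb H"])
    also have "\<dots> = 0" using T by simp
    finally show ?thesis .
  qed
  moreover have "?\<kappa> \<in> opers (A6 i j) []"
    using eval6_opers[OF ij eval_tensor_opers[OF tameH k]] .
  ultimately show ?thesis by (simp add: perp_def)
qed

text \<open>
  Let \<open>b0, b1\<close> be adjacent. Then \<open>b0 \<noteq> b\<close> or \<open>b1 \<noteq> b'\<close>, and accordingly invariance under
  \<open>p i b0\<close> or under \<open>p j b1\<close> annihilates the inner product, because projections at different
  elements of \<open>B\<close> are orthogonal.
\<close>

lemma rank_one_test_form:
  assumes b: "b \<in> B" "b' \<in> B" "(b, b') \<notin> adjB" and uv: "u \<in> carrier H" "v \<in> carrier H"
  shows "eval6 i j (form [H, dual H] (\<lambda>us. ip H (us ! 1) (p i b u) * ip H (p j b' v) (us ! 0)))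
    \<in> test_forms i j" (is "?k \<in> _")
proof -
  let ?y = "p i b u" and ?z = "p j b' v"
  note oc = onb_carrier[OF tameH]
  have yz: "?y \<in> carrier H" "?z \<in> carrier H" using family_carrier[OF pf] ij b uv by auto
  let ?g = "\<lambda>us. ip H (us ! 1) ?y * ip H ?z (us ! 0)"
  have "mlin [H, dual H] ?g"
    using linear_form_const_mult[OF tame_linear_ip[OF tameH yz(2)]] linear_form_mult_const[OF tame_linear_ip_dual[OF tameH yz(1)]]
    by (simp add: ball_listset_Cons)
  then have g: "form [H, dual H] ?g \<in> opers [H, dual H] []" by (intro form_in_opers) simp_all
  have "form_ip (A10 i j b0 b1) w (eval10 b0 b1 ?k) = 0"
    if c: "b0 \<in> B" "b1 \<in> B" and w: "w \<in> sem ctx10 matrix_fm (A10 i j b0 b1)" for b0 b1 w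
  proof -
    let ?W = "\<lambda>h h'. w [] [d b0, d b0, d b1, d b1, c2 j, c2 j, c1 i, c1 i, h, h']"
    have wC: "w \<in> opers (A10 i j b0 b1) []"
      using sem_opers[OF wf_matrix(4) atoms10_in[OF ij c]] w by blast
    have "mlin ([dual (D b0), D b0, D b1, dual (D b1), C j, dual (C j), C i, dual (C i)] @ [H, dual H]) (w [])"
      using wC by (simp add: forms_iff del: mlin.simps)
    from mlin_append_right[OF this, of "[d b0, d b0, d b1, d b1, c2 j, c2 j, c1 i, c1 i]"]
    have "mlin [H, dual H] (\<lambda>us. w [] ([d b0, d b0, d b1, d b1, c2 j, c2 j, c1 i, c1 i] @ us))"
      using ij c by simp
    then have lin: "\<And>h'. h' \<in> carrier H \<Longrightarrow> linear_form H (\<lambda>h. ?W h h')"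
        "\<And>h. h \<in> carrier H \<Longrightarrow> linear_form (dual H) (?W h)"
      by (simp_all add: ball_listset_Cons)
    have "form_ip (A10 i j b0 b1) w (eval10 b0 b1 ?k) =
        (\<Sum>e\<in>onb H. \<Sum>e'\<in>onb H. cnj (?W e e') * (ip H e' ?y * ip H ?z e))"
      unfolding form_ip10[OF ij c] eval10_apply[OF c] eval6_apply[OF ij]
      by (intro sum.cong refl) (simp add: oc)
    also have "\<dots> = cnj (?W ?z ?y)"
      by (rule sandwich[OF tameH yz(2,1) lin])
    also have "?W ?z ?y = 0"
    proof (cases "(b0, b1) \<in> adjB")
      case False
      then have "w = op_zero" using w unfolding sem_matrix[OF ij c] sem_atom_S[OF ij c] by simp
      then show ?thesis by (simp add: op_zero_def)
    next
      case True
      then consider "b0 \<noteq> b" | "b1 \<noteq> b'" using b by blast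
      then show ?thesis
      proof cases
        case 1
        have "?W ?z ?y = ?W ?z (p i b0 ?y)" using sem_matrix_invariant(2)[OF ij c w yz(2,1)] by simp
        also have "p i b0 ?y = \<zero>\<^bsub>H\<^esub>" by (rule family_orthogonal[OF p ij(1) c(1) b(1) 1 uv(1)])
        also have "?W ?z \<zero>\<^bsub>H\<^esub> = 0" using linear_form_zero[OF _ lin(2)[OF yz(2)]] by simp
        finally show ?thesis .
      next
        case 2
        have "?W ?z ?y = ?W (p j b1 ?z) ?y" using sem_matrix_invariant(1)[OF ij c w yz(2,1)] by simp
        also have "p j b1 ?z = \<zero>\<^bsub>H\<^esub>" by (rule family_orthogonal[OF p ij(2) c(2) b(2) 2 uv(2)])
        also have "?W \<zero>\<^bsub>H\<^esub> ?y = 0" using linear_form_zero[OF _ lin(1)[OF yz(1)]] by simp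
        finally show ?thesis .
      qed
    qed
    finally show ?thesis by simp
  qed
  then show ?thesis unfolding test_forms_def[OF ij] using eval6_opers[OF ij g] by blast
qed

text \<open>
  The inner product of \<open>1\<^sub>H\<close> with the rank-one form for \<open>u, v\<close> is \<open>\<langle>p i b u|p j b' v\<rangle>\<close>, up to conjugation;
  for \<open>u = p i b (p j b' v)\<close> this is the square of the norm of \<open>u\<close>.
\<close>

lemma sem_imp_orthogonality:
  assumes \<kappa>: "eval6 i j (eval_tensor H (form [] (\<lambda>_. 1))) \<in> perp (A6 i j) (test_forms i j)" (is "?\<kappa> \<in> _")
    and b: "b \<in> B" "b' \<in> B" "(b, b') \<notin> adjB" and v: "v \<in> carrier H"
  shows "p i b (p j b' v) = \<zero>\<^bsub>H\<^esub>"
proof -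
  note oc = onb_carrier[OF tameH]
  let ?z = "p j b' v" and ?u = "p i b (p j b' v)"
  let ?y = "p i b ?u"
  have z: "?z \<in> carrier H" by (rule family_carrier[OF pf ij(2) b(2) v])
  have u: "?u \<in> carrier H" by (rule family_carrier[OF pf ij(1) b(1) z])
  have y: "?y \<in> carrier H" by (rule family_carrier[OF pf ij(1) b(1) u])
  let ?k = "eval6 i j (form [H, dual H] (\<lambda>us. ip H (us ! 1) ?y * ip H ?z (us ! 0)))"
  have "cnj (ip H ?y ?z) = (\<Sum>e\<in>onb H. \<Sum>e'\<in>onb H. cnj (ip H e' e) * (ip H e' ?y * ip H ?z e))"
    by (rule sandwich[OF tameH z y, symmetric])
      (simp_all add: tame_linear_ip tame_linear_ip_dual)
  also have "\<dots> = cnj (form_ip (A6 i j) ?k ?\<kappa>)"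
    unfolding form_ip6[OF ij] eval6_apply[OF ij] cnj_sum
    by (intro sum.cong refl) (simp add: oc)
  also have "form_ip (A6 i j) ?k ?\<kappa> = 0"
    using \<kappa> rank_one_test_form[OF b u v] by (simp add: perp_def)
  finally have "ip H ?y ?z = 0" by simp
  moreover have "ip H ?y ?z = ip H ?u ?u"
    using H.projectionsD(4,5)[OF family_proj[OF pf ij(1) b(1)]] u z by simp
  ultimately show ?thesis using H.ip_self_0[OF u] by simp
qed

end

definition homomorphism_fm :: "'v fm" where
  "homomorphism_fm = Atm (conj_rel (hat S)) [App (conj_rel F) [Var x', Var a1'], App F [Var x, Var a2]]"

definition edge_fm :: "'v fm" where
  "edge_fm = Atm (hat R) (map Var [a1, a2'])"

lemma hat_R_rels: "hat R \<in> rels (map sort_of [a1, a2'])"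
  using hat_ord_rel_rels[of A C A C adjA] sorts by simp

lemma edge_facts: "distinct [a1, a2']" "set [a1, a2'] \<subseteq> set ctx6"
  using distinct_vars by auto

lemma wf_edge: "wf_fm ctx6 edge_fm"
  unfolding edge_fm_def by (rule wf_Atm[OF hat_R_rels distinct6 edge_facts tame6])

lemma sem_edge:
  assumes ij: "i \<in> A" "j \<in> A"
  shows "sem ctx6 edge_fm (atoms6 i j) = (if (i, j) \<in> adjA then opers (atoms6 i j) [] else {op_zero})"
proof -
  have c: "cmp (hat R) [C i, dual (C j)] [] = (if (i, j) \<in> adjA then opers [C i, dual (C j)] [] else {op_zero})"
    by (rule cmp_hat_ord_rel[OF injC injC ij]) auto
  show ?thesis
  proof (cases "(i, j) \<in> adjA")
    case True
    have "sem ctx6 edge_fm (atoms6 i j) = opers (atoms6 i j) []"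
      unfolding edge_fm_def
      by (rule sem_Atm_top[OF hat_R_rels distinct6 edge_facts tame6 atoms6_in[OF ij]])
        (use True c in \<open>simp only: reorder6 if_True simp_thms\<close>)
    then show ?thesis using True by (simp only: if_True simp_thms)
  next
    case False
    have "sem ctx6 edge_fm (atoms6 i j) = {op_zero}"
      unfolding edge_fm_def
      by (rule sem_Atm_bot[OF hat_R_rels distinct6 edge_facts tame6 atoms6_in[OF ij]])
        (use False c in \<open>simp only: reorder6 if_False simp_thms\<close>)
    then show ?thesis using False by (simp only: if_False simp_thms)
  qed
qed

definition sentence :: "'v fm" where
  "sentence = AllEq x x' (AllEq a1 a1' (AllEq a2 a2' (Impl edge_fm homomorphism_fm)))"

text \<open>
  Three evaluation forms are attached one after the other, and the implication restricts the
  condition to edges, where its premise is \<open>\<top>\<close>.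
\<close>

lemma sem_sentence:
  assumes unfold: "interp ctx6 homomorphism_fm = interp ctx6 (ExEq y y' (ExEq z z' matrix_fm))"
  shows "sem [] sentence [] = {k \<in> opers [] []. \<forall>i\<in>A. \<forall>j\<in>A. (i, j) \<in> adjA \<longrightarrow>
    eval6 i j (eval_tensor H k) \<in> perp (atoms6 i j) (test_forms i j)}"
proof -
  let ?I = "Impl edge_fm homomorphism_fm"
  have wfh: "wf_fm ctx6 homomorphism_fm"
    using wf_ExEq[of ctx6 y y' "ExEq z z' matrix_fm"] by (simp only: wf_fm_def unfold)
  have wfI: "wf_fm ctx6 ?I" by (rule wf_Impl[OF wf_edge wfh])
  have tame: "\<forall>X\<in>{H}. tame X" "\<forall>X\<in>C ` A. tame X" by auto
  have d: "distinct (x # x' # [])" "distinct (a1 # a1' # [x, x'])" "distinct (a2 # a2' # [a1, a1', x, x'])"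
    using distinct_vars by simp_all
  have tc: "tame_ctx []" "tame_ctx [x, x']" "tame_ctx [a1, a1', x, x']" using tame6 by simp_all
  have at: "[] \<in> atoms_of []" "[H, dual H] \<in> atoms_of [x, x']"
    "i \<in> A \<Longrightarrow> [C i, dual (C i), H, dual H] \<in> atoms_of [a1, a1', x, x']" for i
    using sorts by (simp_all add: qdual_def)
  have imp: "\<kappa> \<in> sem ctx6 ?I (atoms6 i j) \<longleftrightarrow>
      ((i, j) \<in> adjA \<longrightarrow> \<kappa> \<in> perp (atoms6 i j) (test_forms i j))"
    if ij: "i \<in> A" "j \<in> A" and \<kappa>: "\<kappa> \<in> opers (atoms6 i j) []" for i j \<kappa>
  proof (cases "(i, j) \<in> adjA")
    case True
    then have "sem ctx6 ?I (atoms6 i j) = sem ctx6 homomorphism_fm (atoms6 i j)"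
      by (intro sem_Impl_top tame6 wf_edge wfh atoms6_in ij) (simp only: sem_edge[OF ij] if_True)
    also have "\<dots> = perp (atoms6 i j) (test_forms i j)" unfolding unfold by (rule sem_exists[OF ij])
    finally show ?thesis using True by simp
  next
    case False
    then have "sem ctx6 ?I (atoms6 i j) = opers (atoms6 i j) []"
      by (intro sem_Impl_bot tame6 wf_edge wfh atoms6_in ij) (simp only: sem_edge[OF ij] if_False)
    then show ?thesis using False \<kappa> by simp
  qed
  have "k \<in> sem [] sentence [] \<longleftrightarrow> (\<forall>i\<in>A. \<forall>j\<in>A. (i, j) \<in> adjA \<longrightarrow>
    eval6 i j (eval_tensor H k) \<in> perp (atoms6 i j) (test_forms i j))" if k: "k \<in> opers [] []" for k
  proof -
    have kH: "eval_tensor H k \<in> opers [H, dual H] []" by (rule eval_tensor_opers[OF tameH k])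
    have k1: "eval_tensor (C i) (eval_tensor H k) \<in> opers [C i, dual (C i), H, dual H] []" if "i \<in> A" for i
      by (rule eval_tensor_opers[OF line_tame[OF lineC[OF that]] kH])
    have k2: "eval6 i j (eval_tensor H k) \<in> opers (atoms6 i j) []" if "i \<in> A" "j \<in> A" for i j
      by (rule eval6_opers[OF that kH])
    have "k \<in> sem [] sentence [] \<longleftrightarrow>
        eval_tensor H k \<in> sem [x, x'] (AllEq a1 a1' (AllEq a2 a2' ?I)) [H, dual H]"
      unfolding sentence_def sem_AllEq[OF sorts(1,2) d(1) tame(1) tc(1) wf_AllEq at(1)] using k by simp
    also have "\<dots> \<longleftrightarrow> (\<forall>i\<in>A. eval_tensor (C i) (eval_tensor H k) \<in>
        sem [a1, a1', x, x'] (AllEq a2 a2' ?I) [C i, dual (C i), H, dual H])"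
      unfolding sem_AllEq[OF sorts(3,4) d(2) tame(2) tc(2) wf_AllEq at(2)] using kH by simp
    also have "\<dots> \<longleftrightarrow> (\<forall>i\<in>A. \<forall>j\<in>A. eval6 i j (eval_tensor H k) \<in> sem ctx6 ?I (atoms6 i j))"
    proof (rule ball_cong[OF refl])
      fix i assume "i \<in> A"
      then show "eval_tensor (C i) (eval_tensor H k) \<in>
          sem [a1, a1', x, x'] (AllEq a2 a2' ?I) [C i, dual (C i), H, dual H] \<longleftrightarrow>
        (\<forall>j\<in>A. eval6 i j (eval_tensor H k) \<in> sem ctx6 ?I (atoms6 i j))"
        unfolding sem_AllEq[OF sorts(5,6) d(3) tame(2) tc(3) wfI at(3)[OF \<open>i \<in> A\<close>]] using k1 by simp
    qed
    also have "\<dots> \<longleftrightarrow> (\<forall>i\<in>A. \<forall>j\<in>A. (i, j) \<in> adjA \<longrightarrow>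
        eval6 i j (eval_tensor H k) \<in> perp (atoms6 i j) (test_forms i j))"
      by (intro ball_cong refl imp k2)
    finally show ?thesis .
  qed
  moreover have "sem [] sentence [] \<subseteq> opers [] []"
    unfolding sentence_def by (rule sem_opers[OF wf_AllEq at(1)])
  ultimately show ?thesis by blast
qed

lemma interp_sentence_iff:
  assumes unfold: "interp ctx6 homomorphism_fm = interp ctx6 (ExEq y y' (ExEq z z' matrix_fm))"
  shows "interp [] sentence = rel_top [] [] \<longleftrightarrow>
    (\<forall>i\<in>A. \<forall>j\<in>A. (i, j) \<in> adjA \<longrightarrow> (\<forall>b\<in>B. \<forall>b'\<in>B. (b, b') \<notin> adjB \<longrightarrow>
       (\<forall>v\<in>carrier H. p i b (p j b' v) = \<zero>\<^bsub>H\<^esub>)))" (is "_ \<longleftrightarrow> ?orth")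
proof -
  have s: "interp [] sentence \<in> rels []" using wf_AllEq[of "[]" x x'] by (simp add: sentence_def wf_fm_def del: interp.simps)
  have t: "rel_top [] [] \<in> rels []" unfolding rel_top_def by (rule rels_mk_rel) simp
  have "interp [] sentence = rel_top [] [] \<longleftrightarrow> sem [] sentence [] = opers [] []"
  proof
    show "sem [] sentence [] = opers [] []" if "interp [] sentence = rel_top [] []"
      unfolding that by (simp add: rel_top_def cmp_mk_rel)
    show "interp [] sentence = rel_top [] []" if "sem [] sentence [] = opers [] []"
      by (rule is_brel_eqI) (use s t that in \<open>auto simp: rels_def rel_top_def cmp_mk_rel simp del: interp.simps\<close>)
  qed
  also have "\<dots> \<longleftrightarrow> ?orth"
  proof
    assume "sem [] sentence [] = opers [] []"
    moreover have "form [] (\<lambda>_. 1) \<in> opers [] []" by (rule form_in_opers) simp_all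
    ultimately have "form [] (\<lambda>_. 1) \<in> sem [] sentence []" by (simp only:)
    then have \<kappa>: "\<forall>i\<in>A. \<forall>j\<in>A. (i, j) \<in> adjA \<longrightarrow>
        eval6 i j (eval_tensor H (form [] (\<lambda>_. 1))) \<in> perp (atoms6 i j) (test_forms i j)"
      unfolding sem_sentence[OF unfold] by blast
    show ?orth
    proof (intro ballI impI)
      fix i j b b' v assume *: "i \<in> A" "j \<in> A" "(i, j) \<in> adjA" "b \<in> B" "b' \<in> B" "(b, b') \<notin> adjB" "v \<in> carrier H"
      show "p i b (p j b' v) = \<zero>\<^bsub>H\<^esub>"
        by (rule sem_imp_orthogonality[OF *(1,2) \<kappa>[rule_format, OF *(1,2,3)] *(4-7)])
    qed
  next
    assume orth: ?orth
    have "eval6 i j (eval_tensor H k) \<in> perp (atoms6 i j) (test_forms i j)"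
      if "i \<in> A" "j \<in> A" "(i, j) \<in> adjA" "k \<in> opers [] []" for i j k
      by (rule orthogonality_imp_sem[OF that(1,2) orth[rule_format, OF that(1-3)] that(4)])
    then show "sem [] sentence [] = opers [] []" unfolding sem_sentence[OF unfold] by blast
  qed
  finally show ?thesis .
qed

end

lemma snd_less_fresh: "v \<in> set ctx \<Longrightarrow> snd v < fresh ctx"
  unfolding fresh_def less_Suc_eq_le by (rule Max_ge) auto

lemma bij_betw_Collect_iff:
  assumes "bij_betw f S T" "\<And>s. s \<in> S \<Longrightarrow> Q (f s) \<longleftrightarrow> P s"
  shows "bij_betw f {s \<in> S. P s} {t \<in> T. Q t}"
  using assms unfolding bij_betw_def inj_on_def by blast

theorem corollary4p6p8:
  fixes A :: "'a set" and adjA :: "'a rel"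
    and B :: "'b set" and adjB :: "'b rel"
    and H :: "'v hilb"
    and C :: "'a \<Rightarrow> 'v hilb" and D :: "'b \<Rightarrow> 'v hilb"
    and R S :: "'v brel"
    and x x' a1 a1' a2 a2' :: "'v var"
  assumes "simple_graph A adjA" and "simple_graph B adjB"
    and "fd_hilbert H" and "carrier H \<noteq> {\<zero>\<^bsub>H\<^esub>}"
    and "line_atoms C A" and "line_atoms D B"
    and "R = ord_rel C A C A adjA" and "S = ord_rel D B D B adjB"
    and "map sort_of [x, x', a1, a1', a2, a2'] =
           [{H}, qdual {H}, C ` A, qdual (C ` A), C ` A, qdual (C ` A)]"
    and "distinct [x, x', a1, a1', a2, a2']"
  shows
    "bij_betw (fun_of_family H C A D B)
       {p \<in> proj_families H A B. sums_to_one H A B p}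
       (qfunctions [{H}, C ` A] [D ` B])
     \<and>
     bij_betw (fun_of_family H C A D B)
       {p \<in> proj_families H A B. witnesses H A adjA B adjB p}
       {F \<in> qfunctions [{H}, C ` A] [D ` B].
          interp []
            (AllEq x x' (AllEq a1 a1' (AllEq a2 a2'
               (Impl (Atm (hat R) [Var a1, Var a2'])
                     (Atm (conj_rel (hat S))
                        [App (conj_rel F) [Var x', Var a1'], App F [Var x, Var a2]])))))
          = rel_top [] []}"
proof -
  interpret quantum_functions H C A D B
    by unfold_locales (use assms(2,3,5,6) in \<open>simp_all add: simple_graph_def\<close>)
  let ?f = "fun_of_family H C A D B"
  let ?true = "\<lambda>F. interp []
            (AllEq x x' (AllEq a1 a1' (AllEq a2 a2'
               (Impl (Atm (hat R) [Var a1, Var a2'])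
                     (Atm (conj_rel (hat S))
                        [App (conj_rel F) [Var x', Var a1'], App F [Var x, Var a2]])))))
          = rel_top [] []"
  have iff: "?true (?f p) \<longleftrightarrow> witnesses H A adjA B adjB p" if p: "p \<in> families" for p
  proof -
    define N where "N = fresh [a2, a2', a1, a1', x, x']"
    define z y z' y' where "z = (qdual (D ` B), N)" and "y = (D ` B, Suc N)"
      and "z' = (D ` B, Suc (Suc N))" and "y' = (qdual (D ` B), Suc (Suc (Suc N)))"
    have less: "\<forall>v\<in>set [a2, a2', a1, a1', x, x']. snd v < N"
      unfolding N_def using snd_less_fresh by blast
    have ne: "w \<noteq> v" if "v \<in> set [a2, a2', a1, a1', x, x']" "w \<in> {z, z', y, y'}" for v w
      using less that(1) that(2) unfolding z_def z'_def y_def y'_def by fastforce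
    interpret homomorphism_sentence H C A D B p adjA adjB x x' a1 a1' a2 a2' z z' y y'
    proof (unfold_locales, goal_cases)
      case 1 then show ?case by (rule p)
    next
      case 12
      have "distinct [a2, a2', a1, a1', x, x']" using assms(10) by auto
      moreover have "distinct [z, z', y, y']" by (simp add: z_def z'_def y_def y'_def)
      moreover have "set [z, z', y, y'] \<inter> set [a2, a2', a1, a1', x, x'] = {}"
      proof (rule equals0I)
        fix v assume "v \<in> set [z, z', y, y'] \<inter> set [a2, a2', a1, a1', x, x']"
        then have "v \<in> {z, z', y, y'}" "v \<in> set [a2, a2', a1, a1', x, x']" by simp_all
        from ne[OF this(2,1)] show False by simp
      qed
      ultimately have "distinct ([z, z', y, y'] @ [a2, a2', a1, a1', x, x'])" by (simp only: distinct_append simp_thms)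
      then show ?case by (simp only: append_Cons append_Nil)
    qed (use assms(9) in \<open>simp_all add: z_def z'_def y_def y'_def\<close>)
    have "src (conj_rel (hat (ord_rel D B D B adjB))) = [qdual (D ` B), D ` B]"
      using conj_hat_S_rels by (simp add: rels_def)
    then have "unfold_atm N (conj_rel (hat (ord_rel D B D B adjB)))
        [App (conj_rel (?f p)) [Var x', Var a1'], App (?f p) [Var x, Var a2]] = ExEq y y' (ExEq z z' matrix_fm)"
      unfolding matrix_fm_def atom_S_def atom_F'_def atom_F_def
      by (simp add: unfold_atm_def Let_def upt_rec z_def z'_def y_def y'_def)
    then have unfold: "interp [a2, a2', a1, a1', x, x'] homomorphism_fm =
        interp [a2, a2', a1, a1', x, x'] (ExEq y y' (ExEq z z' matrix_fm))"
      unfolding homomorphism_fm_def by (simp add: N_def)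
    have "?true (?f p) \<longleftrightarrow> interp [] sentence = rel_top [] []"
      by (simp only: sentence_def edge_fm_def homomorphism_fm_def assms(7,8) list.map)
    also have "\<dots> \<longleftrightarrow> witnesses H A adjA B adjB p"
      unfolding interp_sentence_iff[OF unfold] witnesses_def
      using p family_orthogonal[OF p] by blast
    finally show ?thesis .
  qed
  have first: "bij_betw ?f families (qfunctions [{H}, C ` A] [D ` B])" by (rule fun_of_family_bij)
  moreover have "bij_betw ?f {p \<in> proj_families H A B. witnesses H A adjA B adjB p}
      {F \<in> qfunctions [{H}, C ` A] [D ` B]. ?true F}"
  proof -
    have "{p \<in> proj_families H A B. witnesses H A adjA B adjB p} = {p \<in> families. witnesses H A adjA B adjB p}"
      unfolding witnesses_def by blast
    then show ?thesis using bij_betw_Collect_iff[of ?f _ _ ?true, OF first iff] by (simp only:)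
  qed
  ultimately show ?thesis by blast
qed

end
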